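(* There is a universal constant $C>0$ such that for every integer $n\ge 1$ and every symmetric function $f_n:\{0,1\}^n\to\{0,1\}$, $$R(f_n\Box\wedge)\le C\,\bigl(Q(f_n\Box\wedge)\bigr)^3 .$$
   Context: A function $f_n:\{0,1\}^n\to\{0,1\}$ is symmetric if $f_n(x)$ depends only on the Hamming weight of $x$. $f_n\Box\wedge:\{0,1\}^n\times\{0,1\}^n\to\{0,1\}$ is the function $(f_n\Box\wedge)(x,y)=f_n(x_1\wedge y_1,x_2\wedge y_2,\ldots,x_n\wedge y_n)$. For a function $F(x,y)$ with Alice knowing $x$ and Bob knowing $y$, in the two-way interactive communication model: $R(F)$ is the minimum worst-case number of bits exchanged by a randomized protocol (with unlimited shared randomness) computing $F$ with error probability at most $1/3$ on every input; $Q(F)$ is the minimum worst-case number of qubits exchanged by a quantum protocol (with unlimited prior shared entanglement) computing $F$ with error probability at most $1/3$ on every input. *)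

theory Defs
  imports
    "HOL-Probability.Probability_Mass_Function"
    "Jordan_Normal_Form.Schur_Decomposition"
begin

text \<open>
  Convention for both communication models: when communication ends, one party announces the
  output, using everything this party holds. Which party this is, is known to both players, and
  the announcement itself is not counted. Requiring instead that both players know the output
  costs at most one more bit or qubit. Costs are minima over natural numbers, which are attained
  on finite input domains because Alice can send her whole input.
\<close>

section \<open>Randomized communication complexity\<close>

datatype ('x, 'y) det_protocol =
    Alice_outputs "'x \<Rightarrow> bool"
  | Bob_outputs "'y \<Rightarrow> bool"
  | Alice_sends "'x \<Rightarrow> bool" "bool \<Rightarrow> ('x, 'y) det_protocol"
  | Bob_sends "'y \<Rightarrow> bool" "bool \<Rightarrow> ('x, 'y) det_protocol"

primrec det_output :: "('x, 'y) det_protocol \<Rightarrow> 'x \<Rightarrow> 'y \<Rightarrow> bool" where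
  "det_output (Alice_outputs g) x y = g x"
| "det_output (Bob_outputs g) x y = g y"
| "det_output (Alice_sends m P) x y = det_output (P (m x)) x y"
| "det_output (Bob_sends m P) x y = det_output (P (m y)) x y"

primrec det_bits :: "('x, 'y) det_protocol \<Rightarrow> 'x \<Rightarrow> 'y \<Rightarrow> nat" where
  "det_bits (Alice_outputs g) x y = 0"
| "det_bits (Bob_outputs g) x y = 0"
| "det_bits (Alice_sends m P) x y = Suc (det_bits (P (m x)) x y)"
| "det_bits (Bob_sends m P) x y = Suc (det_bits (P (m y)) x y)"

text \<open>
  A protocol with shared randomness is a probability distribution over deterministic protocols:
  the shared random string selects the deterministic protocol that is run. Private randomness is
  subsumed by shared randomness. A discrete distribution is no restriction on a finite input
  domain, where there are only finitely many input-output-cost behaviours of bounded cost.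
\<close>

definition rand_computes ::
    "'x set \<Rightarrow> 'y set \<Rightarrow> ('x \<Rightarrow> 'y \<Rightarrow> bool) \<Rightarrow> ('x, 'y) det_protocol pmf \<Rightarrow> bool" where
  "rand_computes X Y F M \<longleftrightarrow>
     (\<forall>x\<in>X. \<forall>y\<in>Y. measure_pmf.prob M {P. det_output P x y \<noteq> F x y} \<le> 1/3)"

definition rand_cost_le :: "'x set \<Rightarrow> 'y set \<Rightarrow> ('x, 'y) det_protocol pmf \<Rightarrow> nat \<Rightarrow> bool" where
  "rand_cost_le X Y M c \<longleftrightarrow> (\<forall>P\<in>set_pmf M. \<forall>x\<in>X. \<forall>y\<in>Y. det_bits P x y \<le> c)"

definition rand_cc :: "'x set \<Rightarrow> 'y set \<Rightarrow> ('x \<Rightarrow> 'y \<Rightarrow> bool) \<Rightarrow> nat" where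
  "rand_cc X Y F = (LEAST c. \<exists>M. rand_computes X Y F M \<and> rand_cost_le X Y M c)"


section \<open>Quantum communication complexity with shared entanglement\<close>

definition kron_mat :: "complex mat \<Rightarrow> complex mat \<Rightarrow> complex mat" where
  "kron_mat A B = Matrix.mat (dim_row A * dim_row B) (dim_col A * dim_col B)
     (\<lambda>(i, j). A $$ (i div dim_row B, j div dim_col B) * B $$ (i mod dim_row B, j mod dim_col B))"

definition isometry_mat :: "nat \<Rightarrow> nat \<Rightarrow> complex mat \<Rightarrow> bool" where
  "isometry_mat m n U \<longleftrightarrow> U \<in> carrier_mat m n \<and> mat_adjoint U * U = 1\<^sub>m n"

definition projector_mat :: "nat \<Rightarrow> complex mat \<Rightarrow> bool" where
  "projector_mat n E \<longleftrightarrow> E \<in> carrier_mat n n \<and> mat_adjoint E = E \<and> E * E = E"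

definition norm2_vec :: "complex vec \<Rightarrow> real" where
  "norm2_vec v = Re (v \<bullet>c v)"

text \<open>
  A global state in which Alice's part has dimension \<open>a\<close> and Bob's part has dimension \<open>b\<close> is a
  vector of dimension \<open>a * b\<close>; the basis vector number \<open>i * b + j\<close> is the product of Alice's basis
  vector \<open>i\<close> and Bob's basis vector \<open>j\<close>.

  In a step \<open>Alice_sends_qubit a' U\<close> Alice applies to her part the isometry \<open>U x\<close> into the tensor
  product of a private memory of dimension \<open>a'\<close> and one message qubit (isometries cover unitaries
  together with fresh ancillas), and the qubit then becomes part of Bob's system. As the
  qubit is the last factor on Alice's side and becomes the first one on Bob's side, handing it over
  does not change the global vector: dimensions \<open>(a' * 2) * b\<close> are regrouped as \<open>a' * (2 * b)\<close>.
  The steps of Bob are symmetric. The order of the senders and the number of qubits sent are fixed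
  in advance, independently of the inputs. At the end one party applies a projective measurement,
  given by the projector for output 1, to this party's part.
\<close>

datatype ('x, 'y) q_protocol =
    Alice_measures "'x \<Rightarrow> complex mat"
  | Bob_measures "'y \<Rightarrow> complex mat"
  | Alice_sends_qubit nat "'x \<Rightarrow> complex mat" "('x, 'y) q_protocol"
  | Bob_sends_qubit nat "'y \<Rightarrow> complex mat" "('x, 'y) q_protocol"

primrec q_valid :: "'x set \<Rightarrow> 'y set \<Rightarrow> ('x, 'y) q_protocol \<Rightarrow> nat \<Rightarrow> nat \<Rightarrow> bool" where
  "q_valid X Y (Alice_measures E) a b \<longleftrightarrow> (\<forall>x\<in>X. projector_mat a (E x))"
| "q_valid X Y (Bob_measures E) a b \<longleftrightarrow> (\<forall>y\<in>Y. projector_mat b (E y))"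
| "q_valid X Y (Alice_sends_qubit a' U P) a b \<longleftrightarrow>
     (\<forall>x\<in>X. isometry_mat (a' * 2) a (U x)) \<and> q_valid X Y P a' (2 * b)"
| "q_valid X Y (Bob_sends_qubit b' V P) a b \<longleftrightarrow>
     (\<forall>y\<in>Y. isometry_mat (2 * b') b (V y)) \<and> q_valid X Y P (a * 2) b'"

primrec q_accept_prob ::
    "('x, 'y) q_protocol \<Rightarrow> 'x \<Rightarrow> 'y \<Rightarrow> nat \<Rightarrow> nat \<Rightarrow> complex vec \<Rightarrow> real" where
  "q_accept_prob (Alice_measures E) x y a b \<psi> = norm2_vec (kron_mat (E x) (1\<^sub>m b) *\<^sub>v \<psi>)"
| "q_accept_prob (Bob_measures E) x y a b \<psi> = norm2_vec (kron_mat (1\<^sub>m a) (E y) *\<^sub>v \<psi>)"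
| "q_accept_prob (Alice_sends_qubit a' U P) x y a b \<psi> =
     q_accept_prob P x y a' (2 * b) (kron_mat (U x) (1\<^sub>m b) *\<^sub>v \<psi>)"
| "q_accept_prob (Bob_sends_qubit b' V P) x y a b \<psi> =
     q_accept_prob P x y (a * 2) b' (kron_mat (1\<^sub>m a) (V y) *\<^sub>v \<psi>)"

primrec q_qubits :: "('x, 'y) q_protocol \<Rightarrow> nat" where
  "q_qubits (Alice_measures E) = 0"
| "q_qubits (Bob_measures E) = 0"
| "q_qubits (Alice_sends_qubit a' U P) = Suc (q_qubits P)"
| "q_qubits (Bob_sends_qubit b' V P) = Suc (q_qubits P)"

text \<open>
  The initial state \<open>\<psi>\<close> is an arbitrary bipartite pure state of arbitrary finite dimensions
  \<open>a\<close> and \<open>b\<close>, independent of the inputs; it comprises the prior entanglement and private ancillas.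
\<close>

definition quantum_computes ::
    "'x set \<Rightarrow> 'y set \<Rightarrow> ('x \<Rightarrow> 'y \<Rightarrow> bool) \<Rightarrow>
     nat \<Rightarrow> nat \<Rightarrow> complex vec \<Rightarrow> ('x, 'y) q_protocol \<Rightarrow> bool" where
  "quantum_computes X Y F a b \<psi> P \<longleftrightarrow>
     \<psi> \<in> carrier_vec (a * b) \<and> norm2_vec \<psi> = 1 \<and> q_valid X Y P a b \<and>
     (\<forall>x\<in>X. \<forall>y\<in>Y.
        (if F x y then 1 - q_accept_prob P x y a b \<psi> else q_accept_prob P x y a b \<psi>) \<le> 1/3)"

definition quantum_cc :: "'x set \<Rightarrow> 'y set \<Rightarrow> ('x \<Rightarrow> 'y \<Rightarrow> bool) \<Rightarrow> nat" where
  "quantum_cc X Y F = (LEAST c. \<exists>a b \<psi> P. quantum_computes X Y F a b \<psi> P \<and> q_qubits P = c)"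


section \<open>Symmetric functions and their composition with AND\<close>

definition cube :: "nat \<Rightarrow> bool list set" where
  "cube n = {x. length x = n}"

definition hamming_weight :: "bool list \<Rightarrow> nat" where
  "hamming_weight x = count_list x True"

definition symmetric_fun :: "nat \<Rightarrow> (bool list \<Rightarrow> bool) \<Rightarrow> bool" where
  "symmetric_fun n f \<longleftrightarrow>
     (\<forall>x\<in>cube n. \<forall>y\<in>cube n. hamming_weight x = hamming_weight y \<longrightarrow> f x = f y)"

definition box_and :: "(bool list \<Rightarrow> bool) \<Rightarrow> bool list \<Rightarrow> bool list \<Rightarrow> bool" where
  "box_and f x y = f (map2 (\<and>) x y)"

end

theory Submission
  imports Defs
begin

text \<open>
  Let \<open>m\<close> be the least weight at which the symmetric function changes and put \<open>k = n - m + 1\<close>.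

  Upper bound: the value can differ from the value at weight \<open>0\<close> only if both inputs have fewer
  than \<open>k\<close> zeros. After a random hash of the coordinates into a range of size \<open>O(k\<^sup>2)\<close>, Alice sends
  her hashed set of zeros, and Bob computes the size of the union of both sets of zeros. This
  costs \<open>O(k log k) = O(k\<^sup>3\<^sup>/\<^sup>2)\<close> bits.

  Lower bound: fixing \<open>m - 1\<close> coordinates to \<open>1\<close> leaves a problem on \<open>k\<close> coordinates that
  distinguishes disjoint sets from sets meeting in one point, and it contains the pattern matrix
  of the OR function on \<open>t = k div 4\<close> bits. The acceptance probability of a protocol with
  \<open>q\<close> qubits is a sum of \<open>4^q\<close> inner products of vectors \<open>u x\<close>, \<open>v y\<close> of norm at most \<open>1\<close>. Against
  a function on the cube that is orthogonal to all characters of degree at most \<open>d\<close>, each of these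
  inner products has correlation at most \<open>2^(-d/2)\<close>. Such a function with constant correlation with
  OR exists for \<open>d\<close> of order \<open>sqrt t\<close>; hence \<open>q\<close> is at least of order \<open>sqrt k\<close>.
\<close>

section \<open>Univariate dual weights\<close>

text \<open>Above its first change the function is arbitrary, so a protocol is controlled only at
  intersection sizes 0 and 1. The dual function for OR must therefore have small total mass on all
  larger sizes, and this decides the nodes and constants of the univariate weights.

  Prior entanglement rules out bounds that depend on the dimension of the state. Only norms enter:
  operators of norm at most \<open>1\<close> and a state of norm \<open>1\<close>. A transferred
  qubit has two values, so a step makes the state a sum of two product operators applied to the old
  state. The acceptance probability is quadratic in the state, which costs a factor \<open>4\<close>
  per qubit. The loss \<open>4^q\<close> meets the gain \<open>2^((d+1)/2)\<close>, so
  \<open>d\<close> has to exceed \<open>4 q\<close> only by a constant, and a dual function for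
  degree \<open>d\<close> exists once \<open>t\<close> is at least \<open>49 d^2\<close>.

  Both bounds together leave only a logarithm between \<open>R\<close> and \<open>Q^2\<close>; it is
  estimated by \<open>sqrt k\<close>, which is exactly what a cube can absorb. The case
  \<open>Q = 0\<close> leaves no slack at all and needs \<open>R = 0\<close>.\<close>

lemma lagrange_sum_eq_0:
  fixes p :: "real poly"
  assumes "finite T" "degree p + 1 < card T"
  shows "(\<Sum>s\<in>T. poly p s / (\<Prod>r\<in>T-{s}. s - r)) = 0"
proof -
  define c where "c = (\<lambda>s. poly p s / (\<Prod>r\<in>T-{s}. s - r))"
  define B where "B = (\<lambda>s. \<Prod>r\<in>T-{s}. [:-r,1:])"
  \<comment> \<open>\<open>L\<close> is the Lagrange interpolant of \<open>p\<close> at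
    \<open>T\<close>. The claimed sum, a divided difference, is its coefficient at
    \<open>card T - 1\<close>, and \<open>L = p\<close> has smaller degree.\<close>
  define L where "L = (\<Sum>s\<in>T. Polynomial.smult (c s) (B s))"
  have degB: "degree (B s) = card T - 1" if "s \<in> T" for s
    using assms that unfolding B_def by (subst degree_prod_eq_sum_degree) auto
  have coeffB: "coeff (B s) (card T - 1) = 1" if "s \<in> T" for s
  proof -
    have "lead_coeff (B s) = 1" unfolding B_def by (simp add: lead_coeff_prod)
    then show ?thesis using degB[OF that] by simp
  qed
  have "degree L \<le> card T - 1" unfolding L_def
    by (rule degree_sum_le) (use assms degB in \<open>auto intro: order.trans[OF degree_smult_le]\<close>)
  then have degL: "degree L < card T" using assms by linarith
  have "poly L s = poly p s" if s: "s \<in> T" for s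
  proof -
    have "poly (B r) s = 0" if "r \<in> T" "r \<noteq> s" for r
      using that s assms unfolding B_def by (auto simp: poly_prod)
    then have "poly L s = (\<Sum>r\<in>T. if r = s then c s * poly (B s) s else 0)"
      unfolding L_def by (auto simp: poly_sum intro!: sum.cong)
    also have "\<dots> = c s * poly (B s) s" using s assms by simp
    also have "poly (B s) s = (\<Prod>r\<in>T-{s}. s - r)" unfolding B_def by (simp add: poly_prod)
    also have "c s * \<dots> = poly p s" using assms unfolding c_def by (auto simp: prod_zero_iff)
    finally show ?thesis .
  qed
  then have "L = p" using degL assms by (intro poly_eqI_degree[of T]) auto
  then have "coeff L (card T - 1) = 0" using assms by (intro coeff_eq_0) auto
  moreover have "coeff L (card T - 1) = (\<Sum>s\<in>T. c s)"
    unfolding L_def coeff_sum by (rule sum.cong) (simp_all only: coeff_smult coeffB mult_1_right)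
  ultimately show ?thesis by (simp add: c_def)
qed

text \<open>Monomials averaged over a weight layer appear as binomial coefficients in the weight; in
  this form their degree in the weight is visible.\<close>

definition binom_poly :: "nat \<Rightarrow> real poly" where
  "binom_poly j = Polynomial.smult (1 / fact j) (\<Prod>i<j. [:- real i, 1:])"

lemma degree_binom_poly: "degree (binom_poly j) = j"
  unfolding binom_poly_def by (simp add: degree_prod_eq_sum_degree)

lemma poly_binom_poly: "poly (binom_poly j) (real w) = real (w choose j)"
  unfolding binom_poly_def
  by (simp add: poly_prod binomial_gbinomial gbinomial_prod_rev atLeast0LessThan)

text \<open>Raising \<open>i\<close> by one multiplies the right-hand side by
  \<open>(d + i + 1) / (d - i)\<close>, which is at least \<open>1\<close>.\<close>

lemma fact_mult_le: "i \<le> d \<Longrightarrow> (fact d :: real) * fact d \<le> fact (d + i) * fact (d - i)"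
proof (induction i)
  case (Suc i)
  then have e: "d - i = Suc (d - Suc i)" by simp
  have f: "(fact (d - i) :: real) = real (d - i) * fact (d - Suc i)" unfolding e by (simp only: fact_Suc of_nat_id)
  have "fact d * fact d \<le> fact (d + i) * (real (d - i) * fact (d - Suc i))"
    using Suc f by simp
  also have "\<dots> \<le> fact (d + i) * (real (d + Suc i) * fact (d - Suc i))"
    by (intro mult_left_mono mult_right_mono) auto
  finally show ?case by (simp add: mult_ac)
qed simp

text \<open>Factoring \<open>i^2 - j^2\<close> as \<open>(i - j) (i + j)\<close> turns the product
  into factorials. Square nodes are chosen because these ratios stay bounded uniformly in
  \<open>d\<close>.\<close>

lemma prod_square_ratio:
  assumes "1 \<le> i" "i \<le> d"
  shows "(\<Prod>j\<in>{1..d}-{i}. (real j)^2 / \<bar>(real i)^2 - (real j)^2\<bar>)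
    = 2 * fact d * fact d / (fact (d + i) * fact (d - i))"
  using assms(2)
proof (induction d rule: dec_induct)
  case base
  obtain m where m: "i = Suc m" using assms by (cases i) auto
  \<comment> \<open>At \<open>d = i\<close> all remaining nodes lie below \<open>i\<close>. Partial
    products up to \<open>k\<close> carry the induction, and \<open>k = m = i - 1\<close> is the
    base case.\<close>
  have *: "k \<le> m \<Longrightarrow> (\<Prod>j\<in>{1..k}. (real j)^2 / \<bar>(real i)^2 - (real j)^2\<bar>)
     = fact k * fact k * fact (m - k) * fact i / (fact m * fact (i + k))" for k
  proof (induction k)
    case (Suc k)
    have e: "m - k = Suc (m - Suc k)" using Suc by simp
    have f: "(fact (m - k) :: real) = real (m - k) * fact (m - Suc k)" unfolding e by (simp only: fact_Suc of_nat_id)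
    have "Suc k < i" using Suc m by simp
    then have "(real (Suc k))^2 < (real i)^2" by (intro power_strict_mono) auto
    then have g: "\<bar>(real i)^2 - (real (Suc k))^2\<bar> = real (m - k) * real (i + Suc k)"
      using Suc m by (simp add: power2_eq_square of_nat_diff algebra_simps)
    have pos: "real (m - k) > 0" using Suc by simp
    have h: "(fact (i + Suc k)::real) = real (i + Suc k) * fact (i + k)" by simp
    have IH: "(\<Prod>j\<in>{1..k}. (real j)^2 / \<bar>(real i)^2 - (real j)^2\<bar>)
     = fact k * fact k * fact (m - k) * fact i / (fact m * fact (i + k))" using Suc by simp
    have "(\<Prod>j\<in>{1..Suc k}. (real j)^2 / \<bar>(real i)^2 - (real j)^2\<bar>)
      = (\<Prod>j\<in>{1..k}. (real j)^2 / \<bar>(real i)^2 - (real j)^2\<bar>) * ((real (Suc k))^2 / \<bar>(real i)^2 - (real (Suc k))^2\<bar>)"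
      by (simp add: prod.nat_ivl_Suc' mult.commute)
    also have "\<dots> = fact k * fact k * (real (m - k) * fact (m - Suc k)) * fact i / (fact m * fact (i + k))
        * ((real (Suc k))^2 / (real (m - k) * real (i + Suc k)))"
      unfolding IH g f ..
    also have "\<dots> = (real (Suc k) * fact k) * (real (Suc k) * fact k) * fact (m - Suc k) * fact i
        / (fact m * (real (i + Suc k) * fact (i + k)))"
      using pos by (simp add: power2_eq_square field_simps del: of_nat_Suc of_nat_add)
    finally show ?case unfolding h by (simp only: fact_Suc of_nat_id)
  qed simp
  have s: "{1..i} - {i} = {1..m}" using m by auto
  have e: "(fact (2*i) :: real) = 2 * real i * fact (i + m)"
  proof -
    have "2 * i = Suc (i + m)" using m by simp
    then show ?thesis using m by (simp only: fact_Suc) simp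
  qed
  have fi: "(fact i :: real) = real i * fact m" unfolding m by (simp only: fact_Suc of_nat_id)
  have "i > 0" using m by simp
  then show ?case unfolding s *[OF order.refl]
    by (simp add: mult_2[symmetric] e) (simp add: fi field_simps)
next
  case (step d)
  have "i < Suc d" using step by simp
  have s: "{1..Suc d} - {i} = insert (Suc d) ({1..d} - {i})" using step by auto
  have e: "Suc d - i = Suc (d - i)" using step by simp
  have "(real i)^2 < (real (Suc d))^2" using \<open>i < Suc d\<close> by (intro power_strict_mono) auto
  then have g: "\<bar>(real i)^2 - (real (Suc d))^2\<bar> = real (Suc (d - i)) * real (Suc d + i)"
    using step by (simp add: power2_eq_square of_nat_diff algebra_simps)
  have p: "real (Suc (d - i)) > 0" "real (Suc d + i) > 0" by auto
  have "(\<Prod>j\<in>{1..Suc d}-{i}. (real j)^2 / \<bar>(real i)^2 - (real j)^2\<bar>)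
     = (real (Suc d))^2 / (real (Suc (d - i)) * real (Suc d + i)) * (2 * fact d * fact d / (fact (d + i) * fact (d - i)))"
    unfolding s by (subst prod.insert) (use step g in auto)
  also have "\<dots> = 2 * (real (Suc d) * fact d) * (real (Suc d) * fact d) / ((real (Suc d + i) * fact (d + i)) * (real (Suc (d - i)) * fact (d - i)))"
    using p by (simp add: power2_eq_square field_simps del: of_nat_Suc of_nat_add)
  finally show ?case unfolding e by (simp only: fact_Suc of_nat_id add_Suc)
qed

lemma prod_square_ratio_le:
  assumes "1 \<le> i" "i \<le> d"
  shows "(\<Prod>j\<in>{1..d}-{i}. (real j)^2 / \<bar>(real i)^2 - (real j)^2\<bar>) \<le> 2"
  unfolding prod_square_ratio[OF assms]
  using fact_mult_le[OF assms(2)] by (simp add: divide_le_eq)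

text \<open>Telescoping with \<open>1/i^2 \<le> 1/(i-1) - 1/i\<close>; at \<open>d = 0\<close> the
  convention \<open>1/0 = 0\<close> makes the bound \<open>0 \<le> 2\<close>.\<close>

lemma sum_inverse_squares_le: "(\<Sum>i=1..d. 1 / (real i)^2) \<le> 2 - 1 / real d"
proof (induction d)
  case (Suc d)
  show ?case
  proof (cases "d = 0")
    case False
    have "1 / (real (Suc d))^2 \<le> 1 / (real d * real (Suc d))"
      unfolding power2_eq_square using False by (intro divide_left_mono mult_right_mono) auto
    also have "\<dots> = 1 / real d - 1 / real (Suc d)" using False by (simp add: field_simps)
    finally have "1 / (real (Suc d))^2 \<le> 1 / real d - 1 / real (Suc d)" .
    then show ?thesis using Suc by simp
  qed simp
qed simp

text \<open>
  The weights are those of the divided difference at the nodes \<open>0\<close>, \<open>1\<close> and \<open>49 i\<^sup>2\<close>; the factor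
  \<open>49\<close> pushes the total weight of the nodes \<open>49 i\<^sup>2\<close> below \<open>1/12\<close> of the weight of \<open>0\<close>.
\<close>

lemma dual_weights_exist:
  assumes "49 * d^2 \<le> t" "1 \<le> t"
  obtains \<psi> :: "nat \<Rightarrow> real" where
    "\<psi> 0 = -1" "(\<Sum>w=2..t. \<bar>\<psi> w\<bar>) \<le> 1/12"
    "\<And>j. j \<le> d \<Longrightarrow> (\<Sum>w\<le>t. \<psi> w * real (w choose j)) = 0"
proof -
  define q where "q = (\<lambda>i::nat. 49 * i^2)"
  define N where "N = {0,1} \<union> q ` {1..d}"
  \<comment> \<open>The derivative of the nodal polynomial at \<open>w\<close>, so that
    \<open>1 / D w\<close> are the weights of the divided difference; \<open>\<psi>\<close> rescales
    them to \<open>-1\<close> at \<open>0\<close>.\<close>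
  define D where "D = (\<lambda>w. \<Prod>r\<in>N-{w}. real w - real r)"
  define \<psi> where "\<psi> = (\<lambda>w. if w \<in> N then - D 0 / D w else 0)"
  have inj: "inj_on q A" for A by (auto simp: q_def inj_on_def)
  have q_ge: "q i \<ge> 49" if "1 \<le> i" for i using that by (simp add: q_def)
  have finN: "finite N" by (simp add: N_def)
  have disj: "{0,1} \<inter> q ` {1..d} = {}" using q_ge by force
  have cardN: "card N = d + 2" unfolding N_def
    by (subst card_Un_disjoint) (use disj in \<open>auto simp: card_image[OF inj]\<close>)
  have subN: "N \<subseteq> {..t}"
  proof -
    have "q i \<le> t" if "i \<le> d" for i
      using assms(1) power_mono[OF that, of 2] unfolding q_def by (meson le_trans mult_le_mono2 zero_le)
    then show ?thesis using assms unfolding N_def by auto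
  qed
  have D0: "D w \<noteq> 0" for w using finN by (auto simp: D_def)
  have z: "(\<Sum>w\<le>t. \<psi> w * real (w choose j)) = 0" if "j \<le> d" for j
  proof -
    have D': "D w = (\<Prod>r\<in>real ` N - {real w}. real w - r)" for w
    proof -
      have "real ` N - {real w} = real ` (N - {w})" by auto
      then show ?thesis unfolding D_def by (simp add: prod.reindex)
    qed
    have "(\<Sum>w\<le>t. \<psi> w * real (w choose j)) = (\<Sum>w\<in>N. \<psi> w * real (w choose j))"
      by (rule sum.mono_neutral_right) (use subN in \<open>auto simp: \<psi>_def\<close>)
    also have "\<dots> = - D 0 * (\<Sum>w\<in>N. poly (binom_poly j) (real w) / D w)"
      unfolding sum_distrib_left by (rule sum.cong) (auto simp: \<psi>_def poly_binom_poly)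
    also have "(\<Sum>w\<in>N. poly (binom_poly j) (real w) / D w)
        = (\<Sum>s\<in>real ` N. poly (binom_poly j) s / (\<Prod>r\<in>real ` N - {s}. s - r))"
      by (subst sum.reindex) (auto simp: D')
    also have "\<dots> = 0"
      by (rule lagrange_sum_eq_0)
         (use that finN in \<open>auto simp: card_image cardN degree_binom_poly\<close>)
    finally show ?thesis by simp
  qed
  \<comment> \<open>Against \<open>D 0\<close>, the node \<open>1\<close> leaves a factor
    \<open>1 / (49 i^2 - 1)\<close>, at most \<open>1 / (48 i^2)\<close>, and the other nodes
    contribute at most \<open>2\<close>. Since the \<open>1 / i^2\<close> sum to at most
    \<open>2\<close>, the total is at most \<open>2/24 = 1/12\<close>.\<close>
  have b: "\<bar>\<psi> (q i)\<bar> \<le> 1/24 * (1 / (real i)^2)" if i: "i \<in> {1..d}" for i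
  proof -
    define Q where "Q = q ` ({1..d}-{i})"
    have im: "q ` {1..d} = insert (q i) Q"
      unfolding Q_def image_insert[symmetric] using i by (simp only: insert_Diff)
    have ni: "q i \<notin> Q" unfolding Q_def using inj[of UNIV] by (auto dest: injD)
    have n1: "0 \<notin> Q" "Suc 0 \<notin> Q" "q i \<noteq> Suc 0" "q i \<noteq> 0"
      using disj unfolding im by auto
    have N0: "N - {0} = insert 1 (insert (q i) Q)"
      unfolding N_def im using n1 by auto
    have Ni: "N - {q i} = insert 0 (insert 1 Q)"
      unfolding N_def im using n1 ni by auto
    have finQ: "finite Q" by (simp add: Q_def)
    have pQ: "prod f Q = (\<Prod>j\<in>{1..d}-{i}. f (q j))" for f :: "nat \<Rightarrow> real"
      unfolding Q_def by (simp add: prod.reindex[OF inj])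
    have a0: "\<bar>D 0\<bar> = real (q i) * (\<Prod>j\<in>{1..d}-{i}. real (q j))"
      unfolding D_def N0 using ni n1 finQ by (simp add: pQ abs_mult abs_prod)
    have ai: "\<bar>D (q i)\<bar> = real (q i) * ((real (q i) - 1) * (\<Prod>j\<in>{1..d}-{i}. \<bar>real (q i) - real (q j)\<bar>))"
      unfolding D_def Ni using n1 q_ge[of i] i finQ by (simp add: pQ abs_mult abs_prod)
    have r: "(\<Prod>j\<in>{1..d}-{i}. real (q j)) / (\<Prod>j\<in>{1..d}-{i}. \<bar>real (q i) - real (q j)\<bar>)
       = (\<Prod>j\<in>{1..d}-{i}. (real j)^2 / \<bar>(real i)^2 - (real j)^2\<bar>)"
      unfolding prod_dividef[symmetric]
    proof (rule prod.cong)
      fix j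
      have "\<bar>real (q i) - real (q j)\<bar> = 49 * \<bar>(real i)^2 - (real j)^2\<bar>" unfolding q_def by (simp add: abs_if)
      then show "real (q j) / \<bar>real (q i) - real (q j)\<bar> = (real j)^2 / \<bar>(real i)^2 - (real j)^2\<bar>"
        by (simp add: q_def)
    qed simp
    have i1: "(real i)^2 \<ge> 1" using i by simp
    have "\<bar>\<psi> (q i)\<bar> = \<bar>D 0\<bar> / \<bar>D (q i)\<bar>" using i by (simp add: \<psi>_def N_def)
    also have "\<dots> = 1 / (real (q i) - 1) * ((\<Prod>j\<in>{1..d}-{i}. real (q j)) / (\<Prod>j\<in>{1..d}-{i}. \<bar>real (q i) - real (q j)\<bar>))"
      unfolding a0 ai using n1 by simp
    also have "\<dots> \<le> 1 / (real (q i) - 1) * 2"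
      unfolding r using prod_square_ratio_le[of i d] i q_ge[of i] by (intro mult_left_mono) auto
    also have "\<dots> \<le> 1 / (48 * (real i)^2) * 2"
    proof -
      have "48 * (real i)^2 \<le> real (q i) - 1" using i1 by (simp add: q_def)
      then show ?thesis using i i1 q_ge[of i] by (intro mult_right_mono divide_left_mono mult_pos_pos) auto
    qed
    finally show ?thesis by simp
  qed
  have "w \<in> {2..t}" if "w \<in> q ` {1..d}" for w
  proof -
    from that obtain i where i: "w = q i" "1 \<le> i" by auto
    have "w \<le> t" using that subN unfolding N_def by blast
    then show ?thesis using i q_ge[of i] by simp
  qed
  moreover have "\<psi> w = 0" if "w \<in> {2..t} - q ` {1..d}" for w
    using that unfolding \<psi>_def N_def by auto
  ultimately have "(\<Sum>w=2..t. \<bar>\<psi> w\<bar>) = (\<Sum>w\<in>q ` {1..d}. \<bar>\<psi> w\<bar>)"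
    by (intro sum.mono_neutral_right) (blast, blast, simp)
  also have "\<dots> = (\<Sum>i=1..d. \<bar>\<psi> (q i)\<bar>)" by (simp add: sum.reindex[OF inj])
  also have "\<dots> \<le> (\<Sum>i=1..d. 1/24 * (1 / (real i)^2))" by (rule sum_mono) (rule b)
  also have "\<dots> = 1/24 * (\<Sum>i=1..d. 1 / (real i)^2)" by (simp add: sum_distrib_left)
  also have "\<dots> \<le> 1/24 * 2"
  proof -
    have "(\<Sum>i=1..d. 1 / (real i)^2) \<le> 2"
      using sum_inverse_squares_le[of d] zero_le_divide_1_iff[of "real d"] by linarith
    then show ?thesis by linarith
  qed
  finally have "(\<Sum>w=2..t. \<bar>\<psi> w\<bar>) \<le> 1/12" by simp
  moreover have "\<psi> 0 = -1" using D0 by (simp add: \<psi>_def N_def)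
  ultimately show ?thesis using z that by blast
qed

section \<open>Characters and pattern matrices\<close>

text \<open>The Walsh characters of the group of sets under symmetric difference.\<close>

definition chi :: "'a set \<Rightarrow> 'a set \<Rightarrow> real" where
  "chi S z = (\<Prod>i\<in>S. if i \<in> z then -1 else 1)"

lemma abs_chi [simp]: "\<bar>chi S z\<bar> = 1"
proof -
  have "\<bar>chi S z\<bar> = (\<Prod>i\<in>S. 1)" unfolding chi_def abs_prod by (rule prod.cong) auto
  then show ?thesis by simp
qed

lemma chi_sym_diff: "chi S (sym_diff x y) = chi S x * chi S y"
  unfolding chi_def prod.distrib[symmetric] by (rule prod.cong) auto

text \<open>An index outside \<open>V\<close> reads only \<open>x0\<close> and an index inside
  \<open>V\<close> reads only \<open>x1\<close>, so the product over \<open>S\<close> splits into a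
  character of each string.\<close>

lemma chi_selected:
  assumes "finite S"
  shows "chi S ((x0 - V) \<union> (x1 \<inter> V)) = chi (S - V) x0 * chi (S \<inter> V) x1"
proof -
  have "chi S ((x0 - V) \<union> (x1 \<inter> V)) = chi (S - V) ((x0 - V) \<union> (x1 \<inter> V)) * chi (S \<inter> V) ((x0 - V) \<union> (x1 \<inter> V))"
    unfolding chi_def by (subst prod.Int_Diff[OF assms, of _ V]) (simp only: mult.commute)
  also have "chi (S - V) ((x0 - V) \<union> (x1 \<inter> V)) = chi (S - V) x0"
    unfolding chi_def by (rule prod.cong) auto
  also have "chi (S \<inter> V) ((x0 - V) \<union> (x1 \<inter> V)) = chi (S \<inter> V) x1"
    unfolding chi_def by (rule prod.cong) auto
  finally show ?thesis .
qed

text \<open>The sum factors over the points of \<open>I\<close>, and a point of \<open>z\<close>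
  contributes the factor \<open>-1 + 1 = 0\<close>.\<close>

lemma sum_chi_Pow:
  assumes "finite I"
  shows "(\<Sum>S\<in>Pow I. chi S z) = (if I \<inter> z = {} then 2 ^ card I else 0)"
proof -
  have "(\<Sum>S\<in>Pow I. chi S z) = (\<Prod>i\<in>I. (if i \<in> z then -1 else 1) + 1)"
    unfolding prod_add[OF assms] chi_def by simp
  also have "\<dots> = (\<Prod>i\<in>I. if i \<in> z then 0 else 2)" by (rule prod.cong) auto
  also have "\<dots> = (if I \<inter> z = {} then 2 ^ card I else 0)"
  proof (cases "I \<inter> z = {}")
    case True
    then have "(\<Prod>i\<in>I. if i \<in> z then 0 else 2) = (\<Prod>i\<in>I. 2::real)" by (intro prod.cong) auto
    then show ?thesis using True by simp
  qed (use assms in \<open>auto simp: prod_zero_iff\<close>)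
  finally show ?thesis .
qed

lemma sum_chi_orthogonal:
  assumes "finite I" "x \<subseteq> I" "y \<subseteq> I"
  shows "(\<Sum>S\<in>Pow I. chi S x * chi S y) = (if x = y then 2 ^ card I else 0)"
proof -
  have "I \<inter> sym_diff x y = {} \<longleftrightarrow> x = y" using assms by blast
  then show ?thesis unfolding chi_sym_diff[symmetric] sum_chi_Pow[OF assms(1)] by simp
qed

text \<open>Fourier coefficients are unnormalised sums here, hence the power of \<open>2\<close>,
  which recurs in the Parseval identities.\<close>

lemma fourier_inversion:
  assumes "finite I" "z \<subseteq> I"
  shows "(\<Sum>S\<in>Pow I. (\<Sum>x\<in>Pow I. \<phi> x * chi S x) * chi S z) = 2 ^ card I * \<phi> z"
proof -
  have "(\<Sum>S\<in>Pow I. (\<Sum>x\<in>Pow I. \<phi> x * chi S x) * chi S z)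
      = (\<Sum>x\<in>Pow I. \<phi> x * (\<Sum>S\<in>Pow I. chi S x * chi S z))"
    unfolding sum_distrib_left sum_distrib_right by (subst sum.swap) (simp add: mult.assoc)
  also have "\<dots> = (\<Sum>x\<in>Pow I. if x = z then 2 ^ card I * \<phi> z else 0)"
    by (rule sum.cong) (use assms in \<open>auto simp: sum_chi_orthogonal\<close>)
  finally show ?thesis using assms by simp
qed

lemma parseval_chi:
  fixes g :: "'a set \<Rightarrow> complex"
  assumes "finite I"
  shows "(\<Sum>S\<in>Pow I. (cmod (\<Sum>x\<in>Pow I. chi S x * g x))\<^sup>2) = 2 ^ card I * (\<Sum>x\<in>Pow I. (cmod (g x))\<^sup>2)"
proof -
  have "complex_of_real (\<Sum>S\<in>Pow I. (cmod (\<Sum>x\<in>Pow I. chi S x * g x))\<^sup>2)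
      = (\<Sum>S\<in>Pow I. (\<Sum>x\<in>Pow I. chi S x * g x) * cnj (\<Sum>y\<in>Pow I. chi S y * g y))"
    by (simp only: of_real_sum complex_norm_square)
  also have "\<dots> = (\<Sum>S\<in>Pow I. \<Sum>x\<in>Pow I. \<Sum>y\<in>Pow I. chi S x * chi S y * (g x * cnj (g y)))"
    by (simp add: sum_product mult_ac)
  also have "\<dots> = (\<Sum>x\<in>Pow I. \<Sum>y\<in>Pow I. \<Sum>S\<in>Pow I. chi S x * chi S y * (g x * cnj (g y)))"
    by (subst sum.swap, rule sum.cong[OF refl], subst sum.swap, rule refl)
  also have "\<dots> = (\<Sum>x\<in>Pow I. \<Sum>y\<in>Pow I. complex_of_real (\<Sum>S\<in>Pow I. chi S x * chi S y) * (g x * cnj (g y)))"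
    by (simp add: sum_distrib_right)
  also have "\<dots> = (\<Sum>x\<in>Pow I. \<Sum>y\<in>Pow I. if y = x then 2 ^ card I * (g x * cnj (g x)) else 0)"
    by (intro sum.cong refl) (use assms in \<open>auto simp: sum_chi_orthogonal\<close>)
  also have "\<dots> = 2 ^ card I * (\<Sum>x\<in>Pow I. g x * cnj (g x))"
    using assms by (simp add: sum_distrib_left)
  also have "\<dots> = complex_of_real (2 ^ card I * (\<Sum>x\<in>Pow I. (cmod (g x))\<^sup>2))"
    by (simp only: of_real_mult of_real_sum complex_norm_square) simp
  finally show ?thesis by (simp only: of_real_eq_iff)
qed

lemma parseval_chi_pair:
  fixes g :: "'a set \<Rightarrow> 'a set \<Rightarrow> complex"
  assumes "finite I"
  shows "(\<Sum>S\<in>Pow I. \<Sum>T\<in>Pow I. (cmod (\<Sum>x\<in>Pow I. \<Sum>y\<in>Pow I. chi S x * chi T y * g x y))\<^sup>2)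
    = 4 ^ card I * (\<Sum>x\<in>Pow I. \<Sum>y\<in>Pow I. (cmod (g x y))\<^sup>2)"
proof -
  define G where "G = (\<lambda>T x. \<Sum>y\<in>Pow I. complex_of_real (chi T y) * g x y)"
  have "(\<Sum>x\<in>Pow I. \<Sum>y\<in>Pow I. chi S x * chi T y * g x y) = (\<Sum>x\<in>Pow I. chi S x * G T x)" for S T
    unfolding G_def sum_distrib_left by (simp add: mult.assoc)
  then have "(\<Sum>S\<in>Pow I. \<Sum>T\<in>Pow I. (cmod (\<Sum>x\<in>Pow I. \<Sum>y\<in>Pow I. chi S x * chi T y * g x y))\<^sup>2)
    = (\<Sum>S\<in>Pow I. \<Sum>T\<in>Pow I. (cmod (\<Sum>x\<in>Pow I. chi S x * G T x))\<^sup>2)"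
    by simp
  also have "\<dots> = (\<Sum>T\<in>Pow I. \<Sum>S\<in>Pow I. (cmod (\<Sum>x\<in>Pow I. chi S x * G T x))\<^sup>2)"
    by (rule sum.swap)
  also have "\<dots> = (\<Sum>T\<in>Pow I. 2 ^ card I * (\<Sum>x\<in>Pow I. (cmod (G T x))\<^sup>2))"
    by (intro sum.cong refl parseval_chi assms)
  also have "\<dots> = 2 ^ card I * (\<Sum>T\<in>Pow I. \<Sum>x\<in>Pow I. (cmod (G T x))\<^sup>2)"
    by (rule sum_distrib_left[symmetric])
  also have "(\<Sum>T\<in>Pow I. \<Sum>x\<in>Pow I. (cmod (G T x))\<^sup>2) = (\<Sum>x\<in>Pow I. \<Sum>T\<in>Pow I. (cmod (G T x))\<^sup>2)"
    by (rule sum.swap)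
  also have "\<dots> = (\<Sum>x\<in>Pow I. 2 ^ card I * (\<Sum>y\<in>Pow I. (cmod (g x y))\<^sup>2))"
    unfolding G_def by (intro sum.cong refl parseval_chi assms)
  also have "\<dots> = 2 ^ card I * (\<Sum>x\<in>Pow I. \<Sum>y\<in>Pow I. (cmod (g x y))\<^sup>2)"
    by (rule sum_distrib_left[symmetric])
  finally show ?thesis
    by (simp only: mult.assoc[symmetric] power_mult_distrib[symmetric]) simp
qed

text \<open>The pair \<open>(A, B)\<close> fixes \<open>S = A \<union> B\<close> and the part of
  \<open>V\<close> inside \<open>S\<close>. Only the part of \<open>V\<close> outside
  \<open>S\<close> is free, and that complement has at most \<open>card I - d\<close> points. This
  count is the source of the gain \<open>2^(-d)\<close> in the pattern matrix bound.\<close>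

lemma card_split_fibre:
  assumes "finite I"
  shows "card {(S, V) \<in> {S. S \<subseteq> I \<and> d \<le> card S} \<times> Pow I. (S - V, S \<inter> V) = (A, B)} \<le> 2 ^ (card I - d)"
    (is "card ?F \<le> _")
proof (cases "?F = {}")
  case False
  then obtain S V where S: "S \<subseteq> I" "d \<le> card S" "A = S - V" "B = S \<inter> V" by auto
  moreover from S have "A \<union> B = S" by blast
  ultimately have AB: "A \<union> B \<subseteq> I" "d \<le> card (A \<union> B)" by simp_all
  have "inj_on (\<lambda>(S, V). V - S) ?F" unfolding inj_on_def by auto
  moreover have "(\<lambda>(S, V). V - S) ` ?F \<subseteq> Pow (I - (A \<union> B))" by auto
  ultimately have "card ?F \<le> card (Pow (I - (A \<union> B)))"
    using assms by (intro card_inj_on_le) auto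
  also have "\<dots> = 2 ^ (card I - card (A \<union> B))"
    using assms AB card_Diff_subset[of "A \<union> B" I] finite_subset[of "A \<union> B" I] by (simp add: card_Pow)
  also have "\<dots> \<le> 2 ^ (card I - d)" using AB by (intro power_increasing) auto
  finally show ?thesis .
qed (simp only: card.empty zero_le)

lemma sum_split_le:
  fixes h :: "'a set \<Rightarrow> 'a set \<Rightarrow> real"
  assumes "finite I" "\<And>A B. h A B \<ge> 0"
  shows "(\<Sum>S\<in>{S. S \<subseteq> I \<and> d \<le> card S}. \<Sum>V\<in>Pow I. h (S - V) (S \<inter> V))
     \<le> 2 ^ (card I - d) * (\<Sum>A\<in>Pow I. \<Sum>B\<in>Pow I. h A B)"
proof -
  define D where "D = {S. S \<subseteq> I \<and> d \<le> card S} \<times> Pow I"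
  define g where "g = (\<lambda>(S, V). (S - V, S \<inter> V :: 'a set))"
  have fin: "finite D" unfolding D_def using assms(1) by simp
  have "(\<Sum>S\<in>{S. S \<subseteq> I \<and> d \<le> card S}. \<Sum>V\<in>Pow I. h (S - V) (S \<inter> V))
      = (\<Sum>p\<in>D. case_prod h (g p))"
    unfolding sum.cartesian_product D_def g_def by (rule sum.cong) auto
  also have "\<dots> = (\<Sum>q\<in>Pow I \<times> Pow I. of_nat (card {p \<in> D. g p = q}) * case_prod h q)"
    by (rule sum_fun_comp) (use fin assms(1) in \<open>auto simp: D_def g_def\<close>)
  also have "\<dots> \<le> (\<Sum>q\<in>Pow I \<times> Pow I. 2 ^ (card I - d) * case_prod h q)"
  proof (rule sum_mono)
    fix q :: "'a set \<times> 'a set"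
    obtain A B where q: "q = (A, B)" by force
    have "{p \<in> D. g p = q} = {(S, V) \<in> {S. S \<subseteq> I \<and> d \<le> card S} \<times> Pow I. (S - V, S \<inter> V) = (A, B)}"
      unfolding D_def g_def q by auto
    then have "card {p \<in> D. g p = q} \<le> 2 ^ (card I - d)"
      using card_split_fibre[OF assms(1), of d A B] by (simp only:)
    then have "real (card {p \<in> D. g p = q}) \<le> real (2 ^ (card I - d))"
      by (simp only: of_nat_le_iff)
    then have "real (card {p \<in> D. g p = q}) \<le> 2 ^ (card I - d)" by simp
    moreover have "case_prod h q \<ge> 0" unfolding q by (simp add: assms(2))
    ultimately show "of_nat (card {p \<in> D. g p = q}) * case_prod h q \<le> 2 ^ (card I - d) * case_prod h q"
      by (intro mult_right_mono)
  qed
  also have "\<dots> = 2 ^ (card I - d) * (\<Sum>A\<in>Pow I. \<Sum>B\<in>Pow I. h A B)"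
    unfolding sum.cartesian_product sum_distrib_left[symmetric] ..
  finally show ?thesis .
qed

lemma cmod_sum_mult_le:
  fixes a b :: "'a \<Rightarrow> complex"
  shows "(cmod (\<Sum>i\<in>I. a i * b i))\<^sup>2 \<le> (\<Sum>i\<in>I. (cmod (a i))\<^sup>2) * (\<Sum>i\<in>I. (cmod (b i))\<^sup>2)"
proof -
  have "(cmod (\<Sum>i\<in>I. a i * b i))\<^sup>2 \<le> (\<Sum>i\<in>I. cmod (a i) * cmod (b i))\<^sup>2"
    by (intro power_mono order.trans[OF norm_sum]) (auto simp: norm_mult)
  also have "\<dots> \<le> (\<Sum>i\<in>I. (cmod (a i))\<^sup>2) * (\<Sum>i\<in>I. (cmod (b i))\<^sup>2)"
    by (rule Cauchy_Schwarz_ineq_sum)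
  finally show ?thesis .
qed

lemma sum_reorder6:
  "(\<Sum>a\<in>A. \<Sum>b\<in>B. \<Sum>c\<in>C. \<Sum>d\<in>D. \<Sum>e\<in>E. \<Sum>f\<in>F. g a b c d e f)
   = (\<Sum>e\<in>E. \<Sum>c\<in>C. \<Sum>f\<in>F. \<Sum>a\<in>A. \<Sum>b\<in>B. \<Sum>d\<in>D. g a b c d e f)"
  by (simp only: sum.cartesian_product)
    (rule sum.reindex_bij_witness[of _ "\<lambda>(e,c,f,a,b,d). (a,b,c,d,e,f)" "\<lambda>(a,b,c,d,e,f). (e,c,f,a,b,d)"]; auto)

lemma sum_rotate3:
  "(\<Sum>a\<in>A. \<Sum>b\<in>B. \<Sum>c\<in>C. g a b c) = (\<Sum>c\<in>C. \<Sum>a\<in>A. \<Sum>b\<in>B. g a b c)"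
proof -
  have "(\<Sum>a\<in>A. \<Sum>b\<in>B. \<Sum>c\<in>C. g a b c) = (\<Sum>a\<in>A. \<Sum>c\<in>C. \<Sum>b\<in>B. g a b c)"
    by (intro sum.cong refl sum.swap)
  also have "\<dots> = (\<Sum>c\<in>C. \<Sum>a\<in>A. \<Sum>b\<in>B. g a b c)" by (rule sum.swap)
  finally show ?thesis .
qed

text \<open>
  The spectral bound for Sherstov's pattern matrices: \<open>x0\<close> and \<open>x1\<close> hold the two bits of every block,
  \<open>V\<close> is the set of blocks in which the second bit is selected.
\<close>

lemma pattern_matrix_bound:
  fixes u :: "'a set \<Rightarrow> 'a set \<Rightarrow> 'j \<Rightarrow> complex" and v :: "'a set \<Rightarrow> 'a set \<Rightarrow> 'j \<Rightarrow> complex"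
  assumes I: "finite I" and d: "d \<le> card I"
    and u: "\<And>x0 x1. x0 \<subseteq> I \<Longrightarrow> x1 \<subseteq> I \<Longrightarrow> (\<Sum>j\<in>J. (cmod (u x0 x1 j))\<^sup>2) \<le> 1"
    and v: "\<And>V w. V \<subseteq> I \<Longrightarrow> w \<subseteq> I \<Longrightarrow> (\<Sum>j\<in>J. (cmod (v V w j))\<^sup>2) \<le> 1"
    and low: "\<And>S. S \<subseteq> I \<Longrightarrow> card S < d \<Longrightarrow> (\<Sum>z\<in>Pow I. \<phi> z * chi S z) = 0"
    and l1: "(\<Sum>z\<in>Pow I. \<bar>\<phi> z\<bar>) \<le> M"
  shows "2 ^ d * (cmod (\<Sum>x0\<in>Pow I. \<Sum>x1\<in>Pow I. \<Sum>V\<in>Pow I. \<Sum>w\<in>Pow I. 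
      \<phi> (sym_diff ((x0 - V) \<union> (x1 \<inter> V)) w) * (\<Sum>j\<in>J. u x0 x1 j * v V w j)))\<^sup>2
    \<le> (M * 8 ^ card I)\<^sup>2" (is "_ * (cmod ?X)\<^sup>2 \<le> _")
proof -
  define t where "t = card I"
  define c where "c = (\<lambda>S. \<Sum>z\<in>Pow I. \<phi> z * chi S z)"
  define uh where "uh = (\<lambda>A B j. \<Sum>x0\<in>Pow I. \<Sum>x1\<in>Pow I. chi A x0 * chi B x1 * u x0 x1 j)"
  define vh where "vh = (\<lambda>V S j. \<Sum>w\<in>Pow I. chi S w * v V w j)"
  define H where "H = {S. S \<subseteq> I \<and> d \<le> card S}"
  have M0: "M \<ge> 0" using l1 by (meson abs_ge_zero order.trans sum_nonneg)
  have cM: "\<bar>c S\<bar> \<le> M" for S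
    unfolding c_def by (rule order.trans[OF sum_abs]) (simp add: abs_mult l1)
  have finH: "finite S" if "S \<in> H" for S
    using that I finite_subset unfolding H_def by blast
  \<comment> \<open>Coefficients below degree \<open>d\<close> vanish, so only \<open>S\<close> in
    \<open>H\<close> remains, and each character separates into factors in \<open>x0\<close>,
    \<open>x1\<close> and \<open>w\<close>.\<close>
  have exp: "2 ^ t * \<phi> (sym_diff ((x0 - V) \<union> (x1 \<inter> V)) w)
      = (\<Sum>S\<in>H. c S * (chi (S - V) x0 * chi (S \<inter> V) x1 * chi S w))"
    if "x0 \<subseteq> I" "x1 \<subseteq> I" "V \<subseteq> I" "w \<subseteq> I" for x0 x1 V w
  proof -
    have "2 ^ t * \<phi> (sym_diff ((x0 - V) \<union> (x1 \<inter> V)) w) =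
       (\<Sum>S\<in>Pow I. c S * chi S (sym_diff ((x0 - V) \<union> (x1 \<inter> V)) w))"
      unfolding c_def t_def by (rule fourier_inversion[symmetric]) (use I that in auto)
    also have "\<dots> = (\<Sum>S\<in>H. c S * chi S (sym_diff ((x0 - V) \<union> (x1 \<inter> V)) w))"
      by (rule sum.mono_neutral_right) (use I low in \<open>auto simp: H_def c_def not_le\<close>)
    also have "\<dots> = (\<Sum>S\<in>H. c S * (chi (S - V) x0 * chi (S \<inter> V) x1 * chi S w))"
      by (rule sum.cong) (simp_all add: chi_sym_diff chi_selected[OF finH])
    finally show ?thesis .
  qed
  have "2 ^ t * ?X = (\<Sum>x0\<in>Pow I. \<Sum>x1\<in>Pow I. \<Sum>V\<in>Pow I. \<Sum>w\<in>Pow I.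
     complex_of_real (2 ^ t * \<phi> (sym_diff ((x0 - V) \<union> (x1 \<inter> V)) w)) * (\<Sum>j\<in>J. u x0 x1 j * v V w j))"
    by (simp add: sum_distrib_left mult.assoc)
  also have "\<dots> = (\<Sum>x0\<in>Pow I. \<Sum>x1\<in>Pow I. \<Sum>V\<in>Pow I. \<Sum>w\<in>Pow I.
     complex_of_real (\<Sum>S\<in>H. c S * (chi (S - V) x0 * chi (S \<inter> V) x1 * chi S w)) * (\<Sum>j\<in>J. u x0 x1 j * v V w j))"
    by (intro sum.cong refl) (simp only: exp Pow_iff)
  also have "\<dots> = (\<Sum>x0\<in>Pow I. \<Sum>x1\<in>Pow I. \<Sum>V\<in>Pow I. \<Sum>w\<in>Pow I. \<Sum>S\<in>H. \<Sum>j\<in>J.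
      c S * ((chi (S - V) x0 * chi (S \<inter> V) x1 * u x0 x1 j) * (chi S w * v V w j)))"
    by (intro sum.cong refl) (simp add: sum_product mult_ac sum_distrib_left)
  also have "\<dots> = (\<Sum>S\<in>H. \<Sum>V\<in>Pow I. \<Sum>j\<in>J. \<Sum>x0\<in>Pow I. \<Sum>x1\<in>Pow I. \<Sum>w\<in>Pow I.
      c S * ((chi (S - V) x0 * chi (S \<inter> V) x1 * u x0 x1 j) * (chi S w * v V w j)))"
    by (rule sum_reorder6)
  also have "\<dots> = (\<Sum>S\<in>H. \<Sum>V\<in>Pow I. \<Sum>j\<in>J. (c S * uh (S - V) (S \<inter> V) j) * vh V S j)"
  proof (intro sum.cong refl)
    fix S V j
    have "(c S * uh (S - V) (S \<inter> V) j) * vh V S j = c S * ((\<Sum>x0\<in>Pow I. \<Sum>x1\<in>Pow I. chi (S - V) x0 * chi (S \<inter> V) x1 * u x0 x1 j) * vh V S j)"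
      unfolding uh_def by (simp add: mult.assoc)
    also have "\<dots> = (\<Sum>x0\<in>Pow I. \<Sum>x1\<in>Pow I. c S * ((chi (S - V) x0 * chi (S \<inter> V) x1 * u x0 x1 j) * vh V S j))"
      by (simp only: sum_distrib_right) (simp only: sum_distrib_left)
    also have "\<dots> = (\<Sum>x0\<in>Pow I. \<Sum>x1\<in>Pow I. \<Sum>w\<in>Pow I.
      c S * ((chi (S - V) x0 * chi (S \<inter> V) x1 * u x0 x1 j) * (chi S w * v V w j)))"
      unfolding vh_def by (simp only: sum_distrib_left)
    finally show "(\<Sum>x0\<in>Pow I. \<Sum>x1\<in>Pow I. \<Sum>w\<in>Pow I.
      c S * ((chi (S - V) x0 * chi (S \<inter> V) x1 * u x0 x1 j) * (chi S w * v V w j)))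
      = (c S * uh (S - V) (S \<inter> V) j) * vh V S j" ..
  qed
  \<comment> \<open>Over triples \<open>(S, V, j)\<close> the sum pairs a vector built from
    \<open>u\<close> with a vector built from \<open>v\<close>, ready for Cauchy-Schwarz.\<close>
  finally have X: "2 ^ t * ?X = (\<Sum>p\<in>H \<times> Pow I \<times> J. (case p of (S,V,j) \<Rightarrow> c S * uh (S - V) (S \<inter> V) j) * (case p of (S,V,j) \<Rightarrow> vh V S j))"
    by (simp only: sum.cartesian_product) (rule sum.cong; auto)
  \<comment> \<open>The coefficients are at most \<open>M\<close>, every \<open>(A, B)\<close> comes
    from at most \<open>2 ^ (t - d)\<close> pairs \<open>(S, V)\<close>, Parseval in two variables
    costs \<open>4 ^ t\<close>, and there are \<open>4 ^ t\<close> vectors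
    \<open>u x0 x1\<close>.\<close>
  have U: "(\<Sum>p\<in>H \<times> Pow I \<times> J. (cmod (case p of (S,V,j) \<Rightarrow> c S * uh (S - V) (S \<inter> V) j))\<^sup>2)
     \<le> M\<^sup>2 * (2 ^ (t - d) * 16 ^ t)"
  proof -
    have "(\<Sum>p\<in>H \<times> Pow I \<times> J. (cmod (case p of (S,V,j) \<Rightarrow> c S * uh (S - V) (S \<inter> V) j))\<^sup>2)
      \<le> (\<Sum>p\<in>H \<times> Pow I \<times> J. M\<^sup>2 * (case p of (S,V,j) \<Rightarrow> (cmod (uh (S - V) (S \<inter> V) j))\<^sup>2))"
      using cM M0 by (intro sum_mono) (auto simp: norm_mult power_mult_distrib abs_le_square_iff[symmetric] intro!: mult_right_mono)
    also have "\<dots> = M\<^sup>2 * (\<Sum>S\<in>H. \<Sum>V\<in>Pow I. (\<Sum>j\<in>J. (cmod (uh (S - V) (S \<inter> V) j))\<^sup>2))"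
      by (simp add: sum.cartesian_product sum_distrib_left[symmetric] case_prod_beta)
    also have "\<dots> \<le> M\<^sup>2 * (2 ^ (t - d) * (\<Sum>A\<in>Pow I. \<Sum>B\<in>Pow I. (\<Sum>j\<in>J. (cmod (uh A B j))\<^sup>2)))"
      unfolding H_def t_def by (intro mult_left_mono sum_split_le) (use I in \<open>auto intro: sum_nonneg\<close>)
    also have "(\<Sum>A\<in>Pow I. \<Sum>B\<in>Pow I. (\<Sum>j\<in>J. (cmod (uh A B j))\<^sup>2)) = (\<Sum>j\<in>J. \<Sum>A\<in>Pow I. \<Sum>B\<in>Pow I. (cmod (uh A B j))\<^sup>2)"
      by (rule sum_rotate3)
    also have "\<dots> = (\<Sum>j\<in>J. 4 ^ t * (\<Sum>x\<in>Pow I. \<Sum>y\<in>Pow I. (cmod (u x y j))\<^sup>2))"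
      unfolding uh_def t_def by (simp only: of_real_mult parseval_chi_pair[OF I, unfolded of_real_mult])
    also have "\<dots> = 4 ^ t * (\<Sum>x\<in>Pow I. \<Sum>y\<in>Pow I. \<Sum>j\<in>J. (cmod (u x y j))\<^sup>2)"
      unfolding sum_distrib_left[symmetric] by (intro arg_cong[where f="(*) (4 ^ t)"] sum_rotate3[symmetric])
    also have "\<dots> \<le> 4 ^ t * (\<Sum>x\<in>Pow I. \<Sum>y\<in>Pow I. 1)"
      by (intro mult_left_mono sum_mono u) auto
    also have "\<dots> = 16 ^ t" using I by (simp add: card_Pow t_def power_mult_distrib[symmetric])
    finally show ?thesis by (simp add: mult_left_mono)
  qed
  \<comment> \<open>Parseval in \<open>w\<close> alone costs \<open>2 ^ t\<close>, and there are
    \<open>4 ^ t\<close> vectors \<open>v V w\<close>.\<close>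
  have V: "(\<Sum>p\<in>H \<times> Pow I \<times> J. (cmod (case p of (S,V,j) \<Rightarrow> vh V S j))\<^sup>2) \<le> 8 ^ t"
  proof -
    have "(\<Sum>p\<in>H \<times> Pow I \<times> J. (cmod (case p of (S,V,j) \<Rightarrow> vh V S j))\<^sup>2) = (\<Sum>S\<in>H. \<Sum>V\<in>Pow I. \<Sum>j\<in>J. (cmod (vh V S j))\<^sup>2)"
      by (simp add: sum.cartesian_product case_prod_beta)
    also have "\<dots> \<le> (\<Sum>S\<in>Pow I. \<Sum>V\<in>Pow I. \<Sum>j\<in>J. (cmod (vh V S j))\<^sup>2)"
      by (rule sum_mono2) (use I in \<open>auto simp: H_def intro!: sum_nonneg\<close>)
    also have "\<dots> = (\<Sum>V\<in>Pow I. \<Sum>j\<in>J. \<Sum>S\<in>Pow I. (cmod (vh V S j))\<^sup>2)"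
      by (rule sum_rotate3[symmetric])
    also have "\<dots> = (\<Sum>V\<in>Pow I. \<Sum>j\<in>J. 2 ^ t * (\<Sum>w\<in>Pow I. (cmod (v V w j))\<^sup>2))"
      unfolding vh_def t_def by (simp only: parseval_chi[OF I])
    also have "\<dots> = 2 ^ t * (\<Sum>V\<in>Pow I. \<Sum>w\<in>Pow I. \<Sum>j\<in>J. (cmod (v V w j))\<^sup>2)"
      unfolding sum_distrib_left[symmetric] by (intro arg_cong[where f="(*) (2 ^ t)"] sum.cong refl sum.swap)
    also have "\<dots> \<le> 2 ^ t * (\<Sum>V\<in>Pow I. \<Sum>w\<in>Pow I. 1)"
      by (intro mult_left_mono sum_mono v) auto
    also have "\<dots> = 8 ^ t" using I by (simp add: card_Pow t_def power_mult_distrib[symmetric])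
    finally show ?thesis .
  qed
  define Z where "Z = ?X"
  have "2 ^ d * (2 ^ t * cmod Z)\<^sup>2 = 2 ^ d * (cmod (2 ^ t * Z))\<^sup>2"
    by (simp add: norm_mult norm_power)
  also have "\<dots> \<le> 2 ^ d * ((M\<^sup>2 * (2 ^ (t - d) * 16 ^ t)) * 8 ^ t)"
    unfolding Z_def X by (intro mult_left_mono order.trans[OF cmod_sum_mult_le] mult_mono U V) (auto intro: sum_nonneg)
  also have "\<dots> = M\<^sup>2 * ((2 ^ d * 2 ^ (t - d)) * 16 ^ t * 8 ^ t)" by simp
  also have "2 ^ d * 2 ^ (t - d) = (2 ^ t :: real)" using d by (simp add: t_def power_add[symmetric])
  also have "M\<^sup>2 * (2 ^ t * 16 ^ t * 8 ^ t) = (2 ^ t)\<^sup>2 * (M * 8 ^ t)\<^sup>2"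
  proof -
    have sq: "(a ^ t)\<^sup>2 = (a\<^sup>2) ^ t" for a :: real by (simp add: power_mult[symmetric] mult.commute)
    have "(2 ^ t * 16 ^ t * 8 ^ t :: real) = 256 ^ t" by (simp add: power_mult_distrib[symmetric])
    moreover have "(2 ^ t)\<^sup>2 * (8 ^ t)\<^sup>2 = (256 ^ t :: real)"
      unfolding sq by (simp add: power_mult_distrib[symmetric])
    ultimately show ?thesis by (simp add: power_mult_distrib)
  qed
  finally have "(2 ^ t)\<^sup>2 * (2 ^ d * (cmod Z)\<^sup>2) \<le> (2 ^ t)\<^sup>2 * (M * 8 ^ t)\<^sup>2"
    by (simp add: power_mult_distrib mult_ac)
  then have "2 ^ d * (cmod Z)\<^sup>2 \<le> (M * 8 ^ t)\<^sup>2"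
    by (rule mult_left_le_imp_le) simp
  then show ?thesis unfolding t_def Z_def .
qed

section \<open>Contractive kernels and tensor forms\<close>

text \<open>Matrices as plain functions with the dimension given apart; this spares carrier
  conditions when dimensions are regrouped.\<close>

type_synonym kernel = "nat \<Rightarrow> nat \<Rightarrow> complex"

definition nrm :: "'i set \<Rightarrow> ('i \<Rightarrow> complex) \<Rightarrow> real" where
  "nrm P v = (\<Sum>p\<in>P. (cmod (v p))\<^sup>2)"

text \<open>Operator norm at most \<open>1\<close>, stated for the sesquilinear form because
  acceptance probabilities are built from such forms.\<close>

definition contractive :: "nat \<Rightarrow> kernel \<Rightarrow> bool" where
  "contractive n A \<longleftrightarrow> (\<forall>w v. (cmod (\<Sum>i<n. \<Sum>k<n. cnj (w i) * A i k * v k))\<^sup>2 \<le> nrm {..<n} w * nrm {..<n} v)"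

definition norm_nonincreasing :: "nat \<Rightarrow> nat \<Rightarrow> kernel \<Rightarrow> bool" where
  "norm_nonincreasing m n W \<longleftrightarrow> (\<forall>v. nrm {..<m} (\<lambda>i. \<Sum>k<n. W i k * v k) \<le> nrm {..<n} v)"

text \<open>The product of the adjoint of \<open>W\<close> with \<open>A\<close> and
  \<open>W'\<close>. Operators are moved backwards through the protocol instead of states forwards.
  Two maps are allowed because of the cross terms between the two values of a qubit.\<close>

definition pull :: "nat \<Rightarrow> kernel \<Rightarrow> kernel \<Rightarrow> kernel \<Rightarrow> kernel" where
  "pull m W W' A k k' = (\<Sum>i<m. \<Sum>i'<m. cnj (W i k) * A i i' * W' i' k')"

text \<open>The inner product of \<open>\<Phi>\<close> with the tensor product of \<open>A\<close>
  and \<open>B\<close> applied to \<open>\<Psi>\<close>.\<close>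

definition tensor_form :: "nat \<Rightarrow> nat \<Rightarrow> kernel \<Rightarrow> kernel \<Rightarrow> (nat \<times> nat \<Rightarrow> complex) \<Rightarrow> (nat \<times> nat \<Rightarrow> complex) \<Rightarrow> complex" where
  "tensor_form a b A B \<Phi> \<Psi> = (\<Sum>p\<in>{..<a}\<times>{..<b}. \<Sum>p'\<in>{..<a}\<times>{..<b}.
     cnj (\<Phi> p) * (A (fst p) (fst p') * B (snd p) (snd p')) * \<Psi> p')"

lemma nrm_nonneg [simp]: "nrm P v \<ge> 0"
  by (simp add: nrm_def sum_nonneg)

lemma nrm_mono:
  assumes "finite Q" "P \<subseteq> Q"
  shows "nrm P v \<le> nrm Q v"
  unfolding nrm_def by (rule sum_mono2) (use assms in auto)

lemma of_real_nrm: "complex_of_real (nrm P v) = (\<Sum>p\<in>P. cnj (v p) * v p)"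
  unfolding nrm_def by (simp only: of_real_sum complex_norm_square mult.commute)

lemma nrm_pairs: "nrm ({..<a} \<times> {..<b}) v = (\<Sum>j<b. nrm {..<a} (\<lambda>i. v (i, j)))"
  unfolding nrm_def by (subst sum.swap) (simp add: sum.cartesian_product)

lemma nrm_pairs': "nrm ({..<a} \<times> {..<b}) v = (\<Sum>i<a. nrm {..<b} (\<lambda>j. v (i, j)))"
  unfolding nrm_def by (simp add: sum.cartesian_product)

lemma cauchy_schwarz_nrm: "(cmod (\<Sum>p\<in>P. cnj (w p) * v p))\<^sup>2 \<le> nrm P w * nrm P v"
proof -
  have "cmod (\<Sum>p\<in>P. cnj (w p) * v p) \<le> (\<Sum>p\<in>P. cmod (w p) * cmod (v p))"
    by (rule order.trans[OF norm_sum]) (simp add: norm_mult)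
  then have "(cmod (\<Sum>p\<in>P. cnj (w p) * v p))\<^sup>2 \<le> (\<Sum>p\<in>P. cmod (w p) * cmod (v p))\<^sup>2"
    by (intro power_mono) auto
  also have "\<dots> \<le> nrm P w * nrm P v"
    unfolding nrm_def by (rule Cauchy_Schwarz_ineq_sum)
  finally show ?thesis .
qed

lemma sum_reorder4:
  "(\<Sum>a\<in>A. \<Sum>b\<in>B. \<Sum>c\<in>C. \<Sum>d\<in>D. g a b c d) = (\<Sum>c\<in>C. \<Sum>d\<in>D. \<Sum>a\<in>A. \<Sum>b\<in>B. g a b c d)"
  by (simp only: sum.cartesian_product)
    (rule sum.reindex_bij_witness[of _ "\<lambda>(c,d,a,b). (a,b,c,d)" "\<lambda>(a,b,c,d). (c,d,a,b)"]; auto)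

lemma sum_Times: "(\<Sum>p\<in>A\<times>B. f p) = (\<Sum>a\<in>A. \<Sum>b\<in>B. f (a, b))"
  by (simp add: sum.cartesian_product)

lemma sum_mult_sum:
  fixes x y :: "'a \<Rightarrow> 'b :: comm_semiring_0"
  shows "sum x Q * M * sum y R = (\<Sum>q\<in>Q. \<Sum>r\<in>R. x q * M * y r)"
  unfolding sum_distrib_right[of x Q M] sum_product ..

text \<open>Maps applied to the two arguments of a form move into its kernel; the pull-back
  identities below are instances of this.\<close>

lemma sesquilinear_pull:
  fixes K :: "'p \<Rightarrow> 'q \<Rightarrow> complex"
  shows "(\<Sum>p\<in>P. \<Sum>p'\<in>P. cnj (\<Sum>q\<in>Q. K p q * f q) * M p p' * (\<Sum>q\<in>Q. K' p' q * g q))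
    = (\<Sum>q\<in>Q. \<Sum>q'\<in>Q. cnj (f q) * (\<Sum>p\<in>P. \<Sum>p'\<in>P. cnj (K p q) * M p p' * K' p' q') * g q')"
proof -
  have "(\<Sum>p\<in>P. \<Sum>p'\<in>P. cnj (\<Sum>q\<in>Q. K p q * f q) * M p p' * (\<Sum>q\<in>Q. K' p' q * g q))
    = (\<Sum>p\<in>P. \<Sum>p'\<in>P. \<Sum>q\<in>Q. \<Sum>q'\<in>Q. cnj (K p q * f q) * M p p' * (K' p' q' * g q'))"
    by (simp only: cnj_sum sum_mult_sum)
  also have "\<dots> = (\<Sum>q\<in>Q. \<Sum>q'\<in>Q. \<Sum>p\<in>P. \<Sum>p'\<in>P. cnj (K p q * f q) * M p p' * (K' p' q' * g q'))"
    by (rule sum_reorder4)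
  also have "\<dots> = (\<Sum>q\<in>Q. \<Sum>q'\<in>Q. cnj (f q) * (\<Sum>p\<in>P. \<Sum>p'\<in>P. cnj (K p q) * M p p' * K' p' q') * g q')"
    by (intro sum.cong refl) (simp add: sum_distrib_left sum_distrib_right mult_ac)
  finally show ?thesis .
qed

lemma contractive_pull:
  assumes "contractive m A" "norm_nonincreasing m n W" "norm_nonincreasing m n W'"
  shows "contractive n (pull m W W' A)"
  unfolding contractive_def
proof (intro allI)
  fix w v
  have e: "(\<Sum>i<n. \<Sum>k<n. cnj (w i) * pull m W W' A i k * v k)
     = (\<Sum>i<m. \<Sum>i'<m. cnj (\<Sum>k<n. W i k * w k) * A i i' * (\<Sum>k<n. W' i' k * v k))"
    unfolding sesquilinear_pull pull_def ..
  have "(cmod (\<Sum>i<n. \<Sum>k<n. cnj (w i) * pull m W W' A i k * v k))\<^sup>2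
     \<le> nrm {..<m} (\<lambda>i. \<Sum>k<n. W i k * w k) * nrm {..<m} (\<lambda>i. \<Sum>k<n. W' i k * v k)"
    unfolding e by (rule assms(1)[unfolded contractive_def, rule_format])
  also have "\<dots> \<le> nrm {..<n} w * nrm {..<n} v"
    using assms(2,3) unfolding norm_nonincreasing_def by (intro mult_mono) auto
  finally show "(cmod (\<Sum>i<n. \<Sum>k<n. cnj (w i) * pull m W W' A i k * v k))\<^sup>2 \<le> nrm {..<n} w * nrm {..<n} v" .
qed

lemma contractive_if_nonincreasing:
  assumes "norm_nonincreasing n n A"
  shows "contractive n A"
  unfolding contractive_def
proof (intro allI)
  fix w v
  have "(\<Sum>i<n. \<Sum>k<n. cnj (w i) * A i k * v k) = (\<Sum>i<n. cnj (w i) * (\<Sum>k<n. A i k * v k))"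
    by (simp add: sum_distrib_left mult.assoc)
  then have "(cmod (\<Sum>i<n. \<Sum>k<n. cnj (w i) * A i k * v k))\<^sup>2 \<le> nrm {..<n} w * nrm {..<n} (\<lambda>i. \<Sum>k<n. A i k * v k)"
    using cauchy_schwarz_nrm by simp
  also have "\<dots> \<le> nrm {..<n} w * nrm {..<n} v"
    using assms unfolding norm_nonincreasing_def by (intro mult_left_mono) auto
  finally show "(cmod (\<Sum>i<n. \<Sum>k<n. cnj (w i) * A i k * v k))\<^sup>2 \<le> nrm {..<n} w * nrm {..<n} v" .
qed

lemma le_of_square_le_mult: "x \<le> c" if "x\<^sup>2 \<le> c * x" "0 \<le> x" "0 \<le> c" for x c :: real
proof (cases "x = 0")
  case False
  then have "x > 0" using that by simp
  then show ?thesis using that(1) by (simp add: power2_eq_square)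
qed (use that in simp)

text \<open>Feeding the conjugate of the vector in question to the form gives
  \<open>N^2 \<le> nrm {..<n} w * N\<close> for its squared norm \<open>N\<close>.\<close>

lemma contractive_column:
  assumes "contractive n A"
  shows "nrm {..<n} (\<lambda>k. \<Sum>i<n. cnj (w i) * A i k) \<le> nrm {..<n} w"
proof -
  define c where "c = (\<lambda>k. \<Sum>i<n. cnj (w i) * A i k)"
  have "(\<Sum>i<n. \<Sum>k<n. cnj (w i) * A i k * cnj (c k)) = (\<Sum>k<n. c k * cnj (c k))"
    unfolding c_def by (subst sum.swap) (simp add: sum_distrib_right)
  also have "\<dots> = complex_of_real (nrm {..<n} c)" unfolding of_real_nrm by (simp add: mult.commute)
  finally have e: "cmod (\<Sum>i<n. \<Sum>k<n. cnj (w i) * A i k * cnj (c k)) = nrm {..<n} c" by simp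
  have "nrm {..<n} (\<lambda>k. cnj (c k)) = nrm {..<n} c" by (simp add: nrm_def)
  then have "(nrm {..<n} c)\<^sup>2 \<le> nrm {..<n} w * nrm {..<n} c"
    using assms[unfolded contractive_def, rule_format, of w "\<lambda>k. cnj (c k)"] unfolding e by simp
  then show ?thesis unfolding c_def[symmetric] by (rule le_of_square_le_mult) auto
qed

lemma contractive_row:
  assumes "contractive n A"
  shows "nrm {..<n} (\<lambda>i. \<Sum>k<n. A i k * v k) \<le> nrm {..<n} v"
proof -
  define c where "c = (\<lambda>i. \<Sum>k<n. A i k * v k)"
  have "(\<Sum>i<n. \<Sum>k<n. cnj (c i) * A i k * v k) = complex_of_real (nrm {..<n} c)"
    unfolding of_real_nrm by (simp add: c_def sum_distrib_left mult.assoc)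
  then have e: "cmod (\<Sum>i<n. \<Sum>k<n. cnj (c i) * A i k * v k) = nrm {..<n} c" by simp
  have "(nrm {..<n} c)\<^sup>2 \<le> nrm {..<n} v * nrm {..<n} c"
    using assms[unfolded contractive_def, rule_format, of c v] unfolding e by (simp add: mult.commute)
  then show ?thesis unfolding c_def[symmetric] by (rule le_of_square_le_mult) auto
qed

lemma norm_nonincreasing_embed:
  assumes "inj_on \<iota> {..<n}" "\<iota> ` {..<n} \<subseteq> {..<m}"
  shows "norm_nonincreasing m n (\<lambda>i k. if i = \<iota> k then 1 else 0)"
  unfolding norm_nonincreasing_def
proof
  fix v :: "nat \<Rightarrow> complex"
  let ?w = "\<lambda>i. \<Sum>k<n. (if i = \<iota> k then 1 else 0) * v k"
  have v: "?w (\<iota> k) = v k" if "k < n" for k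
  proof -
    have "?w (\<iota> k) = (\<Sum>l<n. if l = k then v k else 0)"
      by (rule sum.cong) (use assms(1) that in \<open>auto simp: inj_on_def\<close>)
    then show ?thesis using that by simp
  qed
  have z: "?w i = 0" if "i \<notin> \<iota> ` {..<n}" for i
    using that by (intro sum.neutral) auto
  have "nrm {..<m} ?w = (\<Sum>i\<in>\<iota> ` {..<n}. (cmod (?w i))\<^sup>2)"
    unfolding nrm_def by (rule sum.mono_neutral_right) (use assms(2) z in auto)
  also have "\<dots> = (\<Sum>k<n. (cmod (v k))\<^sup>2)"
    unfolding sum.reindex[OF assms(1)] by (rule sum.cong) (simp_all only: o_def v lessThan_iff)
  finally show "nrm {..<m} ?w \<le> nrm {..<n} v" by (simp add: nrm_def)
qed

lemma norm_nonincreasing_restrict: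
  assumes "norm_nonincreasing m n W" "inj_on \<iota> {..<m'}" "\<iota> ` {..<m'} \<subseteq> {..<m}"
  shows "norm_nonincreasing m' n (\<lambda>i. W (\<iota> i))"
  unfolding norm_nonincreasing_def
proof
  fix v
  have "nrm {..<m'} (\<lambda>i. \<Sum>k<n. W (\<iota> i) k * v k) = nrm (\<iota> ` {..<m'}) (\<lambda>i. \<Sum>k<n. W i k * v k)"
    unfolding nrm_def by (simp add: sum.reindex[OF assms(2)])
  also have "\<dots> \<le> nrm {..<m} (\<lambda>i. \<Sum>k<n. W i k * v k)"
    by (rule nrm_mono) (use assms(3) in auto)
  also have "\<dots> \<le> nrm {..<n} v" using assms(1) by (simp add: norm_nonincreasing_def)
  finally show "nrm {..<m'} (\<lambda>i. \<Sum>k<n. W (\<iota> i) k * v k) \<le> nrm {..<n} v" .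
qed

lemma tensor_form_cong:
  assumes "\<And>p. p \<in> {..<a} \<times> {..<b} \<Longrightarrow> \<Phi> p = \<Phi>' p" "\<And>p. p \<in> {..<a} \<times> {..<b} \<Longrightarrow> \<Psi> p = \<Psi>' p"
  shows "tensor_form a b A B \<Phi> \<Psi> = tensor_form a b A B \<Phi>' \<Psi>'"
  unfolding tensor_form_def by (intro sum.cong refl) (simp only: assms)

lemma tensor_form_add:
  "tensor_form a b A B (\<lambda>p. \<Phi> p + \<Phi>' p) (\<lambda>p. \<Psi> p + \<Psi>' p)
   = tensor_form a b A B \<Phi> \<Psi> + tensor_form a b A B \<Phi> \<Psi>' + tensor_form a b A B \<Phi>' \<Psi> + tensor_form a b A B \<Phi>' \<Psi>'"
  unfolding tensor_form_def sum.distrib[symmetric]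
  by (intro sum.cong refl) (simp add: algebra_simps)

text \<open>The tensor product of \<open>W\<close> and \<open>Z\<close> applied to
  \<open>\<Psi>\<close>; \<open>a\<close> and \<open>b\<close> are the dimensions of the
  source.\<close>

definition tensor_apply :: "nat \<Rightarrow> nat \<Rightarrow> kernel \<Rightarrow> kernel \<Rightarrow> (nat \<times> nat \<Rightarrow> complex) \<Rightarrow> nat \<times> nat \<Rightarrow> complex" where
  "tensor_apply a b W Z \<Psi> p = (\<Sum>q\<in>{..<a}\<times>{..<b}. (W (fst p) (fst q) * Z (snd p) (snd q)) * \<Psi> q)"

lemma tensor_form_pull:
  "tensor_form a' b' A B (tensor_apply a b W Z \<Phi>) (tensor_apply a b W' Z' \<Psi>)
   = tensor_form a b (pull a' W W' A) (pull b' Z Z' B) \<Phi> \<Psi>"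
proof -
  have "(\<Sum>p\<in>{..<a'}\<times>{..<b'}. \<Sum>p'\<in>{..<a'}\<times>{..<b'}.
      cnj (W (fst p) k * Z (snd p) l) * (A (fst p) (fst p') * B (snd p) (snd p')) * (W' (fst p') k' * Z' (snd p') l'))
     = pull a' W W' A k k' * pull b' Z Z' B l l'" for k l k' l'
  proof -
    have "pull a' W W' A k k' * pull b' Z Z' B l l'
      = (\<Sum>i<a'. \<Sum>j<b'. \<Sum>i'<a'. \<Sum>j'<b'. (cnj (W i k) * A i i' * W' i' k') * (cnj (Z j l) * B j j' * Z' j' l'))"
      unfolding pull_def by (simp only: sum_product)
    also have "\<dots> = (\<Sum>p\<in>{..<a'}\<times>{..<b'}. \<Sum>p'\<in>{..<a'}\<times>{..<b'}.
      (cnj (W (fst p) k) * A (fst p) (fst p') * W' (fst p') k') * (cnj (Z (snd p) l) * B (snd p) (snd p') * Z' (snd p') l'))"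
      by (simp only: sum_Times fst_conv snd_conv)
    also have "\<dots> = (\<Sum>p\<in>{..<a'}\<times>{..<b'}. \<Sum>p'\<in>{..<a'}\<times>{..<b'}.
      cnj (W (fst p) k * Z (snd p) l) * (A (fst p) (fst p') * B (snd p) (snd p')) * (W' (fst p') k' * Z' (snd p') l'))"
      by (intro sum.cong refl) (simp add: mult_ac)
    finally show ?thesis ..
  qed
  then show ?thesis unfolding tensor_form_def tensor_apply_def sesquilinear_pull by simp
qed

text \<open>Letting \<open>A\<close> act on the left argument only and \<open>B\<close> on the right
  one only writes the form as a sum of products. One factor is a vector determined by Alice's
  operator, the other by Bob's, which is the shape that \<open>pattern_matrix_bound\<close> asks
  for.\<close>

lemma tensor_form_inner:
  "tensor_form a b A B \<Psi> \<Psi> = (\<Sum>p\<in>{..<a}\<times>{..<b}.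
     (\<Sum>i<a. cnj (\<Psi> (i, snd p)) * A i (fst p)) * (\<Sum>j<b. B (snd p) j * \<Psi> (fst p, j)))"
proof -
  have "tensor_form a b A B \<Psi> \<Psi> = (\<Sum>i<a. \<Sum>j<b. \<Sum>i'<a. \<Sum>j'<b. cnj (\<Psi> (i,j)) * (A i i' * B j j') * \<Psi> (i',j'))"
    unfolding tensor_form_def by (simp only: sum_Times fst_conv snd_conv)
  also have "\<dots> = (\<Sum>i'<a. \<Sum>j<b. \<Sum>i<a. \<Sum>j'<b. cnj (\<Psi> (i,j)) * (A i i' * B j j') * \<Psi> (i',j'))"
    by (simp only: sum.cartesian_product)
      (rule sum.reindex_bij_witness[of _ "\<lambda>(i',j,i,j'). (i,j,i',j')" "\<lambda>(i,j,i',j'). (i',j,i,j')"]; auto)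
  also have "\<dots> = (\<Sum>i'<a. \<Sum>j<b. (\<Sum>i<a. cnj (\<Psi> (i,j)) * A i i') * (\<Sum>j'<b. B j j' * \<Psi> (i',j')))"
    by (intro sum.cong refl) (simp add: sum_product mult.assoc)
  also have "\<dots> = (\<Sum>p\<in>{..<a}\<times>{..<b}.
     (\<Sum>i<a. cnj (\<Psi> (i, snd p)) * A i (fst p)) * (\<Sum>j<b. B (snd p) j * \<Psi> (fst p, j)))"
    by (simp only: sum_Times fst_conv snd_conv)
  finally show ?thesis .
qed

section \<open>Two-index coordinates for states, matrices and protocol steps\<close>

definition coords :: "nat \<Rightarrow> complex Matrix.vec \<Rightarrow> nat \<times> nat \<Rightarrow> complex" where
  "coords b \<psi> p = vec_index \<psi> (fst p * b + snd p)"

definition ident :: kernel where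
  "ident i k = (if i = k then 1 else 0)"

lemma sum_lessThan_mult:
  fixes a b :: nat
  shows "(\<Sum>c<a*b. f c) = (\<Sum>i<a. \<Sum>j<b. f (i * b + j))"
proof -
  have "(\<Sum>c<a*b. f c) = (\<Sum>i<a. sum f {i*b..<i*b+b})"
    by (simp add: sum.nat_group)
  also have "\<dots> = (\<Sum>i<a. \<Sum>j<b. f (i * b + j))"
  proof (rule sum.cong[OF refl])
    fix i
    show "sum f {i*b..<i*b+b} = (\<Sum>j<b. f (i * b + j))"
      by (rule sum.reindex_bij_witness[of _ "\<lambda>j. i * b + j" "\<lambda>c. c - i * b"]) auto
  qed
  finally show ?thesis .
qed

lemma index_pair_less: "i * b + j < a * b" if "i < a" "j < b" for i j a b :: nat
proof -
  have "i * b + j < Suc i * b" using that by simp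
  also have "\<dots> \<le> a * b" using that by (intro mult_right_mono) auto
  finally show ?thesis .
qed

lemma norm2_vec_coords:
  assumes "\<psi> \<in> carrier_vec (a * b)"
  shows "norm2_vec \<psi> = nrm ({..<a} \<times> {..<b}) (coords b \<psi>)"
proof -
  have "\<psi> \<bullet>c \<psi> = (\<Sum>c<a*b. vec_index \<psi> c * cnj (vec_index \<psi> c))"
    unfolding scalar_prod_def by (rule sum.cong) (use assms in auto)
  also have "\<dots> = complex_of_real (\<Sum>c<a*b. (cmod (vec_index \<psi> c))\<^sup>2)"
    by (simp only: of_real_sum complex_norm_square)
  finally have "norm2_vec \<psi> = (\<Sum>c<a*b. (cmod (vec_index \<psi> c))\<^sup>2)"
    unfolding norm2_vec_def by (simp only: Re_complex_of_real)
  then show ?thesis unfolding sum_lessThan_mult nrm_def sum_Times coords_def by simp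
qed

lemma index_mult_mat_vec_sum:
  assumes "M \<in> carrier_mat m n" "\<psi> \<in> carrier_vec n" "r < m"
  shows "vec_index (M *\<^sub>v \<psi>) r = (\<Sum>c<n. M $$ (r, c) * vec_index \<psi> c)"
  using assms by (auto simp: scalar_prod_def atLeast0LessThan intro!: sum.cong)

lemma kron_mat_carrier:
  assumes "A \<in> carrier_mat a' a" "B \<in> carrier_mat b' b"
  shows "kron_mat A B \<in> carrier_mat (a' * b') (a * b)"
  using assms by (simp add: kron_mat_def)

lemma kron_mat_index:
  assumes "A \<in> carrier_mat a' a" "B \<in> carrier_mat b' b" "i < a'" "j < b'" "k < a" "l < b"
  shows "kron_mat A B $$ (i * b' + j, k * b + l) = A $$ (i, k) * B $$ (j, l)"
  using assms by (simp add: kron_mat_def index_pair_less)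

lemma coords_kron:
  assumes A: "A \<in> carrier_mat a' a" and B: "B \<in> carrier_mat b' b" and \<psi>: "\<psi> \<in> carrier_vec (a * b)"
    and ij: "i < a'" "j < b'"
  shows "coords b' (kron_mat A B *\<^sub>v \<psi>) (i, j) = (\<Sum>k<a. \<Sum>l<b. A $$ (i, k) * B $$ (j, l) * coords b \<psi> (k, l))"
  unfolding coords_def fst_conv snd_conv
    index_mult_mat_vec_sum[OF kron_mat_carrier[OF A B] \<psi> index_pair_less[OF ij]] sum_lessThan_mult
  by (intro sum.cong refl) (simp add: kron_mat_index[OF A B ij])

lemma coords_kron_left:
  assumes A: "A \<in> carrier_mat a' a" and \<psi>: "\<psi> \<in> carrier_vec (a * b)" and ij: "i < a'" "j < b"
  shows "coords b (kron_mat A (1\<^sub>m b) *\<^sub>v \<psi>) (i, j) = (\<Sum>k<a. A $$ (i, k) * coords b \<psi> (k, j))"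
proof -
  have "(\<Sum>l<b. A $$ (i, k) * 1\<^sub>m b $$ (j, l) * coords b \<psi> (k, l)) = A $$ (i, k) * coords b \<psi> (k, j)" for k
  proof -
    have "(\<Sum>l<b. A $$ (i, k) * 1\<^sub>m b $$ (j, l) * coords b \<psi> (k, l))
       = (\<Sum>l<b. if l = j then A $$ (i, k) * coords b \<psi> (k, j) else 0)"
      by (rule sum.cong) (use ij in auto)
    then show ?thesis using ij by simp
  qed
  then show ?thesis unfolding coords_kron[OF A one_carrier_mat \<psi> ij] by simp
qed

lemma coords_kron_right:
  assumes B: "B \<in> carrier_mat b' b" and \<psi>: "\<psi> \<in> carrier_vec (a * b)" and ij: "i < a" "j < b'"
  shows "coords b' (kron_mat (1\<^sub>m a) B *\<^sub>v \<psi>) (i, j) = (\<Sum>l<b. B $$ (j, l) * coords b \<psi> (i, l))"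
proof -
  have "(\<Sum>k<a. \<Sum>l<b. 1\<^sub>m a $$ (i, k) * B $$ (j, l) * coords b \<psi> (k, l))
       = (\<Sum>k<a. if k = i then \<Sum>l<b. B $$ (j, l) * coords b \<psi> (i, l) else 0)"
    by (rule sum.cong) (use ij in auto)
  then show ?thesis unfolding coords_kron[OF one_carrier_mat B \<psi> ij] using ij by simp
qed

lemma mat_adjoint_mult_index:
  assumes "U \<in> carrier_mat m n" "k < n" "l < n"
  shows "(mat_adjoint U * U) $$ (k, l) = (\<Sum>i<m. cnj (U $$ (i, k)) * U $$ (i, l))"
  using assms unfolding mat_adjoint_def
  by (auto simp: scalar_prod_def mat_of_rows_def atLeast0LessThan intro!: sum.cong)

text \<open>The squared norm is the form of the Gram matrix of \<open>W\<close>; inserting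
  \<open>ident\<close> as a kernel makes this an instance of
  \<open>sesquilinear_pull\<close>.\<close>

lemma of_real_nrm_apply:
  fixes m n :: nat
  shows "complex_of_real (nrm {..<m} (\<lambda>i. \<Sum>k<n. W i k * v k))
    = (\<Sum>k<n. \<Sum>l<n. cnj (v k) * (\<Sum>i<m. cnj (W i k) * W i l) * v l)"
proof -
  have *: "(\<Sum>i<m. \<Sum>i'<m. x i * ident i i' * y i') = (\<Sum>i<m. x i * y i)" for x y :: "nat \<Rightarrow> complex"
  proof (rule sum.cong[OF refl])
    fix i assume "i \<in> {..<m}"
    moreover have "(\<Sum>i'<m. x i * ident i i' * y i') = (\<Sum>i'<m. if i' = i then x i * y i else 0)"
      by (rule sum.cong) (auto simp: ident_def)
    ultimately show "(\<Sum>i'<m. x i * ident i i' * y i') = x i * y i" by simp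
  qed
  have "complex_of_real (nrm {..<m} (\<lambda>i. \<Sum>k<n. W i k * v k))
     = (\<Sum>i<m. \<Sum>i'<m. cnj (\<Sum>k<n. W i k * v k) * ident i i' * (\<Sum>k<n. W i' k * v k))"
    unfolding of_real_nrm * ..
  then show ?thesis unfolding sesquilinear_pull * .
qed

lemma nrm_isometry:
  assumes "isometry_mat m n U"
  shows "nrm {..<m} (\<lambda>i. \<Sum>k<n. U $$ (i, k) * v k) = nrm {..<n} v"
proof -
  have U: "U \<in> carrier_mat m n" "mat_adjoint U * U = 1\<^sub>m n" using assms by (auto simp: isometry_mat_def)
  have e: "(\<Sum>i<m. cnj (U $$ (i, k)) * U $$ (i, l)) = ident k l" if "k < n" "l < n" for k l
    using mat_adjoint_mult_index[OF U(1) that] that unfolding U(2) by (simp add: ident_def)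
  have "complex_of_real (nrm {..<m} (\<lambda>i. \<Sum>k<n. U $$ (i, k) * v k)) = (\<Sum>k<n. \<Sum>l<n. cnj (v k) * ident k l * v l)"
    unfolding of_real_nrm_apply by (intro sum.cong refl) (simp add: e)
  also have "\<dots> = (\<Sum>k<n. \<Sum>l<n. if l = k then cnj (v k) * v k else 0)"
    by (intro sum.cong refl) (simp add: ident_def)
  also have "\<dots> = complex_of_real (nrm {..<n} v)" unfolding of_real_nrm by simp
  finally show ?thesis by (simp only: of_real_eq_iff)
qed

text \<open>The Gram matrix of a projector is the projector itself.\<close>

lemma nrm_projector:
  assumes "projector_mat n E"
  shows "complex_of_real (nrm {..<n} (\<lambda>i. \<Sum>k<n. E $$ (i, k) * v k))
    = (\<Sum>i<n. \<Sum>k<n. cnj (v i) * E $$ (i, k) * v k)"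
proof -
  have E: "E \<in> carrier_mat n n" "mat_adjoint E * E = E" using assms by (auto simp: projector_mat_def)
  have e: "(\<Sum>i<n. cnj (E $$ (i, k)) * E $$ (i, l)) = E $$ (k, l)" if "k < n" "l < n" for k l
    using mat_adjoint_mult_index[OF E(1) that] unfolding E(2) ..
  show ?thesis unfolding of_real_nrm_apply by (intro sum.cong refl) (simp add: e)
qed

lemma norm_nonincreasing_isometry:
  "isometry_mat m n U \<Longrightarrow> norm_nonincreasing m n (\<lambda>i k. U $$ (i, k))"
  by (simp add: norm_nonincreasing_def nrm_isometry)

text \<open>The squared norm \<open>N\<close> of \<open>E v\<close> is the inner product of
  \<open>v\<close> with \<open>E v\<close>, so Cauchy-Schwarz gives
  \<open>N^2 \<le> nrm {..<n} v * N\<close>.\<close>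

lemma norm_nonincreasing_projector:
  assumes "projector_mat n E"
  shows "norm_nonincreasing n n (\<lambda>i k. E $$ (i, k))"
  unfolding norm_nonincreasing_def
proof
  fix v
  let ?w = "\<lambda>i. \<Sum>k<n. E $$ (i, k) * v k"
  have "(\<Sum>i<n. cnj (v i) * ?w i) = (\<Sum>i<n. \<Sum>k<n. cnj (v i) * E $$ (i, k) * v k)"
    by (simp only: sum_distrib_left mult.assoc)
  also have "\<dots> = complex_of_real (nrm {..<n} ?w)"
    by (rule nrm_projector[OF assms, symmetric])
  finally have e: "cmod (\<Sum>i<n. cnj (v i) * ?w i) = nrm {..<n} ?w" by (simp only: norm_of_real) simp
  have "(nrm {..<n} ?w)\<^sup>2 \<le> nrm {..<n} v * nrm {..<n} ?w"
    using cauchy_schwarz_nrm[where P="{..<n}" and w=v and v="?w"] unfolding e .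
  then show "nrm {..<n} ?w \<le> nrm {..<n} v" by (rule le_of_square_le_mult) auto
qed

lemma norm_nonincreasing_ident: "norm_nonincreasing n n ident"
  using norm_nonincreasing_embed[of "\<lambda>i. i" n n] unfolding ident_def by simp

lemma norm2_kron_left_le:
  assumes "A \<in> carrier_mat a' a" "norm_nonincreasing a' a (\<lambda>i k. A $$ (i, k))" "\<psi> \<in> carrier_vec (a * b)"
  shows "norm2_vec (kron_mat A (1\<^sub>m b) *\<^sub>v \<psi>) \<le> norm2_vec \<psi>"
proof -
  have c: "kron_mat A (1\<^sub>m b) *\<^sub>v \<psi> \<in> carrier_vec (a' * b)"
    using kron_mat_carrier[OF assms(1) one_carrier_mat] assms(3) by (rule mult_mat_vec_carrier)
  have "nrm {..<a'} (\<lambda>i. coords b (kron_mat A (1\<^sub>m b) *\<^sub>v \<psi>) (i, j)) \<le> nrm {..<a} (\<lambda>i. coords b \<psi> (i, j))" if "j < b" for j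
  proof -
    have "nrm {..<a'} (\<lambda>i. coords b (kron_mat A (1\<^sub>m b) *\<^sub>v \<psi>) (i, j)) = nrm {..<a'} (\<lambda>i. \<Sum>k<a. A $$ (i, k) * coords b \<psi> (k, j))"
      unfolding nrm_def by (intro sum.cong refl) (simp add: coords_kron_left[OF assms(1,3) _ that])
    then show ?thesis using assms(2) unfolding norm_nonincreasing_def by simp
  qed
  then show ?thesis unfolding norm2_vec_coords[OF c] norm2_vec_coords[OF assms(3)] nrm_pairs
    by (intro sum_mono) simp
qed

lemma norm2_kron_right_le:
  assumes "B \<in> carrier_mat b' b" "norm_nonincreasing b' b (\<lambda>i k. B $$ (i, k))" "\<psi> \<in> carrier_vec (a * b)"
  shows "norm2_vec (kron_mat (1\<^sub>m a) B *\<^sub>v \<psi>) \<le> norm2_vec \<psi>"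
proof -
  have c: "kron_mat (1\<^sub>m a) B *\<^sub>v \<psi> \<in> carrier_vec (a * b')"
    using kron_mat_carrier[OF one_carrier_mat assms(1)] assms(3) by (rule mult_mat_vec_carrier)
  have "nrm {..<b'} (\<lambda>j. coords b' (kron_mat (1\<^sub>m a) B *\<^sub>v \<psi>) (i, j)) \<le> nrm {..<b} (\<lambda>j. coords b \<psi> (i, j))" if "i < a" for i
  proof -
    have "nrm {..<b'} (\<lambda>j. coords b' (kron_mat (1\<^sub>m a) B *\<^sub>v \<psi>) (i, j)) = nrm {..<b'} (\<lambda>j. \<Sum>l<b. B $$ (j, l) * coords b \<psi> (i, l))"
      unfolding nrm_def by (intro sum.cong refl) (simp add: coords_kron_right[OF assms(1,3) that])
    then show ?thesis using assms(2) unfolding norm_nonincreasing_def by simp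
  qed
  then show ?thesis unfolding norm2_vec_coords[OF c] norm2_vec_coords[OF assms(3)] nrm_pairs'
    by (intro sum_mono) simp
qed

lemma q_accept_prob_le:
  assumes "q_valid X Y P a b" "x \<in> X" "y \<in> Y" "\<psi> \<in> carrier_vec (a * b)"
  shows "q_accept_prob P x y a b \<psi> \<le> norm2_vec \<psi>"
  using assms
proof (induction P arbitrary: a b \<psi>)
  case (Alice_measures E)
  then have "projector_mat a (E x)" by simp
  then show ?case using norm2_kron_left_le[of "E x" a a \<psi> b] norm_nonincreasing_projector Alice_measures
    by (simp add: projector_mat_def)
next
  case (Bob_measures E)
  then have "projector_mat b (E y)" by simp
  then show ?case using norm2_kron_right_le[of "E y" b b \<psi> a] norm_nonincreasing_projector Bob_measures
    by (simp add: projector_mat_def)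
next
  case (Alice_sends_qubit a' U P)
  then have U: "isometry_mat (a' * 2) a (U x)" "U x \<in> carrier_mat (a' * 2) a" by (auto simp: isometry_mat_def)
  have "kron_mat (U x) (1\<^sub>m b) *\<^sub>v \<psi> \<in> carrier_vec (a' * (2 * b))"
    using mult_mat_vec_carrier[OF kron_mat_carrier[OF U(2) one_carrier_mat] Alice_sends_qubit.prems(4)] by (simp add: mult.assoc)
  then have "q_accept_prob (Alice_sends_qubit a' U P) x y a b \<psi> \<le> norm2_vec (kron_mat (U x) (1\<^sub>m b) *\<^sub>v \<psi>)"
    using Alice_sends_qubit by simp
  also have "\<dots> \<le> norm2_vec \<psi>"
    by (rule norm2_kron_left_le[OF U(2) norm_nonincreasing_isometry[OF U(1)] Alice_sends_qubit.prems(4)])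
  finally show ?case .
next
  case (Bob_sends_qubit b' V P)
  then have V: "isometry_mat (2 * b') b (V y)" "V y \<in> carrier_mat (2 * b') b" by (auto simp: isometry_mat_def)
  have "kron_mat (1\<^sub>m a) (V y) *\<^sub>v \<psi> \<in> carrier_vec (a * 2 * b')"
    using mult_mat_vec_carrier[OF kron_mat_carrier[OF one_carrier_mat V(2)] Bob_sends_qubit.prems(4)] by (simp add: mult.assoc)
  then have "q_accept_prob (Bob_sends_qubit b' V P) x y a b \<psi> \<le> norm2_vec (kron_mat (1\<^sub>m a) (V y) *\<^sub>v \<psi>)"
    using Bob_sends_qubit by simp
  also have "\<dots> \<le> norm2_vec \<psi>"
    by (rule norm2_kron_right_le[OF V(2) norm_nonincreasing_isometry[OF V(1)] Bob_sends_qubit.prems(4)])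
  finally show ?case .
qed

lemma q_accept_prob_nonneg: "q_accept_prob P x y a b \<psi> \<ge> 0"
proof -
  have n: "norm2_vec v \<ge> 0" for v
    using norm2_vec_coords[of v "dim_vec v" 1] by simp
  show ?thesis by (induction P arbitrary: a b \<psi>) (simp_all add: n)
qed

section \<open>Acceptance probabilities as sums of tensor forms\<close>

definition contractive_pairs :: "'x set \<Rightarrow> 'y set \<Rightarrow> nat \<Rightarrow> nat \<Rightarrow> (('x \<Rightarrow> kernel) \<times> ('y \<Rightarrow> kernel)) list \<Rightarrow> bool" where
  "contractive_pairs X Y a b L \<longleftrightarrow>
     (\<forall>(A, B)\<in>set L. (\<forall>x\<in>X. contractive a (A x)) \<and> (\<forall>y\<in>Y. contractive b (B y)))"

definition pairs_form :: "nat \<Rightarrow> nat \<Rightarrow> (('x \<Rightarrow> kernel) \<times> ('y \<Rightarrow> kernel)) list \<Rightarrow> 'x \<Rightarrow> 'y \<Rightarrow> (nat \<times> nat \<Rightarrow> complex) \<Rightarrow> complex" where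
  "pairs_form a b L x y \<Psi> = (\<Sum>(A, B)\<leftarrow>L. tensor_form a b (A x) (B y) \<Psi> \<Psi>)"

definition pull_pairs :: "nat \<Rightarrow> nat \<Rightarrow> ('x \<Rightarrow> nat \<Rightarrow> kernel) \<Rightarrow> ('y \<Rightarrow> nat \<Rightarrow> kernel) \<Rightarrow>
    (('x \<Rightarrow> kernel) \<times> ('y \<Rightarrow> kernel)) list \<Rightarrow> nat \<Rightarrow> nat \<Rightarrow> (('x \<Rightarrow> kernel) \<times> ('y \<Rightarrow> kernel)) list" where
  "pull_pairs m n W Z L s s' = map (\<lambda>(A, B). (\<lambda>x. pull m (W x s) (W x s') (A x), \<lambda>y. pull n (Z y s) (Z y s') (B y))) L"

text \<open>The index \<open>s\<close> in \<open>W x s\<close> and \<open>Z y s\<close> is the value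
  of the transferred qubit. The new state is a sum over \<open>s\<close> of product operators
  applied to the old one, and the four lists are the terms of a quadratic form in this sum.\<close>

definition pull_all :: "nat \<Rightarrow> nat \<Rightarrow> ('x \<Rightarrow> nat \<Rightarrow> kernel) \<Rightarrow> ('y \<Rightarrow> nat \<Rightarrow> kernel) \<Rightarrow>
    (('x \<Rightarrow> kernel) \<times> ('y \<Rightarrow> kernel)) list \<Rightarrow> (('x \<Rightarrow> kernel) \<times> ('y \<Rightarrow> kernel)) list" where
  "pull_all m n W Z L = pull_pairs m n W Z L 0 0 @ pull_pairs m n W Z L 0 1 @
     pull_pairs m n W Z L 1 0 @ pull_pairs m n W Z L 1 1"

lemma length_pull_all: "length (pull_all m n W Z L) = 4 * length L"
  by (simp add: pull_all_def pull_pairs_def)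

lemma contractive_pairs_append:
  "contractive_pairs X Y a b (L @ L') \<longleftrightarrow> contractive_pairs X Y a b L \<and> contractive_pairs X Y a b L'"
  by (simp only: contractive_pairs_def set_append ball_Un)

lemma contractive_pairs_pull_all:
  assumes "contractive_pairs X Y m n L"
    and "\<And>x s. x \<in> X \<Longrightarrow> s < 2 \<Longrightarrow> norm_nonincreasing m a (W x s)"
    and "\<And>y s. y \<in> Y \<Longrightarrow> s < 2 \<Longrightarrow> norm_nonincreasing n b (Z y s)"
  shows "contractive_pairs X Y a b (pull_all m n W Z L)"
proof -
  have *: "contractive_pairs X Y a b (pull_pairs m n W Z L s s')" if "s < 2" "s' < 2" for s s'
    unfolding contractive_pairs_def
  proof (clarify, intro conjI ballI)
    fix A B assume "(A, B) \<in> set (pull_pairs m n W Z L s s')"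
    then obtain A' B' where AB: "(A', B') \<in> set L" "A = (\<lambda>x. pull m (W x s) (W x s') (A' x))"
      "B = (\<lambda>y. pull n (Z y s) (Z y s') (B' y))"
      unfolding pull_pairs_def by auto
    have c: "\<forall>x\<in>X. contractive m (A' x)" "\<forall>y\<in>Y. contractive n (B' y)"
      using assms(1) AB(1) unfolding contractive_pairs_def by auto
    show "contractive a (A x)" if "x \<in> X" for x
      unfolding AB(2) using c that \<open>s < 2\<close> \<open>s' < 2\<close> by (intro contractive_pull[of m] assms(2)) auto
    show "contractive b (B y)" if "y \<in> Y" for y
      unfolding AB(3) using c that \<open>s < 2\<close> \<open>s' < 2\<close> by (intro contractive_pull[of n] assms(3)) auto
  qed
  show ?thesis unfolding pull_all_def by (simp add: contractive_pairs_append *)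
qed

lemma pairs_form_append: "pairs_form a b (L @ L') x y \<Psi> = pairs_form a b L x y \<Psi> + pairs_form a b L' x y \<Psi>"
  by (simp add: pairs_form_def)

lemma pairs_form_pull_all:
  assumes "\<And>p. p \<in> {..<m} \<times> {..<n} \<Longrightarrow>
     \<Phi> p = tensor_apply a b (W x 0) (Z y 0) \<Psi> p + tensor_apply a b (W x 1) (Z y 1) \<Psi> p"
  shows "pairs_form m n L x y \<Phi> = pairs_form a b (pull_all m n W Z L) x y \<Psi>"
proof -
  have "tensor_form m n (A x) (B y) \<Phi> \<Phi> =
      tensor_form a b (pull m (W x 0) (W x 0) (A x)) (pull n (Z y 0) (Z y 0) (B y)) \<Psi> \<Psi>
    + tensor_form a b (pull m (W x 0) (W x 1) (A x)) (pull n (Z y 0) (Z y 1) (B y)) \<Psi> \<Psi>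
    + tensor_form a b (pull m (W x 1) (W x 0) (A x)) (pull n (Z y 1) (Z y 0) (B y)) \<Psi> \<Psi>
    + tensor_form a b (pull m (W x 1) (W x 1) (A x)) (pull n (Z y 1) (Z y 1) (B y)) \<Psi> \<Psi>" for A B
    unfolding tensor_form_pull[symmetric] tensor_form_add[symmetric]
    by (rule tensor_form_cong; erule assms)
  then show ?thesis unfolding pull_all_def pairs_form_append
    by (induction L) (simp_all add: pairs_form_def pull_pairs_def case_prod_beta)
qed

text \<open>A qubit that reaches Bob becomes the first factor of his system, so the value
  \<open>s\<close> shifts his index by \<open>c = s * b\<close>.\<close>

lemma tensor_apply_shift_right:
  "tensor_apply a b W (\<lambda>m l. if m = c + l then 1 else 0) \<Psi> (i, m)
    = (if c \<le> m \<and> m < c + b then \<Sum>k<a. W i k * \<Psi> (k, m - c) else 0)"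
proof -
  have "(\<Sum>l<b. W i k * (if m = c + l then 1 else 0) * \<Psi> (k, l))
      = (if c \<le> m \<and> m < c + b then W i k * \<Psi> (k, m - c) else 0)" for k
  proof -
    have "(\<Sum>l<b. W i k * (if m = c + l then 1 else 0) * \<Psi> (k, l))
      = (\<Sum>l<b. if l = m - c then (if c \<le> m then W i k * \<Psi> (k, m - c) else 0) else 0)"
      by (rule sum.cong) auto
    then show ?thesis by auto
  qed
  then show ?thesis unfolding tensor_apply_def sum_Times by (cases "c \<le> m \<and> m < c + b") auto
qed

text \<open>A qubit that reaches Alice becomes the last factor of her system, so her index
  \<open>k\<close> turns into \<open>k * 2 + s\<close>.\<close>

lemma tensor_apply_double_left:
  assumes "s < 2"
  shows "tensor_apply a b (\<lambda>i k. if i = k * 2 + s then 1 else 0) Z \<Psi> (i, j)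
    = (if i mod 2 = s \<and> i div 2 < a then \<Sum>l<b. Z j l * \<Psi> (i div 2, l) else 0)"
proof -
  have e: "i = k * 2 + s \<longleftrightarrow> i mod 2 = s \<and> k = i div 2" for k using assms by auto
  have "tensor_apply a b (\<lambda>i k. if i = k * 2 + s then 1 else 0) Z \<Psi> (i, j)
     = (\<Sum>k<a. if k = i div 2 then (if i mod 2 = s then \<Sum>l<b. Z j l * \<Psi> (i div 2, l) else 0) else 0)"
    unfolding tensor_apply_def sum_Times fst_conv snd_conv e by (rule sum.cong) auto
  then show ?thesis by auto
qed

lemma tensor_form_ident_right:
  "tensor_form a b A ident \<Psi> \<Psi> = (\<Sum>j<b. \<Sum>i<a. \<Sum>k<a. cnj (\<Psi> (i, j)) * A i k * \<Psi> (k, j))"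
proof -
  have "(\<Sum>j'<b. ident j j' * \<Psi> (i, j')) = \<Psi> (i, j)" if "j < b" for i j
  proof -
    have "(\<Sum>j'<b. ident j j' * \<Psi> (i, j')) = (\<Sum>j'<b. if j' = j then \<Psi> (i, j) else 0)"
      by (rule sum.cong) (auto simp: ident_def)
    then show ?thesis using that by simp
  qed
  then have "tensor_form a b A ident \<Psi> \<Psi> = (\<Sum>k<a. \<Sum>j<b. (\<Sum>i<a. cnj (\<Psi> (i, j)) * A i k) * \<Psi> (k, j))"
    unfolding tensor_form_inner sum_Times by simp
  also have "\<dots> = (\<Sum>j<b. \<Sum>k<a. \<Sum>i<a. cnj (\<Psi> (i, j)) * A i k * \<Psi> (k, j))"
    by (subst sum.swap) (simp only: sum_distrib_right)
  also have "\<dots> = (\<Sum>j<b. \<Sum>i<a. \<Sum>k<a. cnj (\<Psi> (i, j)) * A i k * \<Psi> (k, j))"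
    by (intro sum.cong refl sum.swap)
  finally show ?thesis .
qed

lemma tensor_form_ident_left:
  "tensor_form a b ident B \<Psi> \<Psi> = (\<Sum>i<a. \<Sum>j<b. \<Sum>l<b. cnj (\<Psi> (i, j)) * B j l * \<Psi> (i, l))"
proof -
  have "(\<Sum>i'<a. cnj (\<Psi> (i', j)) * ident i' i) = cnj (\<Psi> (i, j))" if "i < a" for i j
  proof -
    have "(\<Sum>i'<a. cnj (\<Psi> (i', j)) * ident i' i) = (\<Sum>i'<a. if i' = i then cnj (\<Psi> (i, j)) else 0)"
      by (rule sum.cong) (auto simp: ident_def)
    then show ?thesis using that by simp
  qed
  then have "tensor_form a b ident B \<Psi> \<Psi> = (\<Sum>i<a. \<Sum>j<b. cnj (\<Psi> (i, j)) * (\<Sum>l<b. B j l * \<Psi> (i, l)))"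
    unfolding tensor_form_inner sum_Times by simp
  then show ?thesis by (simp only: sum_distrib_left mult.assoc)
qed

lemma accept_Alice_measures:
  assumes "projector_mat a E" "\<psi> \<in> carrier_vec (a * b)"
  shows "complex_of_real (norm2_vec (kron_mat E (1\<^sub>m b) *\<^sub>v \<psi>))
    = tensor_form a b (\<lambda>i k. E $$ (i, k)) ident (coords b \<psi>) (coords b \<psi>)"
proof -
  have E: "E \<in> carrier_mat a a" using assms by (simp add: projector_mat_def)
  have c: "kron_mat E (1\<^sub>m b) *\<^sub>v \<psi> \<in> carrier_vec (a * b)"
    using kron_mat_carrier[OF E one_carrier_mat] assms(2) by (rule mult_mat_vec_carrier)
  have "nrm {..<a} (\<lambda>i. coords b (kron_mat E (1\<^sub>m b) *\<^sub>v \<psi>) (i, j))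
     = nrm {..<a} (\<lambda>i. \<Sum>k<a. E $$ (i, k) * coords b \<psi> (k, j))" if "j < b" for j
    unfolding nrm_def by (intro sum.cong refl) (simp add: coords_kron_left[OF E assms(2) _ that])
  then have "norm2_vec (kron_mat E (1\<^sub>m b) *\<^sub>v \<psi>) = (\<Sum>j<b. nrm {..<a} (\<lambda>i. \<Sum>k<a. E $$ (i, k) * coords b \<psi> (k, j)))"
    unfolding norm2_vec_coords[OF c] nrm_pairs by simp
  then show ?thesis unfolding tensor_form_ident_right by (simp only: of_real_sum nrm_projector[OF assms(1)])
qed

lemma accept_Bob_measures:
  assumes "projector_mat b E" "\<psi> \<in> carrier_vec (a * b)"
  shows "complex_of_real (norm2_vec (kron_mat (1\<^sub>m a) E *\<^sub>v \<psi>))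
    = tensor_form a b ident (\<lambda>i k. E $$ (i, k)) (coords b \<psi>) (coords b \<psi>)"
proof -
  have E: "E \<in> carrier_mat b b" using assms by (simp add: projector_mat_def)
  have c: "kron_mat (1\<^sub>m a) E *\<^sub>v \<psi> \<in> carrier_vec (a * b)"
    using kron_mat_carrier[OF one_carrier_mat E] assms(2) by (rule mult_mat_vec_carrier)
  have "nrm {..<b} (\<lambda>j. coords b (kron_mat (1\<^sub>m a) E *\<^sub>v \<psi>) (i, j))
     = nrm {..<b} (\<lambda>j. \<Sum>l<b. E $$ (j, l) * coords b \<psi> (i, l))" if "i < a" for i
    unfolding nrm_def by (intro sum.cong refl) (simp add: coords_kron_right[OF E assms(2) that])
  then have "norm2_vec (kron_mat (1\<^sub>m a) E *\<^sub>v \<psi>) = (\<Sum>i<a. nrm {..<b} (\<lambda>j. \<Sum>l<b. E $$ (j, l) * coords b \<psi> (i, l)))"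
    unfolding norm2_vec_coords[OF c] nrm_pairs' by simp
  then show ?thesis unfolding tensor_form_ident_left by (simp only: of_real_sum nrm_projector[OF assms(1)])
qed

text \<open>Row \<open>i * 2 + s\<close> of \<open>U\<close> belongs to memory state
  \<open>i\<close> and qubit value \<open>s\<close>; these rows form Alice's operator for
  \<open>s\<close>, and the shift by \<open>s * b\<close> is Bob's.\<close>

lemma coords_Alice_sends:
  assumes U: "U \<in> carrier_mat (a' * 2) a" and \<psi>: "\<psi> \<in> carrier_vec (a * b)" and p: "p \<in> {..<a'} \<times> {..<2 * b}"
  shows "coords (2 * b) (kron_mat U (1\<^sub>m b) *\<^sub>v \<psi>) p
    = tensor_apply a b (\<lambda>i k. U $$ (i * 2 + 0, k)) (\<lambda>m l. if m = 0 * b + l then 1 else 0) (coords b \<psi>) p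
    + tensor_apply a b (\<lambda>i k. U $$ (i * 2 + 1, k)) (\<lambda>m l. if m = 1 * b + l then 1 else 0) (coords b \<psi>) p"
proof -
  obtain i m where im: "p = (i, m)" "i < a'" "m < 2 * b" using p by auto
  have *: "coords (2 * b) (kron_mat U (1\<^sub>m b) *\<^sub>v \<psi>) (i, s * b + j) = (\<Sum>k<a. U $$ (i * 2 + s, k) * coords b \<psi> (k, j))"
    if "s < 2" "j < b" for s j
  proof -
    have "i * 2 + s < a' * 2" using im that by simp
    then have "coords b (kron_mat U (1\<^sub>m b) *\<^sub>v \<psi>) (i * 2 + s, j) = (\<Sum>k<a. U $$ (i * 2 + s, k) * coords b \<psi> (k, j))"
      by (rule coords_kron_left[OF U \<psi> _ that(2)])
    moreover have "coords (2 * b) v (i, s * b + j) = coords b v (i * 2 + s, j)" for v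
      unfolding coords_def by (simp add: algebra_simps)
    ultimately show ?thesis by simp
  qed
  show ?thesis
  proof (cases "m < b")
    case True
    then show ?thesis unfolding im(1) tensor_apply_shift_right using *[of 0 m] by simp
  next
    case False
    then show ?thesis unfolding im(1) tensor_apply_shift_right using *[of 1 "m - b"] im by simp
  qed
qed

lemma coords_Bob_sends:
  assumes V: "V \<in> carrier_mat (2 * b') b" and \<psi>: "\<psi> \<in> carrier_vec (a * b)" and p: "p \<in> {..<a * 2} \<times> {..<b'}"
  shows "coords b' (kron_mat (1\<^sub>m a) V *\<^sub>v \<psi>) p
    = tensor_apply a b (\<lambda>i k. if i = k * 2 + 0 then 1 else 0) (\<lambda>j l. V $$ (0 * b' + j, l)) (coords b \<psi>) p
    + tensor_apply a b (\<lambda>i k. if i = k * 2 + 1 then 1 else 0) (\<lambda>j l. V $$ (1 * b' + j, l)) (coords b \<psi>) p"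
proof -
  obtain i j where ij: "p = (i, j)" "i < a * 2" "j < b'" using p by auto
  have *: "coords b' (kron_mat (1\<^sub>m a) V *\<^sub>v \<psi>) (i, j) = (\<Sum>l<b. V $$ (s * b' + j, l) * coords b \<psi> (i div 2, l))"
    if "i mod 2 = s" for s
  proof -
    have s: "s < 2" using that by auto
    have i: "i = i div 2 * 2 + s" using that by auto
    have "s * b' + j < 2 * b'" using s ij(3) by (rule index_pair_less)
    moreover have "i div 2 < a" using ij by auto
    ultimately have "coords (2 * b') (kron_mat (1\<^sub>m a) V *\<^sub>v \<psi>) (i div 2, s * b' + j) = (\<Sum>l<b. V $$ (s * b' + j, l) * coords b \<psi> (i div 2, l))"
      by (intro coords_kron_right[OF V \<psi>])
    moreover have "coords b' v (i div 2 * 2 + s, j) = coords (2 * b') v (i div 2, s * b' + j)" for v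
      unfolding coords_def by (simp add: algebra_simps)
    ultimately show ?thesis using i by metis
  qed
  have "i div 2 < a" using ij by auto
  moreover have "i mod 2 = 0 \<or> i mod 2 = 1" by auto
  moreover have s: "(0::nat) < 2" "(1::nat) < 2" by simp_all
  ultimately show ?thesis
    unfolding ij(1) tensor_apply_double_left[OF s(1)] tensor_apply_double_left[OF s(2)]
    using *[of 0] *[of 1] by auto
qed

text \<open>The final measurement is a single pair, a projector and the identity, and every qubit
  replaces a pair by four pull-backs. The list is fixed before inputs and state, because the
  induction hypothesis is applied to a state that already depends on the inputs.\<close>

lemma accept_prob_decomposition:
  assumes "q_valid X Y P a b"
  shows "\<exists>L. length L = 4 ^ q_qubits P \<and> contractive_pairs X Y a b L \<and>
    (\<forall>x\<in>X. \<forall>y\<in>Y. \<forall>\<psi>\<in>carrier_vec (a * b).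
      complex_of_real (q_accept_prob P x y a b \<psi>) = pairs_form a b L x y (coords b \<psi>))"
  using assms
proof (induction P arbitrary: a b)
  case (Alice_measures E)
  let ?L = "[(\<lambda>x i k. E x $$ (i, k), \<lambda>y. ident)]"
  have E: "projector_mat a (E x)" if "x \<in> X" for x using Alice_measures that by simp
  have "contractive_pairs X Y a b ?L"
    unfolding contractive_pairs_def
    using norm_nonincreasing_projector[OF E] norm_nonincreasing_ident by (auto intro!: contractive_if_nonincreasing)
  moreover have "\<forall>x\<in>X. \<forall>y\<in>Y. \<forall>\<psi>\<in>carrier_vec (a * b).
      complex_of_real (q_accept_prob (Alice_measures E) x y a b \<psi>) = pairs_form a b ?L x y (coords b \<psi>)"
    using accept_Alice_measures[OF E] by (simp add: pairs_form_def)
  ultimately show ?case by (intro exI[of _ ?L]) simp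
next
  case (Bob_measures E)
  let ?L = "[(\<lambda>x. ident, \<lambda>y i k. E y $$ (i, k))]"
  have E: "projector_mat b (E y)" if "y \<in> Y" for y using Bob_measures that by simp
  have "contractive_pairs X Y a b ?L"
    unfolding contractive_pairs_def
    using norm_nonincreasing_projector[OF E] norm_nonincreasing_ident by (auto intro!: contractive_if_nonincreasing)
  moreover have "\<forall>x\<in>X. \<forall>y\<in>Y. \<forall>\<psi>\<in>carrier_vec (a * b).
      complex_of_real (q_accept_prob (Bob_measures E) x y a b \<psi>) = pairs_form a b ?L x y (coords b \<psi>)"
    using accept_Bob_measures[OF E] by (simp add: pairs_form_def)
  ultimately show ?case by (intro exI[of _ ?L]) simp
next
  case (Alice_sends_qubit a' U P)
  have U: "isometry_mat (a' * 2) a (U x)" "U x \<in> carrier_mat (a' * 2) a" if "x \<in> X" for x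
    using Alice_sends_qubit.prems that by (auto simp: isometry_mat_def)
  have "q_valid X Y P a' (2 * b)" using Alice_sends_qubit.prems by simp
  then obtain L where L: "length L = 4 ^ q_qubits P" "contractive_pairs X Y a' (2 * b) L"
    "\<And>x y \<psi>. x \<in> X \<Longrightarrow> y \<in> Y \<Longrightarrow> \<psi> \<in> carrier_vec (a' * (2 * b)) \<Longrightarrow>
      complex_of_real (q_accept_prob P x y a' (2 * b) \<psi>) = pairs_form a' (2 * b) L x y (coords (2 * b) \<psi>)"
    using Alice_sends_qubit.IH by blast
  define W where "W = (\<lambda>x s i k. U x $$ (i * 2 + s, k))"
  define Z where "Z = (\<lambda>(y::'b) s m l. if m = s * b + l then 1 else (0::complex))"
  have "contractive_pairs X Y a b (pull_all a' (2 * b) W Z L)"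
  proof (rule contractive_pairs_pull_all[OF L(2)])
    fix x and s :: nat assume "x \<in> X" "s < 2"
    then show "norm_nonincreasing a' a (W x s)"
      unfolding W_def by (intro norm_nonincreasing_restrict[OF norm_nonincreasing_isometry[OF U(1)]]) (auto simp: inj_on_def)
  next
    fix y and s :: nat assume "s < 2"
    then show "norm_nonincreasing (2 * b) b (Z y s)"
      unfolding Z_def by (intro norm_nonincreasing_embed) (auto simp: inj_on_def intro: index_pair_less)
  qed
  moreover have "complex_of_real (q_accept_prob (Alice_sends_qubit a' U P) x y a b \<psi>)
      = pairs_form a b (pull_all a' (2 * b) W Z L) x y (coords b \<psi>)"
    if "x \<in> X" "y \<in> Y" "\<psi> \<in> carrier_vec (a * b)" for x y \<psi>
  proof -
    have "kron_mat (U x) (1\<^sub>m b) *\<^sub>v \<psi> \<in> carrier_vec (a' * (2 * b))"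
      using mult_mat_vec_carrier[OF kron_mat_carrier[OF U(2)[OF that(1)] one_carrier_mat] that(3)] by (simp add: mult.assoc)
    then have "complex_of_real (q_accept_prob (Alice_sends_qubit a' U P) x y a b \<psi>)
       = pairs_form a' (2 * b) L x y (coords (2 * b) (kron_mat (U x) (1\<^sub>m b) *\<^sub>v \<psi>))"
      using L(3) that by simp
    also have "\<dots> = pairs_form a b (pull_all a' (2 * b) W Z L) x y (coords b \<psi>)"
      by (rule pairs_form_pull_all) (unfold W_def Z_def, rule coords_Alice_sends[OF U(2)[OF that(1)] that(3)])
    finally show ?thesis .
  qed
  ultimately show ?case
    by (intro exI[of _ "pull_all a' (2 * b) W Z L"]) (simp add: length_pull_all L(1))
next
  case (Bob_sends_qubit b' V P)
  have V: "isometry_mat (2 * b') b (V y)" "V y \<in> carrier_mat (2 * b') b" if "y \<in> Y" for y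
    using Bob_sends_qubit.prems that by (auto simp: isometry_mat_def)
  have "q_valid X Y P (a * 2) b'" using Bob_sends_qubit.prems by simp
  then obtain L where L: "length L = 4 ^ q_qubits P" "contractive_pairs X Y (a * 2) b' L"
    "\<And>x y \<psi>. x \<in> X \<Longrightarrow> y \<in> Y \<Longrightarrow> \<psi> \<in> carrier_vec (a * 2 * b') \<Longrightarrow>
      complex_of_real (q_accept_prob P x y (a * 2) b' \<psi>) = pairs_form (a * 2) b' L x y (coords b' \<psi>)"
    using Bob_sends_qubit.IH by blast
  define W where "W = (\<lambda>(x::'a) (s::nat) i (k::nat). if i = k * 2 + s then 1 else (0::complex))"
  define Z where "Z = (\<lambda>y s j l. V y $$ (s * b' + j, l))"
  have "contractive_pairs X Y a b (pull_all (a * 2) b' W Z L)"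
  proof (rule contractive_pairs_pull_all[OF L(2)])
    fix x and s :: nat assume "s < 2"
    then show "norm_nonincreasing (a * 2) a (W x s)"
      unfolding W_def by (intro norm_nonincreasing_embed) (auto simp: inj_on_def)
  next
    fix y and s :: nat assume "y \<in> Y" "s < 2"
    then show "norm_nonincreasing b' b (Z y s)"
      unfolding Z_def by (intro norm_nonincreasing_restrict[OF norm_nonincreasing_isometry[OF V(1)]])
        (auto simp: inj_on_def intro: index_pair_less)
  qed
  moreover have "complex_of_real (q_accept_prob (Bob_sends_qubit b' V P) x y a b \<psi>)
      = pairs_form a b (pull_all (a * 2) b' W Z L) x y (coords b \<psi>)"
    if "x \<in> X" "y \<in> Y" "\<psi> \<in> carrier_vec (a * b)" for x y \<psi>
  proof -
    have "kron_mat (1\<^sub>m a) (V y) *\<^sub>v \<psi> \<in> carrier_vec (a * 2 * b')"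
      using mult_mat_vec_carrier[OF kron_mat_carrier[OF one_carrier_mat V(2)[OF that(2)]] that(3)] by (simp add: mult.assoc)
    then have "complex_of_real (q_accept_prob (Bob_sends_qubit b' V P) x y a b \<psi>)
       = pairs_form (a * 2) b' L x y (coords b' (kron_mat (1\<^sub>m a) (V y) *\<^sub>v \<psi>))"
      using L(3) that by simp
    also have "\<dots> = pairs_form a b (pull_all (a * 2) b' W Z L) x y (coords b \<psi>)"
      by (rule pairs_form_pull_all) (unfold W_def Z_def, rule coords_Bob_sends[OF V(2)[OF that(2)] that(3)])
    finally show ?thesis .
  qed
  ultimately show ?case
    by (intro exI[of _ "pull_all (a * 2) b' W Z L"]) (simp add: length_pull_all L(1))
qed

section \<open>Quantum lower bound under the promise\<close>

lemma sum_Pow_by_card: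
  fixes t :: nat
  shows "(\<Sum>z\<in>Pow {..<t}. h z) = (\<Sum>w\<le>t. \<Sum>z\<in>{z. z \<subseteq> {..<t} \<and> card z = w}. h z)"
proof -
  have "card z \<le> t" if "z \<subseteq> {..<t}" for z
    using card_mono[OF _ that] by simp
  then have "(\<Sum>w\<le>t. sum h {z \<in> Pow {..<t}. card z = w}) = sum h (Pow {..<t})"
    by (intro sum.group) auto
  then show ?thesis by (simp add: Pow_def)
qed

lemma card_supersets:
  assumes "finite I" "T \<subseteq> I"
  shows "card {z. z \<subseteq> I \<and> card z = w \<and> T \<subseteq> z} = (if card T \<le> w then (card I - card T) choose (w - card T) else 0)"
proof (cases "card T \<le> w")
  case True
  have fT: "finite T" using assms finite_subset by blast
  have "bij_betw (\<lambda>z. z - T) {z. z \<subseteq> I \<and> card z = w \<and> T \<subseteq> z} {B. B \<subseteq> I - T \<and> card B = w - card T}"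
  proof (rule bij_betwI[where g = "\<lambda>B. B \<union> T"])
    show "(\<lambda>z. z - T) \<in> {z. z \<subseteq> I \<and> card z = w \<and> T \<subseteq> z} \<rightarrow> {B. B \<subseteq> I - T \<and> card B = w - card T}"
      using fT by (auto simp: card_Diff_subset)
    show "(\<lambda>B. B \<union> T) \<in> {B. B \<subseteq> I - T \<and> card B = w - card T} \<rightarrow> {z. z \<subseteq> I \<and> card z = w \<and> T \<subseteq> z}"
    proof
      fix B assume "B \<in> {B. B \<subseteq> I - T \<and> card B = w - card T}"
      then have B: "B \<subseteq> I - T" "card B = w - card T" by auto
      then have "card (B \<union> T) = card B + card T"
        using assms fT finite_subset[OF B(1)] by (intro card_Un_disjoint) auto
      then show "B \<union> T \<in> {z. z \<subseteq> I \<and> card z = w \<and> T \<subseteq> z}" using B True assms by auto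
    qed
  qed auto
  then have "card {z. z \<subseteq> I \<and> card z = w \<and> T \<subseteq> z} = card {B. B \<subseteq> I - T \<and> card B = w - card T}"
    by (rule bij_betw_same_card)
  also have "\<dots> = (card I - card T) choose (w - card T)"
    using assms fT by (simp add: n_subsets card_Diff_subset)
  finally show ?thesis using True by simp
next
  case False
  then have e: "{z. z \<subseteq> I \<and> card z = w \<and> T \<subseteq> z} = {}"
    using assms by (auto dest: card_mono[rotated] finite_subset)
  show ?thesis unfolding e using False by simp
qed

text \<open>Every factor of the character is \<open>1 - 2 z_i\<close> in the bit \<open>z_i\<close>;
  expanding the product gives the monomials.\<close>

lemma chi_monomials:
  assumes "finite S"
  shows "chi S z = (\<Sum>T\<in>Pow S. if T \<subseteq> z then (-2) ^ card T else 0)"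
proof -
  have "chi S z = (\<Prod>i\<in>S. (if i \<in> z then -2 else 0) + 1)"
    unfolding chi_def by (rule prod.cong) auto
  also have "\<dots> = (\<Sum>T\<in>Pow S. \<Prod>i\<in>T. if i \<in> z then -2 else 0)"
    unfolding prod_add[OF assms] by simp
  also have "\<dots> = (\<Sum>T\<in>Pow S. if T \<subseteq> z then (-2) ^ card T else 0)"
  proof (rule sum.cong[OF refl])
    fix T assume "T \<in> Pow S"
    then have T: "finite T" using assms finite_subset by auto
    show "(\<Prod>i\<in>T. if i \<in> z then -2 else 0) = (if T \<subseteq> z then (-2) ^ card T else (0::real))"
    proof (cases "T \<subseteq> z")
      case True
      then have "(\<Prod>i\<in>T. if i \<in> z then -2 else 0) = (\<Prod>i\<in>T. -2::real)" by (intro prod.cong) auto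
      then show ?thesis using True by simp
    next
      case False
      then obtain i where "i \<in> T" "i \<notin> z" by auto
      then show ?thesis using False T by (auto intro!: prod_zero bexI[of _ i])
    qed
  qed
  finally show ?thesis .
qed

lemma sum_atMost_split:
  fixes f :: "nat \<Rightarrow> real"
  assumes "1 \<le> t"
  shows "(\<Sum>w\<le>t. f w) = f 0 + f 1 + (\<Sum>w=2..t. f w)"
proof -
  have "{..t} = {0, 1} \<union> {2..t}" using assms by auto
  then have "(\<Sum>w\<le>t. f w) = (\<Sum>w\<in>{0, 1}. f w) + (\<Sum>w=2..t. f w)"
    by (simp only:) (rule sum.union_disjoint, auto)
  then show ?thesis by simp
qed

text \<open>Spreading \<open>\<psi> w\<close> evenly over the sets of size \<open>w\<close> reduces
  orthogonality to monomials to the univariate identities for \<open>\<psi>\<close>. The last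
  property covers every approximation of OR that is prescribed only on sets with at most one
  element.\<close>

lemma dual_function_exists:
  assumes "49 * d^2 \<le> t" "1 \<le> t"
  obtains \<phi> :: "nat set \<Rightarrow> real" where
    "\<And>S. S \<subseteq> {..<t} \<Longrightarrow> card S \<le> d \<Longrightarrow> (\<Sum>z\<in>Pow {..<t}. \<phi> z * chi S z) = 0"
    "(\<Sum>z\<in>Pow {..<t}. \<bar>\<phi> z\<bar>) \<le> 3"
    "\<And>p. (\<And>z. z \<subseteq> {..<t} \<Longrightarrow> 0 \<le> p z \<and> p z \<le> 1) \<Longrightarrow> p {} \<le> 1/3 \<Longrightarrow> (\<And>i. i < t \<Longrightarrow> p {i} \<ge> 2/3) \<Longrightarrow>
       (\<Sum>z\<in>Pow {..<t}. \<phi> z * p z) \<ge> 1/6"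
proof -
  obtain \<psi> :: "nat \<Rightarrow> real" where \<psi>: "\<psi> 0 = -1" "(\<Sum>w=2..t. \<bar>\<psi> w\<bar>) \<le> 1/12"
    "\<And>j. j \<le> d \<Longrightarrow> (\<Sum>w\<le>t. \<psi> w * real (w choose j)) = 0"
    using dual_weights_exist[OF assms] by blast
  define \<phi> where "\<phi> = (\<lambda>z::nat set. \<psi> (card z) / real (t choose card z))"
  define Q where "Q = (\<lambda>w. {z. z \<subseteq> {..<t} \<and> card z = w})"
  have cardQ: "card (Q w) = t choose w" for w unfolding Q_def by (simp add: n_subsets)
  have Qeq: "{z. z \<subseteq> {..<t} \<and> card z = w} = Q w" for w by (simp add: Q_def)
  have finQ: "finite (Q w)" for w unfolding Q_def by simp
  have \<phi>Q: "\<phi> z = \<psi> w / real (t choose w)" if "z \<in> Q w" for z w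
    using that unfolding Q_def \<phi>_def by simp
  have sum_abs: "(\<Sum>z\<in>Q w. \<bar>\<phi> z\<bar>) = \<bar>\<psi> w\<bar>" if "w \<le> t" for w
  proof -
    have "(\<Sum>z\<in>Q w. \<bar>\<phi> z\<bar>) = (\<Sum>z\<in>Q w. \<bar>\<psi> w\<bar> / real (t choose w))"
      by (rule sum.cong) (simp_all add: \<phi>Q)
    then show ?thesis using that by (simp add: cardQ)
  qed
  have mono: "(\<Sum>z\<in>Pow {..<t}. \<phi> z * (if T \<subseteq> z then 1 else 0)) = 0" if T: "T \<subseteq> {..<t}" "card T \<le> d" for T
  proof -
    have jt: "card T \<le> t" using card_mono[OF _ T(1)] by simp
    \<comment> \<open>The fraction of the \<open>w\<close>-sets that contain \<open>T\<close> is
      \<open>(w choose card T) / (t choose card T)\<close>, a polynomial in \<open>w\<close> of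
      degree \<open>card T\<close>.\<close>
    have "(\<Sum>z\<in>Q w. \<phi> z * (if T \<subseteq> z then 1 else 0)) = \<psi> w * real (w choose card T) / real (t choose card T)"
      if w: "w \<le> t" for w
    proof -
      have "(\<Sum>z\<in>Q w. \<phi> z * (if T \<subseteq> z then 1 else 0)) = (\<Sum>z\<in>Q w. if T \<subseteq> z then \<psi> w / real (t choose w) else 0)"
        by (rule sum.cong) (simp_all add: \<phi>Q)
      also have "\<dots> = (\<Sum>z\<in>{z \<in> Q w. T \<subseteq> z}. \<psi> w / real (t choose w))"
        using finQ by (rule sum.inter_filter[symmetric])
      also have "{z \<in> Q w. T \<subseteq> z} = {z. z \<subseteq> {..<t} \<and> card z = w \<and> T \<subseteq> z}" by (auto simp: Q_def)
      also have "(\<Sum>z\<in>\<dots>. \<psi> w / real (t choose w)) = real (if card T \<le> w then (t - card T) choose (w - card T) else 0) * (\<psi> w / real (t choose w))"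
        using card_supersets[OF _ T(1), of w] by simp
      also have "\<dots> = \<psi> w * real (w choose card T) / real (t choose card T)"
      proof (cases "card T \<le> w")
        case True
        have "(t choose w) * (w choose card T) = (t choose card T) * ((t - card T) choose (w - card T))"
          by (rule choose_mult[OF True w])
        then have "real (t choose w) * real (w choose card T) = real (t choose card T) * real ((t - card T) choose (w - card T))"
          by (metis of_nat_mult)
        moreover have "real (t choose w) > 0" "real (t choose card T) > 0" using w jt by simp_all
        ultimately show ?thesis using True by (simp add: field_simps)
      qed simp
      finally show ?thesis .
    qed
    then have "(\<Sum>z\<in>Pow {..<t}. \<phi> z * (if T \<subseteq> z then 1 else 0)) = (\<Sum>w\<le>t. \<psi> w * real (w choose card T) / real (t choose card T))"
      unfolding sum_Pow_by_card Qeq by (intro sum.cong) auto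
    also have "\<dots> = 0" unfolding sum_divide_distrib[symmetric] \<psi>(3)[OF T(2)] by simp
    finally show ?thesis .
  qed
  have low: "(\<Sum>z\<in>Pow {..<t}. \<phi> z * chi S z) = 0" if S: "S \<subseteq> {..<t}" "card S \<le> d" for S
  proof -
    have fS: "finite S" using S finite_subset by blast
    have "(\<Sum>z\<in>Pow {..<t}. \<phi> z * chi S z)
       = (\<Sum>z\<in>Pow {..<t}. \<Sum>T\<in>Pow S. (-2) ^ card T * (\<phi> z * (if T \<subseteq> z then 1 else 0)))"
      unfolding chi_monomials[OF fS] sum_distrib_left by (intro sum.cong refl) simp
    also have "\<dots> = (\<Sum>T\<in>Pow S. (-2) ^ card T * (\<Sum>z\<in>Pow {..<t}. \<phi> z * (if T \<subseteq> z then 1 else 0)))"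
      by (subst sum.swap) (simp only: sum_distrib_left)
    also have "\<dots> = 0"
    proof (rule sum.neutral, rule ballI)
      fix T assume T: "T \<in> Pow S"
      then have "card T \<le> d" using card_mono[OF fS, of T] S by auto
      then show "(-2) ^ card T * (\<Sum>z\<in>Pow {..<t}. \<phi> z * (if T \<subseteq> z then 1 else 0)) = 0"
        using mono[of T] T S by auto
    qed
    finally show ?thesis .
  qed
  \<comment> \<open>Orthogonality to constants balances \<open>\<psi> 0 = -1\<close> against
    \<open>\<psi> 1\<close>, up to the tail of mass at most \<open>1/12\<close>.\<close>
  have "(\<Sum>w\<le>t. \<psi> w) = 0" using \<psi>(3)[of 0] by simp
  then have "\<psi> 1 = 1 - (\<Sum>w=2..t. \<psi> w)" unfolding sum_atMost_split[OF assms(2)] \<psi>(1) by simp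
  moreover have "\<bar>\<Sum>w=2..t. \<psi> w\<bar> \<le> 1/12" using \<psi>(2) Groups_Big.sum_abs[of \<psi> "{2..t}"] by linarith
  ultimately have \<psi>1: "11/12 \<le> \<psi> 1" "\<psi> 1 \<le> 13/12" by linarith+
  have l1: "(\<Sum>z\<in>Pow {..<t}. \<bar>\<phi> z\<bar>) \<le> 3"
  proof -
    have "(\<Sum>z\<in>Pow {..<t}. \<bar>\<phi> z\<bar>) = (\<Sum>w\<le>t. \<bar>\<psi> w\<bar>)"
      unfolding sum_Pow_by_card Qeq by (intro sum.cong refl) (simp add: sum_abs)
    then show ?thesis unfolding sum_atMost_split[OF assms(2)] using \<psi>(1,2) \<psi>1 by simp
  qed
  have corr: "(\<Sum>z\<in>Pow {..<t}. \<phi> z * p z) \<ge> 1/6"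
    if p: "\<And>z. z \<subseteq> {..<t} \<Longrightarrow> 0 \<le> p z \<and> p z \<le> 1" "p {} \<le> 1/3" "\<And>i. i < t \<Longrightarrow> p {i} \<ge> 2/3" for p
  proof -
    have Q0: "Q 0 = {{}}" unfolding Q_def by (auto dest: finite_subset)
    have w0: "(\<Sum>z\<in>Q 0. \<phi> z * p z) \<ge> -1/3"
      unfolding Q0 using p(2) by (simp add: \<phi>_def \<psi>)
    have w1: "(\<Sum>z\<in>Q 1. \<phi> z * p z) \<ge> \<psi> 1 * (2/3)"
    proof -
      have "(\<Sum>z\<in>Q 1. \<psi> 1 / real t * (2/3)) \<le> (\<Sum>z\<in>Q 1. \<phi> z * p z)"
      proof (rule sum_mono)
        fix z assume z: "z \<in> Q 1"
        then obtain i where i: "z = {i}" "i < t" unfolding Q_def by (auto simp: card_1_singleton_iff)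
        have "\<phi> z = \<psi> 1 / real t" using \<phi>Q[OF z] by simp
        then show "\<psi> 1 / real t * (2/3) \<le> \<phi> z * p z"
          using p(3)[OF i(2)] \<psi>1 unfolding i(1) by (simp only:) (intro mult_left_mono, auto)
      qed
      then show ?thesis using assms(2) by (simp add: cardQ)
    qed
    have w2: "(\<Sum>w=2..t. \<Sum>z\<in>Q w. \<phi> z * p z) \<ge> -1/12"
    proof -
      have "\<bar>\<Sum>z\<in>Q w. \<phi> z * p z\<bar> \<le> \<bar>\<psi> w\<bar>" if "w \<in> {2..t}" for w
      proof -
        have "\<bar>\<Sum>z\<in>Q w. \<phi> z * p z\<bar> \<le> (\<Sum>z\<in>Q w. \<bar>\<phi> z * p z\<bar>)" by (rule Groups_Big.sum_abs)
        also have "\<dots> \<le> (\<Sum>z\<in>Q w. \<bar>\<phi> z\<bar>)"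
        proof (rule sum_mono)
          fix z assume "z \<in> Q w"
          then have "\<bar>p z\<bar> \<le> 1" using p(1)[of z] by (auto simp: Q_def)
          then show "\<bar>\<phi> z * p z\<bar> \<le> \<bar>\<phi> z\<bar>" by (simp add: abs_mult mult_left_le)
        qed
        finally show ?thesis using sum_abs that by simp
      qed
      then have "(\<Sum>w=2..t. \<bar>\<Sum>z\<in>Q w. \<phi> z * p z\<bar>) \<le> (\<Sum>w=2..t. \<bar>\<psi> w\<bar>)" by (rule sum_mono)
      then have "(\<Sum>w=2..t. \<bar>\<Sum>z\<in>Q w. \<phi> z * p z\<bar>) \<le> 1/12" using \<psi>(2) by linarith
      then show ?thesis using Groups_Big.sum_abs[of "\<lambda>w. \<Sum>z\<in>Q w. \<phi> z * p z" "{2..t}"] by linarith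
    qed
    \<comment> \<open>The three parts add up to at least
      \<open>-1/3 + (11/12) (2/3) - 1/12 = 7/36\<close>.\<close>
    show ?thesis unfolding sum_Pow_by_card Qeq sum_atMost_split[OF assms(2)]
      using w0 w1 w2 \<psi>1 by linarith
  qed
  show ?thesis by (rule that[OF low l1 corr])
qed

text \<open>The pairs of basis indices serve as the index set \<open>J\<close> of the inner product.
  Its size does not enter the bound, so the amount of entanglement is irrelevant.\<close>

lemma tensor_form_pattern_bound:
  fixes A :: "'x \<Rightarrow> kernel" and B :: "'y \<Rightarrow> kernel"
  assumes d: "d \<le> t"
    and A: "\<And>x0 x1. x0 \<subseteq> {..<t} \<Longrightarrow> x1 \<subseteq> {..<t} \<Longrightarrow> contractive a (A (xs x0 x1))"
    and B: "\<And>V w. V \<subseteq> {..<t} \<Longrightarrow> w \<subseteq> {..<t} \<Longrightarrow> contractive b (B (ys V w))"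
    and \<Psi>: "nrm ({..<a} \<times> {..<b}) \<Psi> \<le> 1"
    and low: "\<And>S. S \<subseteq> {..<t} \<Longrightarrow> card S < d \<Longrightarrow> (\<Sum>z\<in>Pow {..<t}. \<phi> z * chi S z) = 0"
    and l1: "(\<Sum>z\<in>Pow {..<t}. \<bar>\<phi> z\<bar>) \<le> M"
  shows "2 ^ d * (cmod (\<Sum>x0\<in>Pow {..<t}. \<Sum>x1\<in>Pow {..<t}. \<Sum>V\<in>Pow {..<t}. \<Sum>w\<in>Pow {..<t}.
      \<phi> (sym_diff ((x0 - V) \<union> (x1 \<inter> V)) w) * tensor_form a b (A (xs x0 x1)) (B (ys V w)) \<Psi> \<Psi>))\<^sup>2
    \<le> (M * 8 ^ t)\<^sup>2"
proof -
  define u where "u = (\<lambda>x0 x1 p. \<Sum>i<a. cnj (\<Psi> (i, snd p)) * A (xs x0 x1) i (fst p))"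
  define v where "v = (\<lambda>V w p. \<Sum>j<b. B (ys V w) (snd p) j * \<Psi> (fst p, j))"
  have u: "(\<Sum>p\<in>{..<a} \<times> {..<b}. (cmod (u x0 x1 p))\<^sup>2) \<le> 1" if "x0 \<subseteq> {..<t}" "x1 \<subseteq> {..<t}" for x0 x1
  proof -
    have "nrm ({..<a} \<times> {..<b}) (u x0 x1) \<le> nrm ({..<a} \<times> {..<b}) \<Psi>"
      unfolding nrm_pairs u_def fst_conv snd_conv by (intro sum_mono contractive_column A that)
    then show ?thesis using \<Psi> by (simp add: nrm_def)
  qed
  have v: "(\<Sum>p\<in>{..<a} \<times> {..<b}. (cmod (v V w p))\<^sup>2) \<le> 1" if "V \<subseteq> {..<t}" "w \<subseteq> {..<t}" for V w
  proof -
    have "nrm ({..<a} \<times> {..<b}) (v V w) \<le> nrm ({..<a} \<times> {..<b}) \<Psi>"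
      unfolding nrm_pairs' v_def fst_conv snd_conv by (intro sum_mono contractive_row B that)
    then show ?thesis using \<Psi> by (simp add: nrm_def)
  qed
  have "tensor_form a b (A (xs x0 x1)) (B (ys V w)) \<Psi> \<Psi> = (\<Sum>p\<in>{..<a} \<times> {..<b}. u x0 x1 p * v V w p)" for x0 x1 V w
    unfolding tensor_form_inner u_def v_def ..
  then show ?thesis
    using pattern_matrix_bound[where I = "{..<t}" and J = "{..<a} \<times> {..<b}", OF _ _ u v low l1] d by simp
qed

lemma cmod_sum_list_le:
  assumes "\<And>p. p \<in> set L \<Longrightarrow> cmod (g p) \<le> c"
  shows "cmod (\<Sum>p\<leftarrow>L. g p) \<le> real (length L) * c"
  using assms
proof (induction L)
  case (Cons p L)
  have "cmod (g p + (\<Sum>p\<leftarrow>L. g p)) \<le> cmod (g p) + cmod (\<Sum>p\<leftarrow>L. g p)" by (rule norm_triangle_ineq)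
  also have "\<dots> \<le> c + real (length L) * c" using Cons by (intro add_mono) auto
  finally show ?case by (simp add: algebra_simps)
qed simp

lemma sum_sum_list: "(\<Sum>a\<in>A. \<Sum>p\<leftarrow>L. g a p) = (\<Sum>p\<leftarrow>L. \<Sum>a\<in>A. g a p)" for g :: "'a \<Rightarrow> 'b \<Rightarrow> 'c::comm_monoid_add"
  by (induction L) (simp_all add: sum.distrib)

lemma sum_Pow_sym_diff:
  assumes "s \<subseteq> I"
  shows "(\<Sum>w\<in>Pow I. g (sym_diff s w) w) = (\<Sum>z\<in>Pow I. g z (sym_diff s z))"
  by (rule sum.reindex_bij_witness[of _ "sym_diff s" "sym_diff s"])
    (use assms in \<open>auto intro: arg_cong2[where f = g]\<close>)

text \<open>The correlation \<open>T\<close> of the acceptance probabilities with the dual function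
  is estimated twice: from below because the protocol approximates OR or its negation on sizes 0 and
  1, from above by the spectral bound for each of the \<open>4 ^ q\<close> terms.\<close>

lemma promise_lower_bound:
  fixes xs :: "nat set \<Rightarrow> nat set \<Rightarrow> 'x" and ys :: "nat set \<Rightarrow> nat set \<Rightarrow> 'y"
  assumes P: "q_valid X Y P a b" and \<psi>: "\<psi> \<in> carrier_vec (a * b)" "norm2_vec \<psi> = 1"
    and xs: "\<And>x0 x1. x0 \<subseteq> {..<t} \<Longrightarrow> x1 \<subseteq> {..<t} \<Longrightarrow> xs x0 x1 \<in> X"
    and ys: "\<And>V w. V \<subseteq> {..<t} \<Longrightarrow> w \<subseteq> {..<t} \<Longrightarrow> ys V w \<in> Y"
    and err: "\<And>x0 x1 V w. x0 \<subseteq> {..<t} \<Longrightarrow> x1 \<subseteq> {..<t} \<Longrightarrow> V \<subseteq> {..<t} \<Longrightarrow> w \<subseteq> {..<t} \<Longrightarrow>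
        (if g (card (sym_diff ((x0 - V) \<union> (x1 \<inter> V)) w)) then 1 - q_accept_prob P (xs x0 x1) (ys V w) a b \<psi>
         else q_accept_prob P (xs x0 x1) (ys V w) a b \<psi>) \<le> 1/3"
    and g: "g 0 \<noteq> g 1"
  shows "t < 49 * (4 * q_qubits P + 8)\<^sup>2"
proof (rule ccontr)
  define q where "q = q_qubits P"
  \<comment> \<open>The two estimates of \<open>T\<close> will imply
    \<open>2^(d + 1) \<le> 324 * 16^q\<close>, where \<open>324 = (6 * 3)^2\<close> comes from the
    correlation \<open>1/6\<close> and the norm bound \<open>3\<close>. The summand \<open>8\<close>
    makes the left-hand side \<open>512 * 16^q\<close>.\<close>
  define d where "d = 4 * q + 8"
  let ?I = "{..<t}"
  assume "\<not> t < 49 * (4 * q_qubits P + 8)\<^sup>2"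
  then have dt: "49 * d\<^sup>2 \<le> t" by (simp add: d_def q_def)
  have "d \<ge> 8" by (simp add: d_def)
  then have "d * 8 \<le> d * d" by simp
  then have t: "1 \<le> t" "d + 1 \<le> t" using dt \<open>d \<ge> 8\<close> unfolding power2_eq_square by linarith+
  obtain \<phi> :: "nat set \<Rightarrow> real" where
    low: "\<And>S. S \<subseteq> ?I \<Longrightarrow> card S \<le> d \<Longrightarrow> (\<Sum>z\<in>Pow ?I. \<phi> z * chi S z) = 0" and
    l1: "(\<Sum>z\<in>Pow ?I. \<bar>\<phi> z\<bar>) \<le> 3" and
    corr: "\<And>p. (\<And>z. z \<subseteq> ?I \<Longrightarrow> 0 \<le> p z \<and> p z \<le> 1) \<Longrightarrow> p {} \<le> 1/3 \<Longrightarrow> (\<And>i. i < t \<Longrightarrow> p {i} \<ge> 2/3) \<Longrightarrow>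
       (\<Sum>z\<in>Pow ?I. \<phi> z * p z) \<ge> 1/6"
    using dual_function_exists[OF dt t(1)] by blast
  have sum0: "(\<Sum>z\<in>Pow ?I. \<phi> z) = 0" using low[of "{}"] by (simp add: chi_def)
  define acc where "acc = (\<lambda>x0 x1 V w. q_accept_prob P (xs x0 x1) (ys V w) a b \<psi>)"
  have acc01: "0 \<le> acc x0 x1 V w \<and> acc x0 x1 V w \<le> 1"
    if "x0 \<subseteq> ?I" "x1 \<subseteq> ?I" "V \<subseteq> ?I" "w \<subseteq> ?I" for x0 x1 V w
    using q_accept_prob_le[OF P xs[OF that(1,2)] ys[OF that(3,4)] \<psi>(1)] \<psi>(2) q_accept_prob_nonneg
    unfolding acc_def by simp
  \<comment> \<open>If \<open>g 0\<close> holds, it is the rejection probability that approximates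
    OR. As \<open>\<phi>\<close> sums to \<open>0\<close>, this merely flips the sign of the
    correlation.\<close>
  define sg where "sg = (if g 1 then 1 else -1 :: real)"
  define T where "T = (\<Sum>x0\<in>Pow ?I. \<Sum>x1\<in>Pow ?I. \<Sum>V\<in>Pow ?I. \<Sum>w\<in>Pow ?I.
      \<phi> (sym_diff ((x0 - V) \<union> (x1 \<inter> V)) w) * acc x0 x1 V w)"
  \<comment> \<open>For fixed \<open>x0\<close>, \<open>x1\<close> and \<open>V\<close>, the masks
    \<open>w\<close> make the masked selected set run through every subset exactly once.\<close>
  have inner: "sg * (\<Sum>w\<in>Pow ?I. \<phi> (sym_diff ((x0 - V) \<union> (x1 \<inter> V)) w) * acc x0 x1 V w) \<ge> 1/6"
    if sub: "x0 \<subseteq> ?I" "x1 \<subseteq> ?I" "V \<subseteq> ?I" for x0 x1 V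
  proof -
    define s where "s = (x0 - V) \<union> (x1 \<inter> V)"
    have s: "s \<subseteq> ?I" unfolding s_def using sub by auto
    define p where "p = (\<lambda>z. acc x0 x1 V (sym_diff s z))"
    have sd: "sym_diff s z \<subseteq> ?I" if "z \<subseteq> ?I" for z using s that by auto
    have p01: "0 \<le> p z \<and> p z \<le> 1" if "z \<subseteq> ?I" for z
      unfolding p_def by (rule acc01[OF sub sd[OF that]])
    have ss: "sym_diff s (sym_diff s z) = z" for z by auto
    have perr: "(if g (card z) then 1 - p z else p z) \<le> 1/3" if "z \<subseteq> ?I" for z
      using err[OF sub sd[OF that]] unfolding s_def[symmetric] ss p_def acc_def .
    have e: "(\<Sum>w\<in>Pow ?I. \<phi> (sym_diff s w) * acc x0 x1 V w) = (\<Sum>z\<in>Pow ?I. \<phi> z * p z)"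
      unfolding p_def by (rule sum_Pow_sym_diff[OF s])
    show ?thesis
    proof (cases "g 1")
      case True
      then have "\<not> g 0" using g by simp
      then have "(\<Sum>z\<in>Pow ?I. \<phi> z * p z) \<ge> 1/6"
        using True perr[of "{}"] perr[of "{_}"] p01 by (intro corr) auto
      then show ?thesis unfolding s_def[symmetric] e using True by (simp add: sg_def)
    next
      case False
      then have "g 0" using g by simp
      then have "(\<Sum>z\<in>Pow ?I. \<phi> z * (1 - p z)) \<ge> 1/6"
        using False perr[of "{}"] perr[of "{_}"] p01 by (intro corr) auto
      moreover have "(\<Sum>z\<in>Pow ?I. \<phi> z * (1 - p z)) = - (\<Sum>z\<in>Pow ?I. \<phi> z * p z)"
        using sum0 by (simp add: right_diff_distrib sum_subtractf)
      ultimately show ?thesis unfolding s_def[symmetric] e using False by (simp add: sg_def)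
    qed
  qed
  have "8 ^ t / 6 \<le> sg * T"
  proof -
    have "(\<Sum>x0\<in>Pow ?I. \<Sum>x1\<in>Pow ?I. \<Sum>V\<in>Pow ?I. 1/6) \<le> sg * T"
      unfolding T_def sum_distrib_left[of sg]
      by (intro sum_mono) (use inner in \<open>simp add: sum_distrib_left\<close>)
    moreover have "(8::real) ^ t = 2 ^ t * (2 ^ t * 2 ^ t)" by (simp flip: power_mult_distrib)
    ultimately show ?thesis by (simp add: card_Pow)
  qed
  also have "sg * T \<le> \<bar>T\<bar>" unfolding sg_def by (simp add: abs_ge_self abs_ge_minus_self)
  finally have T_ge: "8 ^ t / 6 \<le> \<bar>T\<bar>" .
  obtain L where L: "length L = 4 ^ q" "contractive_pairs X Y a b L"
    "\<And>x y. x \<in> X \<Longrightarrow> y \<in> Y \<Longrightarrow> complex_of_real (q_accept_prob P x y a b \<psi>) = pairs_form a b L x y (coords b \<psi>)"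
    using accept_prob_decomposition[OF P] \<psi>(1) unfolding q_def by blast
  define G where "G = (\<lambda>p :: ('x \<Rightarrow> kernel) \<times> ('y \<Rightarrow> kernel). \<Sum>x0\<in>Pow ?I. \<Sum>x1\<in>Pow ?I. \<Sum>V\<in>Pow ?I. \<Sum>w\<in>Pow ?I.
      \<phi> (sym_diff ((x0 - V) \<union> (x1 \<inter> V)) w) * tensor_form a b (fst p (xs x0 x1)) (snd p (ys V w)) (coords b \<psi>) (coords b \<psi>))"
  have TG: "complex_of_real T = (\<Sum>p\<leftarrow>L. G p)"
  proof -
    have "complex_of_real T = (\<Sum>x0\<in>Pow ?I. \<Sum>x1\<in>Pow ?I. \<Sum>V\<in>Pow ?I. \<Sum>w\<in>Pow ?I.
      complex_of_real (\<phi> (sym_diff ((x0 - V) \<union> (x1 \<inter> V)) w)) * complex_of_real (acc x0 x1 V w))"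
      unfolding T_def by (simp only: of_real_sum of_real_mult)
    also have "\<dots> = (\<Sum>x0\<in>Pow ?I. \<Sum>x1\<in>Pow ?I. \<Sum>V\<in>Pow ?I. \<Sum>w\<in>Pow ?I. \<Sum>p\<leftarrow>L.
      complex_of_real (\<phi> (sym_diff ((x0 - V) \<union> (x1 \<inter> V)) w)) * tensor_form a b (fst p (xs x0 x1)) (snd p (ys V w)) (coords b \<psi>) (coords b \<psi>))"
    proof (intro sum.cong refl)
      fix x0 x1 V w assume "x0 \<in> Pow ?I" "x1 \<in> Pow ?I" "V \<in> Pow ?I" "w \<in> Pow ?I"
      then have "complex_of_real (acc x0 x1 V w) = pairs_form a b L (xs x0 x1) (ys V w) (coords b \<psi>)"
        unfolding acc_def by (intro L(3) xs ys) auto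
      then show "complex_of_real (\<phi> (sym_diff ((x0 - V) \<union> (x1 \<inter> V)) w)) * complex_of_real (acc x0 x1 V w)
        = (\<Sum>p\<leftarrow>L. complex_of_real (\<phi> (sym_diff ((x0 - V) \<union> (x1 \<inter> V)) w)) * tensor_form a b (fst p (xs x0 x1)) (snd p (ys V w)) (coords b \<psi>) (coords b \<psi>))"
        unfolding pairs_form_def split_def by (simp only: sum_list_const_mult)
    qed
    also have "\<dots> = (\<Sum>p\<leftarrow>L. G p)" unfolding G_def by (simp only: sum_sum_list)
    finally show ?thesis .
  qed
  have \<Psi>: "nrm ({..<a} \<times> {..<b}) (coords b \<psi>) \<le> 1"
    using norm2_vec_coords[OF \<psi>(1)] \<psi>(2) by simp
  \<comment> \<open>Characters of degree \<open>d\<close> are annihilated too, so the pattern bound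
    applies with \<open>d + 1\<close>.\<close>
  define c where "c = sqrt ((3 * 8 ^ t)\<^sup>2 / 2 ^ (d + 1))"
  have G_le: "cmod (G p) \<le> c" if "p \<in> set L" for p
  proof -
    obtain A B where p: "p = (A, B)" by force
    have AB: "\<And>x. x \<in> X \<Longrightarrow> contractive a (A x)" "\<And>y. y \<in> Y \<Longrightarrow> contractive b (B y)"
      using L(2) that unfolding contractive_pairs_def p by auto
    have "2 ^ (d + 1) * (cmod (G p))\<^sup>2 \<le> (3 * 8 ^ t)\<^sup>2"
      unfolding G_def p fst_conv snd_conv
      by (rule tensor_form_pattern_bound[where A = A and B = B and xs = xs and ys = ys, OF t(2) AB(1)[OF xs] AB(2)[OF ys] \<Psi> _ l1]) (use low in auto)
    then have "(cmod (G p))\<^sup>2 \<le> (3 * 8 ^ t)\<^sup>2 / 2 ^ (d + 1)" by (simp add: field_simps)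
    then show ?thesis unfolding c_def by (rule real_le_rsqrt)
  qed
  have "\<bar>T\<bar> = cmod (\<Sum>p\<leftarrow>L. G p)" unfolding TG[symmetric] by simp
  also have "\<dots> \<le> 4 ^ q * c" using cmod_sum_list_le[of L G c] G_le L(1) by simp
  finally have "8 ^ t / 6 \<le> 4 ^ q * c" using T_ge by linarith
  then have "(8 ^ t / 6)\<^sup>2 \<le> (4 ^ q * c)\<^sup>2" by (intro power_mono) auto
  also have "\<dots> = (4 ^ q)\<^sup>2 * ((3 * 8 ^ t)\<^sup>2 / 2 ^ (d + 1))" unfolding power_mult_distrib c_def by simp
  finally have "(8 ^ t)\<^sup>2 * 2 ^ (d + 1) \<le> (8 ^ t)\<^sup>2 * (324 * (4 ^ q)\<^sup>2 :: real)"
    by (simp add: power_divide power_mult_distrib field_simps)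
  then have "2 ^ (d + 1) \<le> (324 * (4 ^ q)\<^sup>2 :: real)"
    by (rule mult_left_le_imp_le) simp
  moreover have "(2::real) ^ (d + 1) = 512 * (4 ^ q)\<^sup>2"
  proof -
    have "(2::real) ^ (4 * q) = (2 ^ 4) ^ q" by (rule power_mult)
    moreover have "((4::real) ^ q)\<^sup>2 = (4 ^ 2) ^ q" unfolding power_mult[symmetric] by (simp add: mult.commute)
    ultimately show ?thesis by (simp add: d_def power_add)
  qed
  ultimately show False by simp
qed

section \<open>Randomized protocol\<close>

primrec Alice_sends_list :: "nat \<Rightarrow> ('x \<Rightarrow> bool list) \<Rightarrow> (bool list \<Rightarrow> ('x, 'y) det_protocol) \<Rightarrow> ('x, 'y) det_protocol" where
  "Alice_sends_list 0 g K = K []"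
| "Alice_sends_list (Suc c) g K =
     Alice_sends (\<lambda>x. hd (g x)) (\<lambda>b. Alice_sends_list c (\<lambda>x. tl (g x)) (\<lambda>l. K (b # l)))"

lemma det_output_Alice_sends_list:
  "length (g x) = c \<Longrightarrow> det_output (Alice_sends_list c g K) x y = det_output (K (g x)) x y"
  by (induction c arbitrary: g K) (auto simp: length_Suc_conv)

lemma det_bits_Alice_sends_list:
  "(\<And>l. det_bits (K l) x y = 0) \<Longrightarrow> det_bits (Alice_sends_list c g K) x y = c"
  by (induction c arbitrary: g K) auto

text \<open>Any injection of \<open>D\<close> into the bit strings of length \<open>c\<close> serves
  as a code, which Bob inverts.\<close>

lemma one_way_protocol_exists:
  fixes g :: "'x \<Rightarrow> 'm" and out :: "'m \<Rightarrow> 'y \<Rightarrow> bool"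
  assumes "finite D" "card D \<le> 2 ^ c" "\<And>x. g x \<in> D"
  shows "\<exists>P. \<forall>x y. det_output P x y = out (g x) y \<and> det_bits P x y = c"
proof -
  let ?B = "{l :: bool list. set l \<subseteq> UNIV \<and> length l = c}"
  have "card ?B = 2 ^ c" by (subst card_lists_length_eq) auto
  moreover have "finite ?B" by (rule finite_lists_length_eq) simp
  ultimately obtain e where e: "e ` D \<subseteq> ?B" "inj_on e D"
    using card_le_inj[of D ?B] assms by auto
  let ?P = "Alice_sends_list c (\<lambda>x. e (g x)) (\<lambda>l. Bob_outputs (out (inv_into D e l)))"
  have "det_output ?P x y = out (g x) y" for x y
  proof -
    have "length (e (g x)) = c" using e(1) assms(3)[of x] by auto
    then have "det_output ?P x y = out (inv_into D e (e (g x))) y"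
      by (subst det_output_Alice_sends_list) auto
    then show ?thesis using e(2) assms(3) by simp
  qed
  moreover have "det_bits ?P x y = c" for x y by (rule det_bits_Alice_sends_list) simp
  ultimately show ?thesis by blast
qed

lemma rand_cc_le:
  assumes "rand_computes X Y F M" "rand_cost_le X Y M c"
  shows "rand_cc X Y F \<le> c"
  unfolding rand_cc_def by (rule Least_le) (use assms in blast)

lemma rand_cc_eq_0:
  assumes "\<And>x y. x \<in> X \<Longrightarrow> y \<in> Y \<Longrightarrow> det_output P x y = F x y" "\<And>x y. det_bits P x y = 0"
  shows "rand_cc X Y F = 0"
proof -
  have "rand_computes X Y F (return_pmf P)" unfolding rand_computes_def using assms(1) by simp
  moreover have "rand_cost_le X Y (return_pmf P) 0" unfolding rand_cost_le_def using assms(2) by simp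
  ultimately show ?thesis using rand_cc_le by fastforce
qed

section \<open>Random hash functions\<close>

definition hashes :: "nat \<Rightarrow> nat \<Rightarrow> (nat \<Rightarrow> nat) set" where
  "hashes n M = ({..<n} \<rightarrow>\<^sub>E {..<M})"

lemma card_hashes: "card (hashes n M) = M ^ n"
  unfolding hashes_def by (subst card_PiE) auto

lemma finite_hashes: "finite (hashes n M)"
  unfolding hashes_def by (rule finite_PiE) auto

text \<open>A colliding \<open>h\<close> is determined by its values away from \<open>i\<close>,
  because \<open>h i = h j\<close>.\<close>

lemma card_collision_le:
  assumes "i < n" "j < n" "i \<noteq> j"
  shows "M * card {h \<in> hashes n M. h i = h j} \<le> M ^ n"
proof -
  let ?R = "({..<n} - {i}) \<rightarrow>\<^sub>E {..<M}"
  have "inj_on (\<lambda>h. restrict h ({..<n} - {i})) {h \<in> hashes n M. h i = h j}"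
  proof (rule inj_onI)
    fix h h' assume h: "h \<in> {h \<in> hashes n M. h i = h j}" "h' \<in> {h \<in> hashes n M. h i = h j}"
      and eq: "restrict h ({..<n} - {i}) = restrict h' ({..<n} - {i})"
    have *: "h l = h' l" if "l < n" "l \<noteq> i" for l
      using fun_cong[OF eq, of l] that by simp
    show "h = h'"
    proof (rule PiE_ext)
      show "h \<in> {..<n} \<rightarrow>\<^sub>E {..<M}" "h' \<in> {..<n} \<rightarrow>\<^sub>E {..<M}" using h by (auto simp: hashes_def)
      fix l assume "l \<in> {..<n}"
      then show "h l = h' l" using * *[of j] h assms by (cases "l = i") auto
    qed
  qed
  moreover have "(\<lambda>h. restrict h ({..<n} - {i})) ` {h \<in> hashes n M. h i = h j} \<subseteq> ?R"
    unfolding hashes_def by (auto simp: PiE_iff split: if_splits)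
  ultimately have "card {h \<in> hashes n M. h i = h j} \<le> card ?R"
    by (intro card_inj_on_le finite_PiE) auto
  also have "card ?R = M ^ (n - 1)" using assms by (subst card_PiE) auto
  finally have "M * card {h \<in> hashes n M. h i = h j} \<le> M * M ^ (n - 1)" by simp
  also have "\<dots> = M ^ n" using assms by (cases n) auto
  finally show ?thesis .
qed

text \<open>Union bound over the ordered pairs of elements of \<open>S\<close>.\<close>

lemma card_not_inj_le:
  assumes "S \<subseteq> {..<n}"
  shows "M * card {h \<in> hashes n M. \<not> inj_on h S} \<le> (card S)\<^sup>2 * M ^ n"
proof -
  have fS: "finite S" using assms finite_subset by blast
  let ?C = "\<lambda>(i, j). {h \<in> hashes n M. i \<noteq> j \<and> h i = h j}"
  have "{h \<in> hashes n M. \<not> inj_on h S} \<subseteq> (\<Union>p\<in>S \<times> S. ?C p)"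
    by (auto simp: inj_on_def)
  then have "card {h \<in> hashes n M. \<not> inj_on h S} \<le> card (\<Union>p\<in>S \<times> S. ?C p)"
    using fS finite_hashes by (intro card_mono) auto
  also have "\<dots> \<le> (\<Sum>p\<in>S \<times> S. card (?C p))"
    using fS by (intro card_UN_le) auto
  finally have "M * card {h \<in> hashes n M. \<not> inj_on h S} \<le> (\<Sum>p\<in>S \<times> S. M * card (?C p))"
    by (simp flip: sum_distrib_left)
  also have "\<dots> \<le> (\<Sum>p\<in>S \<times> S. M ^ n)"
  proof (rule sum_mono)
    fix p assume "p \<in> S \<times> S"
    then obtain i j where p: "p = (i, j)" "i < n" "j < n" using assms by auto
    show "M * card (?C p) \<le> M ^ n"
      using card_collision_le[OF p(2,3), of M] p(1) by (cases "i = j") auto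
  qed
  also have "\<dots> = (card S)\<^sup>2 * M ^ n" by (simp add: card_cartesian_product power2_eq_square)
  finally show ?thesis .
qed

text \<open>Lists of length \<open>k\<close> over \<open>{..M}\<close> describe all these sets; the
  extra letter \<open>M\<close> pads the sets with fewer than \<open>k\<close> elements.\<close>

lemma card_small_subsets_le: "card {S. S \<subseteq> {..<M} \<and> card S \<le> k} \<le> (M + 1) ^ k"
proof -
  let ?L = "{l. set l \<subseteq> {..M} \<and> length l = k}"
  have "{S. S \<subseteq> {..<M} \<and> card S \<le> k} \<subseteq> (\<lambda>l. set l - {M}) ` ?L"
  proof
    fix S assume "S \<in> {S. S \<subseteq> {..<M} \<and> card S \<le> k}"
    then have S: "S \<subseteq> {..<M}" "card S \<le> k" "finite S" using finite_subset by auto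
    let ?l = "sorted_list_of_set S @ replicate (k - card S) M"
    have "length ?l = k" using S by simp
    moreover have "set ?l \<subseteq> {..M}" using S by auto
    moreover have "S = set ?l - {M}" using S by auto
    ultimately show "S \<in> (\<lambda>l. set l - {M}) ` ?L" by blast
  qed
  then have "card {S. S \<subseteq> {..<M} \<and> card S \<le> k} \<le> card ?L"
    by (rule surj_card_le[rotated]) (rule finite_lists_length_eq, simp)
  also have "\<dots> = (M + 1) ^ k" by (subst card_lists_length_eq) auto
  finally show ?thesis .
qed

section \<open>Zero sets and values by weight\<close>

definition zeros :: "bool list \<Rightarrow> nat set" where
  "zeros x = {i. i < length x \<and> \<not> x ! i}"

lemma hamming_weight_card: "hamming_weight l = card {i. i < length l \<and> l ! i}"
  unfolding hamming_weight_def count_list_eq_length_filter length_filter_conv_card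
  by (simp cong: conj_cong)

lemma hamming_weight_and:
  assumes "x \<in> cube n" "y \<in> cube n"
  shows "hamming_weight (map2 (\<and>) x y) = n - card (zeros x \<union> zeros y)"
proof -
  have "{i. i < length (map2 (\<and>) x y) \<and> map2 (\<and>) x y ! i} = {..<n} - (zeros x \<union> zeros y)"
    using assms by (auto simp: cube_def zeros_def)
  moreover have "zeros x \<union> zeros y \<subseteq> {..<n}" using assms by (auto simp: cube_def zeros_def)
  moreover have "finite (zeros x \<union> zeros y)" by (simp add: zeros_def)
  ultimately show ?thesis unfolding hamming_weight_card
    by (simp only: card_Diff_subset card_lessThan)
qed

text \<open>The representative has length \<open>n\<close>, and thus lies in the domain of the
  symmetry assumption, only for \<open>w \<le> n\<close>.\<close>

definition of_weight :: "nat \<Rightarrow> (bool list \<Rightarrow> bool) \<Rightarrow> nat \<Rightarrow> bool" where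
  "of_weight n f w = f (replicate w True @ replicate (n - w) False)"

lemma symmetric_fun_of_weight:
  assumes "symmetric_fun n f" "z \<in> cube n"
  shows "f z = of_weight n f (hamming_weight z)"
proof -
  let ?w = "hamming_weight z"
  have "?w \<le> n" using assms(2) count_le_length[of z True] unfolding hamming_weight_def cube_def by simp
  then have "replicate ?w True @ replicate (n - ?w) False \<in> cube n"
    and "hamming_weight (replicate ?w True @ replicate (n - ?w) False) = ?w"
    by (auto simp: cube_def hamming_weight_def count_list_eq_length_filter)
  then show ?thesis using assms unfolding symmetric_fun_def of_weight_def by metis
qed

lemma box_and_of_weight:
  assumes "symmetric_fun n f" "x \<in> cube n" "y \<in> cube n"
  shows "box_and f x y = of_weight n f (n - card (zeros x \<union> zeros y))"
proof -
  have "map2 (\<and>) x y \<in> cube n" using assms by (simp add: cube_def)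
  then show ?thesis unfolding box_and_def using symmetric_fun_of_weight[OF assms(1)] hamming_weight_and[OF assms(2,3)] by simp
qed

text \<open>
  Only inputs with fewer than \<open>k\<close> zeros matter, and the size of the union of the zero sets of two
  such inputs survives hashing the coordinates into a range quadratic in \<open>k\<close>.
\<close>

lemma rand_cc_box_and_le:
  assumes f: "symmetric_fun n f" and k: "1 \<le> k" "k \<le> n"
    and const: "\<And>w. w \<le> n - k \<Longrightarrow> of_weight n f w = of_weight n f 0"
    and L: "12 * k\<^sup>2 + 1 \<le> 2 ^ L"
  shows "rand_cc (cube n) (cube n) (box_and f) \<le> L * k"
proof -
  \<comment> \<open>The union of two zero sets with fewer than \<open>k\<close> elements has at most
    \<open>2 k\<close> elements, so a random hash fails to be injective on it with probability at
    most \<open>4 k^2 / M = 1/3\<close>.\<close>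
  define M where "M = 12 * k\<^sup>2"
  define D where "D = {S. S \<subseteq> {..<M} \<and> card S \<le> k}"
  have "k * 1 \<le> k * k" using k by (intro mult_left_mono) auto
  then have kM: "k \<le> M" "0 < M" using k by (auto simp: M_def power2_eq_square)
  have finD: "finite D" unfolding D_def by simp
  have "card D \<le> (M + 1) ^ k" unfolding D_def by (rule card_small_subsets_le)
  also have "\<dots> \<le> (2 ^ L) ^ k" using L by (intro power_mono) (auto simp: M_def)
  finally have cardD: "card D \<le> 2 ^ (L * k)" by (simp add: power_mult)
  \<comment> \<open>The default \<open>{..<k}\<close> signals too many zeros: with \<open>k\<close>
    elements of its own it pushes Bob's union to size at least \<open>k\<close>, where the value is
    constant. It also keeps the message in \<open>D\<close> for lists outside the cube.\<close>
  define msg where "msg = (\<lambda>h x. if card (zeros x) < k \<and> zeros x \<subseteq> {..<n} then h ` zeros x else {..<k})"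
  define out where "out = (\<lambda>(h :: nat \<Rightarrow> nat) S y. if k \<le> card (zeros y) then of_weight n f 0
     else of_weight n f (n - card (S \<union> h ` zeros y)))"
  have "\<exists>P. \<forall>x y. det_output P x y = out h (msg h x) y \<and> det_bits P x y = L * k" if "h \<in> hashes n M" for h
  proof (rule one_way_protocol_exists[OF finD cardD])
    fix x
    show "msg h x \<in> D"
    proof (cases "card (zeros x) < k \<and> zeros x \<subseteq> {..<n}")
      case True
      then have "h ` zeros x \<subseteq> {..<M}" using that by (auto simp: hashes_def)
      moreover have "card (h ` zeros x) \<le> k"
        using True card_image_le[of "zeros x" h] by (simp add: zeros_def)
      ultimately show ?thesis using True by (simp add: msg_def D_def)
    next
      case False
      then have "msg h x = {..<k}" unfolding msg_def by (rule if_not_P)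
      then show ?thesis using kM by (simp add: D_def)
    qed
  qed
  then obtain prot where prot: "\<And>h x y. h \<in> hashes n M \<Longrightarrow> det_output (prot h) x y = out h (msg h x) y"
    "\<And>h x y. h \<in> hashes n M \<Longrightarrow> det_bits (prot h) x y = L * k"
    by metis
  have correct: "det_output (prot h) x y = box_and f x y"
    if h: "h \<in> hashes n M" and x: "x \<in> cube n" and y: "y \<in> cube n"
      and inj: "card (zeros x) < k \<Longrightarrow> card (zeros y) < k \<Longrightarrow> inj_on h (zeros x \<union> zeros y)" for h x y
  proof -
    have fin: "finite (zeros x)" "finite (zeros y)" by (simp_all add: zeros_def)
    have sub: "zeros x \<subseteq> {..<n}" using x by (auto simp: zeros_def cube_def)
    \<comment> \<open>Truncated subtraction is harmless: \<open>n - c\<close> is at most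
      \<open>n - k\<close> even if \<open>c\<close> exceeds \<open>n\<close>.\<close>
    have big: "of_weight n f (n - c) = of_weight n f 0" if "k \<le> c" for c
      using that by (intro const) simp
    show ?thesis
    proof (cases "k \<le> card (zeros y)")
      case True
      have "card (zeros y) \<le> card (zeros x \<union> zeros y)" using fin by (intro card_mono) auto
      then show ?thesis unfolding prot(1)[OF h] box_and_of_weight[OF f x y] out_def using True big by simp
    next
      case y': False
      show ?thesis
      proof (cases "k \<le> card (zeros x)")
        case True
        then have m: "msg h x = {..<k}" by (simp add: msg_def)
        have "card {..<k} \<le> card ({..<k} \<union> h ` zeros y)" using fin by (intro card_mono) auto
        moreover have "card (zeros x) \<le> card (zeros x \<union> zeros y)" using fin by (intro card_mono) auto
        ultimately show ?thesis
          unfolding prot(1)[OF h] box_and_of_weight[OF f x y] out_def m using True y' big by simp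
      next
        case False
        then have m: "msg h x = h ` zeros x" using sub by (simp add: msg_def)
        have "card (h ` zeros x \<union> h ` zeros y) = card (zeros x \<union> zeros y)"
          unfolding image_Un[symmetric] using inj False y' by (intro card_image) auto
        then show ?thesis unfolding prot(1)[OF h] box_and_of_weight[OF f x y] out_def m using y' by simp
      qed
    qed
  qed
  define R where "R = map_pmf prot (pmf_of_set (hashes n M))"
  have ne: "hashes n M \<noteq> {}" using card_hashes[of n M] kM by auto
  have "rand_computes (cube n) (cube n) (box_and f) R"
    unfolding rand_computes_def
  proof (intro ballI)
    fix x y assume x: "x \<in> cube n" and y: "y \<in> cube n"
    define bad where "bad = {h \<in> hashes n M. det_output (prot h) x y \<noteq> box_and f x y}"
    have "measure_pmf.prob R {P. det_output P x y \<noteq> box_and f x y}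
      = real (card bad) / real (card (hashes n M))"
      unfolding R_def measure_map_pmf measure_pmf_of_set[OF ne finite_hashes] bad_def vimage_def Int_def by simp
    also have "\<dots> \<le> 1/3"
    proof (cases "card (zeros x) < k \<and> card (zeros y) < k")
      case True
      have c: "card (zeros x \<union> zeros y) \<le> 2 * k" using True card_Un_le[of "zeros x" "zeros y"] by linarith
      have sub: "zeros x \<union> zeros y \<subseteq> {..<n}" using x y by (auto simp: zeros_def cube_def)
      have "bad \<subseteq> {h \<in> hashes n M. \<not> inj_on h (zeros x \<union> zeros y)}"
        unfolding bad_def using correct x y by blast
      then have "card bad \<le> card {h \<in> hashes n M. \<not> inj_on h (zeros x \<union> zeros y)}"
        using finite_hashes by (intro card_mono) auto
      then have "M * card bad \<le> M * card {h \<in> hashes n M. \<not> inj_on h (zeros x \<union> zeros y)}" by simp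
      also have "\<dots> \<le> (card (zeros x \<union> zeros y))\<^sup>2 * M ^ n" by (rule card_not_inj_le[OF sub])
      also have "\<dots> \<le> (2 * k)\<^sup>2 * M ^ n" using c by (intro mult_right_mono power_mono) auto
      finally have "M * (3 * card bad) \<le> M * M ^ n" by (simp add: M_def power_mult_distrib)
      then have "3 * card bad \<le> M ^ n" using kM(2) by simp
      then have "3 * real (card bad) \<le> real (M ^ n)" by (metis of_nat_le_iff of_nat_mult of_nat_numeral)
      then show ?thesis unfolding card_hashes using kM(2) by (simp add: divide_le_eq)
    next
      case False
      then have "bad = {}" unfolding bad_def using correct x y by blast
      then show ?thesis by simp
    qed
    finally show "measure_pmf.prob R {P. det_output P x y \<noteq> box_and f x y} \<le> 1/3" .
  qed
  moreover have "rand_cost_le (cube n) (cube n) R (L * k)"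
    unfolding rand_cost_le_def R_def using prot(2) ne finite_hashes by auto
  ultimately show ?thesis by (rule rand_cc_le)
qed

section \<open>Quantum protocols for symmetric functions\<close>

text \<open>Both bits of a block stand next to their negations, so that Bob can apply a mask bit
  merely by choosing a coordinate.\<close>

definition Alice_block :: "nat set \<Rightarrow> nat set \<Rightarrow> nat \<Rightarrow> bool list" where
  "Alice_block x0 x1 j = [j \<in> x0, j \<notin> x0, j \<in> x1, j \<notin> x1]"

text \<open>A single one: \<open>V\<close> chooses between the two bits of the block,
  \<open>w\<close> between plain and negated. The conjunction with Alice's block then has weight
  equal to the masked selected bit.\<close>

definition Bob_block :: "nat set \<Rightarrow> nat set \<Rightarrow> nat \<Rightarrow> bool list" where
  "Bob_block V w j = [j \<notin> V \<and> j \<notin> w, j \<notin> V \<and> j \<in> w, j \<in> V \<and> j \<notin> w, j \<in> V \<and> j \<in> w]"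

lemma hamming_weight_append: "hamming_weight (x @ y) = hamming_weight x + hamming_weight y"
  by (simp add: hamming_weight_def)

lemma length_blocks:
  "length (concat (map (Alice_block x0 x1) [0..<t])) = 4 * t"
  "length (concat (map (Bob_block V w) [0..<t])) = 4 * t"
  by (induction t) (simp_all add: Alice_block_def Bob_block_def)

lemma hamming_weight_block:
  "hamming_weight (map2 (\<and>) (Alice_block x0 x1 j) (Bob_block V w j))
   = (if j \<in> sym_diff ((x0 - V) \<union> (x1 \<inter> V)) w then 1 else 0)"
  by (auto simp: hamming_weight_def Alice_block_def Bob_block_def)

lemma hamming_weight_blocks:
  "hamming_weight (map2 (\<and>) (concat (map (Alice_block x0 x1) [0..<t])) (concat (map (Bob_block V w) [0..<t])))
   = card (sym_diff ((x0 - V) \<union> (x1 \<inter> V)) w \<inter> {..<t})"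
proof (induction t)
  case 0
  show ?case by (simp add: hamming_weight_def)
next
  case (Suc t)
  let ?z = "sym_diff ((x0 - V) \<union> (x1 \<inter> V)) w"
  have "hamming_weight (map2 (\<and>) (concat (map (Alice_block x0 x1) [0..<Suc t])) (concat (map (Bob_block V w) [0..<Suc t])))
     = card (?z \<inter> {..<t}) + (if t \<in> ?z then 1 else 0)"
    using Suc by (simp add: zip_append length_blocks hamming_weight_append hamming_weight_block)
  also have "\<dots> = card (?z \<inter> {..<Suc t})"
  proof (cases "t \<in> ?z")
    case True
    then have "?z \<inter> {..<Suc t} = insert t (?z \<inter> {..<t})" by (auto simp: less_Suc_eq)
    then show ?thesis using True by simp
  next
    case False
    then have "?z \<inter> {..<Suc t} = ?z \<inter> {..<t}" by (auto simp: less_Suc_eq)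
    then show ?thesis using False by simp
  qed
  finally show ?case .
qed

text \<open>Padding with \<open>m - 1\<close> common ones and \<open>r\<close> common zeros places
  the intersection sizes 0 and 1 of the blocks at the weights \<open>m - 1\<close> and
  \<open>m\<close>, on both sides of the jump.\<close>

lemma quantum_lower_bound:
  assumes f: "symmetric_fun n f" and m: "1 \<le> m" "m \<le> n" and jump: "of_weight n f (m - 1) \<noteq> of_weight n f m"
    and t: "m - 1 + 4 * t \<le> n"
    and P: "quantum_computes (cube n) (cube n) (box_and f) a b \<psi> P"
  shows "t < 49 * (4 * q_qubits P + 8)\<^sup>2"
proof -
  define r where "r = n - (m - 1 + 4 * t)"
  define xs where "xs = (\<lambda>x0 x1. replicate (m - 1) True @ concat (map (Alice_block x0 x1) [0..<t]) @ replicate r False)"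
  define ys where "ys = (\<lambda>V w. replicate (m - 1) True @ concat (map (Bob_block V w) [0..<t]) @ replicate r False)"
  have xs: "xs x0 x1 \<in> cube n" for x0 x1
    unfolding xs_def cube_def mem_Collect_eq length_append length_blocks length_replicate r_def using t by simp
  have ys: "ys V w \<in> cube n" for V w
    unfolding ys_def cube_def mem_Collect_eq length_append length_blocks length_replicate r_def using t by simp
  have h: "hamming_weight (map2 (\<and>) (replicate i c) (replicate i c)) = (if c then i else 0)" for i c
    by (induction i) (auto simp: hamming_weight_def)
  have val: "box_and f (xs x0 x1) (ys V w) = of_weight n f (m - 1 + card (sym_diff ((x0 - V) \<union> (x1 \<inter> V)) w))"
    if "x0 \<subseteq> {..<t}" "x1 \<subseteq> {..<t}" "V \<subseteq> {..<t}" "w \<subseteq> {..<t}" for x0 x1 V w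
  proof -
    have "map2 (\<and>) (xs x0 x1) (ys V w) \<in> cube n" using xs[of x0 x1] ys[of V w] by (simp add: cube_def)
    moreover have "hamming_weight (map2 (\<and>) (xs x0 x1) (ys V w)) = m - 1 + card (sym_diff ((x0 - V) \<union> (x1 \<inter> V)) w \<inter> {..<t})"
      unfolding xs_def ys_def
      by (simp only: zip_append length_replicate length_append length_blocks map_append hamming_weight_append h hamming_weight_blocks if_True if_False)
    moreover have "sym_diff ((x0 - V) \<union> (x1 \<inter> V)) w \<inter> {..<t} = sym_diff ((x0 - V) \<union> (x1 \<inter> V)) w"
      using that by blast
    ultimately show ?thesis unfolding box_and_def using symmetric_fun_of_weight[OF f] by simp
  qed
  have P': "q_valid (cube n) (cube n) P a b" "\<psi> \<in> carrier_vec (a * b)" "norm2_vec \<psi> = 1"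
    using P by (auto simp: quantum_computes_def)
  show ?thesis
  proof (rule promise_lower_bound[where xs = xs and ys = ys and g = "\<lambda>c. of_weight n f (m - 1 + c)", OF P'])
    fix x0 x1 V w assume sub: "x0 \<subseteq> {..<t}" "x1 \<subseteq> {..<t}" "V \<subseteq> {..<t}" "w \<subseteq> {..<t}"
    have "(if box_and f (xs x0 x1) (ys V w) then 1 - q_accept_prob P (xs x0 x1) (ys V w) a b \<psi>
      else q_accept_prob P (xs x0 x1) (ys V w) a b \<psi>) \<le> 1/3"
      using P xs ys unfolding quantum_computes_def by blast
    then show "(if of_weight n f (m - 1 + card (sym_diff ((x0 - V) \<union> (x1 \<inter> V)) w))
      then 1 - q_accept_prob P (xs x0 x1) (ys V w) a b \<psi> else q_accept_prob P (xs x0 x1) (ys V w) a b \<psi>) \<le> 1/3"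
      unfolding val[OF sub] .
  next
    show "of_weight n f (m - 1 + 0) \<noteq> of_weight n f (m - 1 + 1)" using jump m by simp
  qed (use xs ys in auto)
qed

section \<open>A quantum protocol that sends the whole input\<close>

definition input_index :: "nat \<Rightarrow> bool list \<Rightarrow> nat" where
  "input_index i x = (\<Sum>l<i. if x ! l then 2 ^ l else 0)"

lemma input_index_less: "input_index i x < 2 ^ i"
  by (induction i) (auto simp: input_index_def)

lemma input_index_inj: "input_index i x = input_index i y \<Longrightarrow> l < i \<Longrightarrow> x ! l = y ! l"
proof (induction i)
  case (Suc i)
  have s: "input_index (Suc i) z = input_index i z + (if z ! i then 2 ^ i else 0)" for z
    by (simp add: input_index_def)
  have "x ! i = y ! i" "input_index i x = input_index i y"
    using Suc.prems(1) input_index_less[of i x] input_index_less[of i y] unfolding s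
    by (auto split: if_splits)
  then show ?case using Suc by (cases "l = i") auto
qed simp

text \<open>Alice's memory has dimension \<open>1\<close>, and each isometry prepares a fresh qubit
  holding \<open>x ! i\<close>. The argument \<open>i\<close> counts the qubits already sent,
  \<open>r\<close> those still to come.\<close>

primrec send_input :: "('y \<Rightarrow> complex mat) \<Rightarrow> nat \<Rightarrow> nat \<Rightarrow> (bool list, 'y) q_protocol" where
  "send_input E 0 i = Bob_measures E"
| "send_input E (Suc r) i = Alice_sends_qubit 1
     (\<lambda>x. Matrix.mat 2 1 (\<lambda>(s, _). if s = (if x ! i then 1 else 0) then 1 else 0)) (send_input E r (Suc i))"

lemma dim_mat_adjoint: "dim_row (mat_adjoint A) = dim_col A" "dim_col (mat_adjoint A) = dim_row A"
  by (simp_all add: mat_adjoint_def)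

lemma isometry_bit: "isometry_mat 2 1 (Matrix.mat 2 1 (\<lambda>(s, _). if s = (if c then 1 else 0) then 1 else 0))"
  (is "isometry_mat 2 1 ?U")
proof -
  have U: "?U \<in> carrier_mat 2 1" by simp
  have "(mat_adjoint ?U * ?U) $$ (0, 0) = 1"
    using mat_adjoint_mult_index[OF U, of 0 0] by (simp add: numeral_2_eq_2)
  then have "mat_adjoint ?U * ?U = 1\<^sub>m 1" by (intro eq_matI) (simp_all add: dim_mat_adjoint)
  then show ?thesis using U by (simp add: isometry_mat_def)
qed

lemma q_valid_send_input:
  assumes "\<And>y. y \<in> Y \<Longrightarrow> projector_mat (2 ^ (i + r)) (E y)"
  shows "q_valid X Y (send_input E r i) 1 (2 ^ i)"
  using assms
proof (induction r arbitrary: i)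
  case (Suc r)
  then have "q_valid X Y (send_input E r (Suc i)) 1 (2 ^ Suc i)" by (intro Suc.IH) simp
  then show ?case using isometry_bit by simp
qed simp

text \<open>A received qubit is the first factor on Bob's side, so bit \<open>i\<close> gets the
  weight \<open>2 ^ i\<close>, in agreement with \<open>input_index\<close>.\<close>

lemma kron_bit_unit_vec:
  "kron_mat (Matrix.mat 2 1 (\<lambda>(s, _). if s = (if x ! i then 1 else 0) then 1 else 0)) (1\<^sub>m (2 ^ i)) *\<^sub>v
     unit_vec (2 ^ i) (input_index i x) = unit_vec (2 ^ Suc i) (input_index (Suc i) x)"
  (is "kron_mat ?U _ *\<^sub>v ?v = ?v'")
proof (rule eq_vecI)
  have U: "?U \<in> carrier_mat 2 1" by simp
  have v: "?v \<in> carrier_vec (1 * 2 ^ i)" by simp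
  fix c assume "c < dim_vec ?v'"
  then have c: "c < 2 * 2 ^ i" by simp
  define s j where "s = c div 2 ^ i" and "j = c mod 2 ^ i"
  have sj: "c = s * 2 ^ i + j" "s < 2" "j < 2 ^ i"
    unfolding s_def j_def using less_mult_imp_div_less[OF c] by (simp_all only: div_mult_mod_eq mod_less_divisor zero_less_power zero_less_numeral)
  have "vec_index (kron_mat ?U (1\<^sub>m (2 ^ i)) *\<^sub>v ?v) c = (\<Sum>k<1. ?U $$ (s, k) * coords (2 ^ i) ?v (k, j))"
    using coords_kron_left[OF U v sj(2,3)] unfolding coords_def sj(1) by simp
  also have "\<dots> = (if s = (if x ! i then 1 else 0) \<and> j = input_index i x then 1 else 0)"
    using sj input_index_less[of i x] by (auto simp: coords_def)
  also have "\<dots> = vec_index ?v' c"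
  proof -
    define b where "b = (if x ! i then 1 else 0 :: nat)"
    have e: "input_index (Suc i) x = b * 2 ^ i + input_index i x" by (simp add: input_index_def b_def)
    have "s = b \<and> j = input_index i x \<longleftrightarrow> c = input_index (Suc i) x"
    proof
      assume "c = input_index (Suc i) x"
      then show "s = b \<and> j = input_index i x"
        unfolding s_def j_def e using input_index_less[of i x] by simp
    qed (simp add: e sj(1))
    moreover have "vec_index ?v' c = (if c = input_index (Suc i) x then 1 else 0)"
      using c input_index_less[of "Suc i" x] by (subst index_unit_vec(1)) auto
    ultimately show ?thesis unfolding b_def by simp
  qed
  finally show "vec_index (kron_mat ?U (1\<^sub>m (2 ^ i)) *\<^sub>v ?v) c = vec_index ?v' c" .
qed (simp add: kron_mat_def)

lemma q_accept_prob_send_input: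
  "q_accept_prob (send_input E r i) x y 1 (2 ^ i) (unit_vec (2 ^ i) (input_index i x))
   = norm2_vec (kron_mat (1\<^sub>m 1) (E y) *\<^sub>v unit_vec (2 ^ (i + r)) (input_index (i + r) x))"
proof (induction r arbitrary: i)
  case (Suc r)
  show ?case using Suc[of "Suc i"] kron_bit_unit_vec[of x i] by simp
qed simp

text \<open>Guarantees that the \<open>LEAST\<close> in \<open>quantum_cc\<close> is attained by a
  protocol. Bob measures with the diagonal projector onto the indices of the inputs \<open>x\<close>
  with \<open>F x y\<close>.\<close>

lemma quantum_protocol_exists:
  "\<exists>a b \<psi> P. quantum_computes (cube n) Y F a b \<psi> P"
proof -
  define A where "A = (\<lambda>y. {input_index n x | x. x \<in> cube n \<and> F x y})"
  define E where "E = (\<lambda>y. Matrix.mat (2 ^ n) (2 ^ n) (\<lambda>(i, j). if i = j \<and> i \<in> A y then 1 else 0 :: complex))"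
  have E: "E y \<in> carrier_mat (2 ^ n) (2 ^ n)" for y by (simp add: E_def)
  have adj: "mat_adjoint (E y) = E y" for y
    by (rule eq_matI) (auto simp: E_def mat_adjoint_def mat_of_rows_def)
  have sq: "E y * E y = E y" for y
  proof (rule eq_matI)
    fix i j assume ij: "i < dim_row (E y)" "j < dim_col (E y)"
    then have ij': "i < 2 ^ n" "j < 2 ^ n" using E[of y] by auto
    have "(E y * E y) $$ (i, j) = (\<Sum>l<2 ^ n. cnj (E y $$ (l, i)) * E y $$ (l, j))"
      using mat_adjoint_mult_index[OF E ij', of y] unfolding adj .
    also have "\<dots> = (\<Sum>l<2 ^ n. if l = i then E y $$ (i, j) else 0)"
      by (rule sum.cong) (use ij' in \<open>auto simp: E_def\<close>)
    also have "\<dots> = E y $$ (i, j)" using ij' by simp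
    finally show "(E y * E y) $$ (i, j) = E y $$ (i, j)" .
  qed (use E in auto)
  have proj: "projector_mat (2 ^ n) (E y)" for y using E adj sq by (simp add: projector_mat_def)
  let ?P = "send_input E n 0" and ?\<psi> = "unit_vec 1 0 :: complex Matrix.vec"
  have acc: "q_accept_prob ?P x y 1 1 ?\<psi> = (if F x y then 1 else 0)" if x: "x \<in> cube n" for x y
  proof -
    let ?i = "input_index n x"
    have i: "?i < 2 ^ n" by (rule input_index_less)
    have mem: "?i \<in> A y \<longleftrightarrow> F x y"
    proof
      assume "?i \<in> A y"
      then obtain x' where x': "input_index n x = input_index n x'" "x' \<in> cube n" "F x' y" unfolding A_def by auto
      have "x = x'" using x x'(2) input_index_inj[OF x'(1)] by (auto simp: cube_def intro: nth_equalityI)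
      then show "F x y" using x'(3) by simp
    qed (use x in \<open>auto simp: A_def\<close>)
    have v: "(unit_vec (2 ^ n) ?i :: complex Matrix.vec) \<in> carrier_vec (1 * 2 ^ n)" by simp
    have c: "kron_mat (1\<^sub>m 1) (E y) *\<^sub>v unit_vec (2 ^ n) ?i \<in> carrier_vec (1 * 2 ^ n)"
      using mult_mat_vec_carrier[OF kron_mat_carrier[OF one_carrier_mat E] v] .
    have "q_accept_prob ?P x y 1 1 ?\<psi> = norm2_vec (kron_mat (1\<^sub>m 1) (E y) *\<^sub>v unit_vec (2 ^ n) ?i)"
      using q_accept_prob_send_input[of E n 0 x y] by (simp add: input_index_def)
    also have "\<dots> = (\<Sum>j<2 ^ n. (cmod (coords (2 ^ n) (kron_mat (1\<^sub>m 1) (E y) *\<^sub>v unit_vec (2 ^ n) ?i) (0, j)))\<^sup>2)"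
      unfolding norm2_vec_coords[OF c] nrm_pairs' by (simp add: nrm_def)
    also have "\<dots> = (\<Sum>j<2 ^ n. if j = ?i then (if F x y then 1 else 0) else 0)"
    proof (rule sum.cong[OF refl])
      fix j :: nat assume "j \<in> {..<2 ^ n}"
      then have j: "j < 2 ^ n" by simp
      have "coords (2 ^ n) (kron_mat (1\<^sub>m 1) (E y) *\<^sub>v unit_vec (2 ^ n) ?i) (0, j)
         = (\<Sum>l<2 ^ n. E y $$ (j, l) * coords (2 ^ n) (unit_vec (2 ^ n) ?i) (0, l))"
        by (rule coords_kron_right[OF E v _ j]) simp
      also have "\<dots> = (\<Sum>l<2 ^ n. if l = ?i then E y $$ (j, ?i) else 0)"
        by (rule sum.cong) (auto simp: coords_def i)
      also have "\<dots> = (if j = ?i then (if F x y then 1 else 0) else 0)"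
        using i j mem by (auto simp: E_def)
      finally show "(cmod (coords (2 ^ n) (kron_mat (1\<^sub>m 1) (E y) *\<^sub>v unit_vec (2 ^ n) ?i) (0, j)))\<^sup>2
         = (if j = ?i then (if F x y then 1 else 0) else 0)" by simp
    qed
    also have "\<dots> = (if F x y then 1 else 0)" using i by simp
    finally show ?thesis .
  qed
  have "q_valid (cube n) Y ?P 1 1" using q_valid_send_input[of Y 0 n E] proj by simp
  moreover have "norm2_vec ?\<psi> = 1" by (simp add: norm2_vec_def)
  ultimately have "quantum_computes (cube n) Y F 1 1 ?\<psi> ?P"
    unfolding quantum_computes_def using acc by auto
  then show ?thesis by blast
qed

text \<open>Without communication the acceptance probability depends only on the input of the
  measuring party, hence so does the function, and this party can announce it.\<close>

lemma rand_cc_eq_0_of_zero_qubits: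
  assumes P: "quantum_computes X Y F a b \<psi> P" and q: "q_qubits P = 0"
  shows "rand_cc X Y F = 0"
proof (cases P)
  case (Alice_measures E)
  have "F x y = F x y'" if "x \<in> X" "y \<in> Y" "y' \<in> Y" for x y y'
  proof -
    have "(if F x z then 1 - norm2_vec (kron_mat (E x) (1\<^sub>m b) *\<^sub>v \<psi>) else norm2_vec (kron_mat (E x) (1\<^sub>m b) *\<^sub>v \<psi>)) \<le> 1/3"
      if "z \<in> Y" for z
      using P that \<open>x \<in> X\<close> unfolding quantum_computes_def Alice_measures q_accept_prob.simps by blast
    from this[OF that(2)] this[OF that(3)] show ?thesis by (auto split: if_splits)
  qed
  then have "F x (SOME y. y \<in> Y) = F x y" if "x \<in> X" "y \<in> Y" for x y
    using that someI[of "\<lambda>y. y \<in> Y" y] by blast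
  then show ?thesis by (intro rand_cc_eq_0[of _ _ "Alice_outputs (\<lambda>x. F x (SOME y. y \<in> Y))"]) auto
next
  case (Bob_measures E)
  have "F x y = F x' y" if "x \<in> X" "x' \<in> X" "y \<in> Y" for x x' y
  proof -
    have "(if F z y then 1 - norm2_vec (kron_mat (1\<^sub>m a) (E y) *\<^sub>v \<psi>) else norm2_vec (kron_mat (1\<^sub>m a) (E y) *\<^sub>v \<psi>)) \<le> 1/3"
      if "z \<in> X" for z
      using P that \<open>y \<in> Y\<close> unfolding quantum_computes_def Bob_measures q_accept_prob.simps by blast
    from this[OF that(1)] this[OF that(2)] show ?thesis by (auto split: if_splits)
  qed
  then have "F (SOME x. x \<in> X) y = F x y" if "x \<in> X" "y \<in> Y" for x y
    using that someI[of "\<lambda>x. x \<in> X" x] by blast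
  then show ?thesis by (intro rand_cc_eq_0[of _ _ "Bob_outputs (\<lambda>y. F (SOME x. x \<in> X) y)"]) auto
qed (use q in auto)

section \<open>The cubic relation\<close>

text \<open>The quotient \<open>L^4 / 2^L\<close> is largest at \<open>L = 6\<close>, where
  \<open>1296 \<le> 21 * 64\<close>. From there on a step at most doubles the fourth power.\<close>

lemma power4_le: "L ^ 4 \<le> 21 * 2 ^ L" for L :: nat
proof (cases "L \<le> 6")
  case True
  then have "L \<in> {0, 1, 2, 3, 4, 5, 6}" by auto
  then show ?thesis by auto
next
  case False
  then have "6 \<le> L" by simp
  then show ?thesis
  proof (induction L rule: dec_induct)
    case (step L)
    have "L * L\<^sup>2 \<ge> 6 * L\<^sup>2" "L * L ^ 3 \<ge> 6 * L ^ 3" "L * L \<ge> 6 * L"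
      using step by (intro mult_right_mono; simp)+
    then have "4 * L ^ 3 + 6 * L\<^sup>2 + 4 * L + 1 \<le> L ^ 4"
      using step unfolding power2_eq_square power3_eq_cube power4_eq_xxxx mult.assoc by linarith
    then have "(Suc L) ^ 4 \<le> 2 * L ^ 4" by (simp add: power2_eq_square power3_eq_cube power4_eq_xxxx algebra_simps)
    then show ?case using step by simp
  qed simp
qed

lemma power_of_two_between: "1 \<le> N \<Longrightarrow> \<exists>L. N \<le> 2 ^ L \<and> 2 ^ L \<le> 2 * N" for N :: nat
proof (induction N rule: dec_induct)
  case base
  show ?case by (intro exI[of _ 0]) simp
next
  case (step N)
  then obtain L where L: "N \<le> 2 ^ L" "2 ^ L \<le> 2 * N" by blast
  show ?case
  proof (cases "Suc N \<le> 2 ^ L")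
    case True
    then show ?thesis using L by (intro exI[of _ L]) simp
  next
    case False
    then have "2 ^ L = N" using L by simp
    then show ?thesis using step by (intro exI[of _ "Suc L"]) simp
  qed
qed

theorem theorem1p7:
  shows "\<exists>C::real. C > 0 \<and>
    (\<forall>n::nat. \<forall>f::bool list \<Rightarrow> bool. n \<ge> 1 \<longrightarrow> symmetric_fun n f \<longrightarrow>
      real (rand_cc (cube n) (cube n) (box_and f))
        \<le> C * real (quantum_cc (cube n) (cube n) (box_and f)) ^ 3)"
proof (intro exI[of _ "28227\<^sup>2"] conjI allI impI)
  fix n :: nat and f :: "bool list \<Rightarrow> bool"
  assume f: "symmetric_fun n f"
  let ?F = "box_and f"
  let ?R = "rand_cc (cube n) (cube n) ?F" and ?Q = "quantum_cc (cube n) (cube n) ?F"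
  have "\<exists>c a b \<psi> P. quantum_computes (cube n) (cube n) ?F a b \<psi> P \<and> q_qubits P = c"
    using quantum_protocol_exists by blast
  then have "\<exists>a b \<psi> P. quantum_computes (cube n) (cube n) ?F a b \<psi> P \<and> q_qubits P = ?Q"
    unfolding quantum_cc_def by (rule LeastI_ex)
  then obtain a b \<psi> P where P: "quantum_computes (cube n) (cube n) ?F a b \<psi> P" "q_qubits P = ?Q" by blast
  show "real ?R \<le> 28227\<^sup>2 * real ?Q ^ 3"
  proof (cases "?Q = 0 \<or> (\<forall>w\<le>n. of_weight n f w = of_weight n f 0)")
    case const: True
    have "?R = 0"
    proof (cases "?Q = 0")
      case True
      then show ?thesis using rand_cc_eq_0_of_zero_qubits[OF P(1)] P(2) by simp
    next
      case False
      have "\<forall>w\<le>n. of_weight n f w = of_weight n f 0" using const by (rule disjE) (erule notE[OF False], assumption)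
      then have c: "of_weight n f (n - l) = of_weight n f 0" for l by (rule allE[of _ "n - l"]) simp
      show ?thesis
        by (rule rand_cc_eq_0[of _ _ "Alice_outputs (\<lambda>_. of_weight n f 0)"]) (simp_all add: box_and_of_weight[OF f] c)
    qed
    then show ?thesis by simp
  next
    case False
    define m where "m = (LEAST w. of_weight n f w \<noteq> of_weight n f 0)"
    obtain w where w: "w \<le> n" "of_weight n f w \<noteq> of_weight n f 0" using False by blast
    have m0: "of_weight n f m \<noteq> of_weight n f 0" unfolding m_def by (rule LeastI[of _ w]) (rule w(2))
    have "m \<le> w" unfolding m_def by (rule Least_le) (rule w(2))
    then have mn: "m \<le> n" using w(1) by simp
    have m1: "1 \<le> m" using m0 by (cases m) auto
    have before: "of_weight n f w = of_weight n f 0" if "w < m" for w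
      using not_less_Least[of w] that unfolding m_def by blast
    define q where "q = ?Q"
    have q1: "1 \<le> q" using False by (simp add: q_def)
    \<comment> \<open>\<open>n - k = m - 1\<close> is the last weight before the change, and
      \<open>k\<close> is also the number of coordinates left once \<open>m - 1\<close> of them are
      fixed to one.\<close>
    define k where "k = n - m + 1"
    have k: "1 \<le> k" "k \<le> n" using m1 mn by (auto simp: k_def)
    have "k div 4 < 49 * (4 * q + 8)\<^sup>2"
      unfolding q_def P(2)[symmetric]
      by (rule quantum_lower_bound[OF f m1 mn _ _ P(1)]) (use before[of "m - 1"] m0 m1 mn in \<open>auto simp: k_def\<close>)
    \<comment> \<open>For \<open>q \<ge> 1\<close>, \<open>4 q + 8 \<le> 12 q\<close>, and
      \<open>49 * 144 = 7056\<close>. Undoing the division by \<open>4\<close> gives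
      \<open>28224\<close>, and its rounding adds the \<open>3\<close> in
      \<open>28227\<close>.\<close>
    also have "\<dots> \<le> 49 * (12 * q)\<^sup>2" using q1 by (intro mult_left_mono power_mono) auto
    also have "\<dots> = 7056 * q\<^sup>2" by (simp add: power_mult_distrib)
    finally have "k \<le> 28224 * q\<^sup>2 + 3" by linarith
    moreover have "1 \<le> q\<^sup>2" using q1 by simp
    ultimately have kq: "k \<le> 28227 * q\<^sup>2" by linarith
    have k2: "1 \<le> k\<^sup>2" using k by simp
    obtain L where L: "12 * k\<^sup>2 + 1 \<le> 2 ^ L" "2 ^ L \<le> 2 * (12 * k\<^sup>2 + 1)"
      using power_of_two_between[of "12 * k\<^sup>2 + 1"] by auto
    have "?R \<le> L * k"
      by (rule rand_cc_box_and_le[OF f k _ L(1)]) (rule before, use k mn m1 in \<open>simp add: k_def\<close>)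
    have "(L\<^sup>2)\<^sup>2 \<le> (24 * k)\<^sup>2"
    proof -
      have "(L\<^sup>2)\<^sup>2 = L ^ 4" by simp
      \<comment> \<open>By the choice of \<open>L\<close> this is at most
        \<open>42 (12 k^2 + 1) \<le> 546 k^2\<close>, and \<open>576 = 24^2\<close> is the next
        square that suffices.\<close>
      also have "\<dots> \<le> 21 * 2 ^ L" by (rule power4_le)
      also have "\<dots> \<le> (24 * k)\<^sup>2" using L(2) k2 unfolding power_mult_distrib by simp
      finally show ?thesis .
    qed
    then have L2: "L\<^sup>2 \<le> 24 * k" by (rule power2_le_imp_le) simp
    have "(L * k)\<^sup>2 = L\<^sup>2 * k\<^sup>2" by (rule power_mult_distrib)
    also have "\<dots> \<le> (24 * k) * k\<^sup>2" using L2 by (rule mult_right_mono) simp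
    also have "\<dots> = 24 * k ^ 3" by (simp add: power2_eq_square power3_eq_cube)
    \<comment> \<open>Enlarging \<open>24\<close> to \<open>28227\<close> makes the right-hand side
      the square of \<open>28227^2 * q^3\<close>, so that roots can be taken in the natural
      numbers.\<close>
    also have "\<dots> \<le> 28227 * (28227 * q\<^sup>2) ^ 3" using kq by (intro mult_mono power_mono) auto
    also have "\<dots> = (28227\<^sup>2 * q ^ 3)\<^sup>2" by (simp add: power_mult_distrib flip: power_mult)
    finally have "L * k \<le> 28227\<^sup>2 * q ^ 3" by (rule power2_le_imp_le) simp
    then have "?R \<le> 28227\<^sup>2 * q ^ 3" using \<open>?R \<le> L * k\<close> by linarith
    then have "real ?R \<le> real (28227\<^sup>2 * q ^ 3)" by (simp only: of_nat_le_iff)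
    then show ?thesis by (simp add: q_def)
  qed
qed simp

end
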